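(* A Steiner bundle $S\in\mathcal{S}_{n,k}$ on $\mathbf{P}^n$ is logarithmic if and only if it admits at least $n+k+1$ (distinct) unstable hyperplanes.
   Context: $V$ is a complex vector space of dimension $n+1$, and $\mathbf{P}^n=\mathbf{P}(V)$ with $H^0(\mathcal{O}(1))=V$; hyperplanes are points of $\mathbf{P}(V^* )$. A Steiner bundle over $\mathbf{P}^n$ is a vector bundle $S$ whose dual $S^*$ appears in an exact sequence $0\to S^*\to W\otimes\mathcal{O}\to I\otimes\mathcal{O}(1)\to 0$ with $W,I$ complex vector spaces of dimension $n+k$ and $k$; $\mathcal{S}_{n,k}$ denotes the family of such bundles. A hyperplane $H$ is an unstable hyperplane of $S$ if $h^0(S^*_{|H})\neq0$. A finite set of hyperplanes has normal crossing if any $m\le n+1$ of them have linearly independent equations. For a union $\mathcal{H}$ of hyperplanes with normal crossing, $\Omega(\log\mathcal{H})$ is the bundle of meromorphic $1$-forms with at most logarithmic poles along $\mathcal{H}$; when $\mathcal{H}$ consists of $n+k+1$ hyperplanes ($k\ge1$) it belongs to $\mathcal{S}_{n,k}$. A bundle $S\in\mathcal{S}_{n,k}$ is logarithmic if $S\simeq\Omega(\log\mathcal{H})$ for some such $\mathcal{H}$. *)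

theory Defs
  imports "HOL-Analysis.Analysis"
begin

text \<open>
  Everything is algebraic over \<open>\<complex>\<close>. Coordinates identify \<open>V\<close> and \<open>V\<^sup>*\<close> with
  \<open>complex ^ 'v\<close>, where \<open>CARD('v) = n + 1\<close>. The projective space \<open>P\<^sup>n = P(V)\<close> with
  \<open>H\<^sup>0(O(1)) = V\<close> consists of the lines of \<open>V\<^sup>*\<close>, so \<open>V\<close> is the space of linear forms
  in the homogeneous coordinates. The type \<open>'v proj\<close> also serves for the dual projective space.
\<close>

subsection \<open>Projective space\<close>

quotient_type (overloaded) 'v proj =
  "complex ^ ('v::finite)" / partial: "\<lambda>x y. x \<noteq> 0 \<and> y \<noteq> 0 \<and> (\<exists>c. y = c *s x)"
  morphisms coords pt
proof (rule part_equivpI)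
  show "\<exists>x::complex ^ 'v. x \<noteq> 0 \<and> x \<noteq> 0 \<and> (\<exists>c. x = c *s x)"
    by (rule exI[of _ "axis undefined 1"]) (auto simp: axis_eq_0_iff intro: exI[of _ 1])
  show "symp (\<lambda>x y::complex ^ 'v. x \<noteq> 0 \<and> y \<noteq> 0 \<and> (\<exists>c. y = c *s x))"
  proof (rule sympI, elim conjE exE)
    fix x y :: "complex ^ 'v" and c
    assume "x \<noteq> 0" "y \<noteq> 0" "y = c *s x"
    then have "x = inverse c *s y" by (cases "c = 0") (auto simp: vector_smult_assoc)
    with \<open>x \<noteq> 0\<close> \<open>y \<noteq> 0\<close> show "y \<noteq> 0 \<and> x \<noteq> 0 \<and> (\<exists>c. x = c *s y)" by blast
  qed
  show "transp (\<lambda>x y::complex ^ 'v. x \<noteq> 0 \<and> y \<noteq> 0 \<and> (\<exists>c. y = c *s x))"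
    by (rule transpI) (auto simp: vector_smult_assoc)
qed

text \<open>\<open>hpoly d p\<close>: \<open>p\<close> is the function of a homogeneous polynomial of degree \<open>d\<close>
  (the zero function has every degree).\<close>

inductive hpoly :: "nat \<Rightarrow> (complex ^ 'v \<Rightarrow> complex) \<Rightarrow> bool" where
  const: "hpoly 0 (\<lambda>_. c)"
| coord: "hpoly 1 (\<lambda>x. x $ i)"
| add: "hpoly d p \<Longrightarrow> hpoly d q \<Longrightarrow> hpoly d (\<lambda>x. p x + q x)"
| mult: "hpoly d p \<Longrightarrow> hpoly e q \<Longrightarrow> hpoly (d + e) (\<lambda>x. p x * q x)"

definition zariski_open :: "('v::finite) proj set \<Rightarrow> bool" where
  "zariski_open U \<longleftrightarrow>
    (\<exists>P. (\<forall>p\<in>P. \<exists>d. hpoly d p) \<and> U = {l. \<exists>p\<in>P. p (coords l) \<noteq> 0})"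

definition punctured_cone :: "('v::finite) proj set \<Rightarrow> (complex ^ 'v) set" where
  "punctured_cone Z = {x. x \<noteq> 0 \<and> pt x \<in> Z}"

text \<open>Sections of \<open>O(m)\<close> over \<open>Z\<close> as functions on the punctured cone, locally quotients
  \<open>p / q\<close> of homogeneous polynomials with \<open>deg p - deg q = m\<close>. The set \<open>Z\<close> may be any
  locally closed subset of \<open>P\<^sup>n\<close>, with its reduced structure; it will be
  open, or an open subset of a hyperplane.\<close>

definition homog_regular ::
  "int \<Rightarrow> ('v::finite) proj set \<Rightarrow> (complex ^ 'v \<Rightarrow> complex) \<Rightarrow> bool" where
  "homog_regular m Z f \<longleftrightarrow>
    (\<forall>x\<in>punctured_cone Z. \<exists>d e p q. hpoly d p \<and> hpoly e q \<and> int d = int e + m \<and> q x \<noteq> 0 \<and>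
      (\<forall>y\<in>punctured_cone Z. q y \<noteq> 0 \<longrightarrow> f y = p y / q y))"

definition regular_on :: "('v::finite) proj set \<Rightarrow> ('v proj \<Rightarrow> complex) \<Rightarrow> bool" where
  "regular_on Z f \<longleftrightarrow> homog_regular 0 Z (\<lambda>x. f (pt x))"

definition pairing :: "complex ^ 'v \<Rightarrow> complex ^ 'v \<Rightarrow> complex" where
  "pairing \<xi> x = (\<Sum>i\<in>UNIV. \<xi> $ i * x $ i)"

text \<open>A point \<open>h\<close> of \<open>P(V\<^sup>*)\<close> is a nonzero linear form up to a scalar, that is, a hyperplane.\<close>

definition hyperplane :: "('v::finite) proj \<Rightarrow> 'v proj set" where
  "hyperplane h = {l. pairing (coords h) (coords l) = 0}"

definition normal_crossing :: "('v::finite) proj set \<Rightarrow> bool" where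
  "normal_crossing \<H> \<longleftrightarrow> finite \<H> \<and>
    (\<forall>M\<subseteq>\<H>. card M \<le> CARD('v) \<longrightarrow> vec.independent (coords ` M))"


subsection \<open>Vector bundles\<close>

text \<open>A vector bundle of rank \<open>CARD('r)\<close> is given by a trivialising open cover and transition
  matrices: a vector with components \<open>w\<close> in the chart \<open>b\<close> has components
  \<open>transition E a b x *v w\<close> in the chart \<open>a\<close>.\<close>

record ('a, 'v, 'r) vbundle =
  chart_dom :: "'a \<Rightarrow> 'v proj set"
  transition :: "'a \<Rightarrow> 'a \<Rightarrow> 'v proj \<Rightarrow> complex ^ 'r ^ 'r"

definition vector_bundle :: "('a, 'v::finite, 'r::finite) vbundle \<Rightarrow> bool" where
  "vector_bundle E \<longleftrightarrow>
    (\<forall>a. zariski_open (chart_dom E a)) \<and>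
    (\<Union>a. chart_dom E a) = UNIV \<and>
    (\<forall>a b i j. regular_on (chart_dom E a \<inter> chart_dom E b) (\<lambda>x. transition E a b x $ i $ j)) \<and>
    (\<forall>a. \<forall>x\<in>chart_dom E a. transition E a a x = mat 1) \<and>
    (\<forall>a b c. \<forall>x\<in>chart_dom E a \<inter> chart_dom E b \<inter> chart_dom E c.
      transition E a b x ** transition E b c x = transition E a c x)"

text \<open>On the overlaps \<open>transition E b a x\<close> is the inverse of \<open>transition E a b x\<close>, so the
  dual has the usual inverse transposed cocycle.\<close>

definition dual :: "('a, 'v::finite, 'r::finite) vbundle \<Rightarrow> ('a, 'v, 'r) vbundle" where
  "dual E = \<lparr>chart_dom = chart_dom E, transition = (\<lambda>a b x. transpose (transition E b a x))\<rparr>"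

text \<open>\<open>W \<otimes> O\<close> for \<open>W = complex ^ 'w\<close>.\<close>

definition trivial_bundle :: "(unit, 'v::finite, 'w::finite) vbundle" where
  "trivial_bundle = \<lparr>chart_dom = (\<lambda>_. UNIV), transition = (\<lambda>_ _ _. mat 1)\<rparr>"

text \<open>\<open>I \<otimes> O(1)\<close> for \<open>I = complex ^ 'i\<close>: a linear form \<open>\<xi>\<close> is the global section of \<open>O(1)\<close>
  with component \<open>\<xi> / x\<^sub>a\<close> in the chart \<open>x\<^sub>a \<noteq> 0\<close>.\<close>

definition twisted_bundle :: "('v, 'v::finite, 'i::finite) vbundle" where
  "twisted_bundle =
    \<lparr>chart_dom = (\<lambda>a. {l. coords l $ a \<noteq> 0}),
     transition = (\<lambda>a b l. mat (coords l $ b / coords l $ a))\<rparr>"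

text \<open>\<open>A a b\<close> is the matrix of the morphism in the charts \<open>a\<close> of \<open>E\<close> and \<open>b\<close> of \<open>F\<close>.\<close>

definition bundle_hom ::
  "('a, 'v::finite, 'r::finite) vbundle \<Rightarrow> ('b, 'v, 's::finite) vbundle \<Rightarrow>
    ('a \<Rightarrow> 'b \<Rightarrow> 'v proj \<Rightarrow> complex ^ 'r ^ 's) \<Rightarrow> bool" where
  "bundle_hom E F A \<longleftrightarrow>
    (\<forall>a b i j. regular_on (chart_dom E a \<inter> chart_dom F b) (\<lambda>x. A a b x $ i $ j)) \<and>
    (\<forall>a a' b b'. \<forall>x\<in>chart_dom E a \<inter> chart_dom E a' \<inter> chart_dom F b \<inter> chart_dom F b'.
      A a' b' x ** transition E a' a x = transition F b' b x ** A a b x)"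

text \<open>Exactness of \<open>0 \<rightarrow> E \<rightarrow> F \<rightarrow> G \<rightarrow> 0\<close>; as all terms are vector bundles it is
  exactness on the fibres.\<close>

definition short_exact ::
  "('a, 'v::finite, 'r::finite) vbundle \<Rightarrow> ('a \<Rightarrow> 'b \<Rightarrow> 'v proj \<Rightarrow> complex ^ 'r ^ 's) \<Rightarrow>
    ('b, 'v, 's::finite) vbundle \<Rightarrow> ('b \<Rightarrow> 'c \<Rightarrow> 'v proj \<Rightarrow> complex ^ 's ^ 't) \<Rightarrow>
    ('c, 'v, 't::finite) vbundle \<Rightarrow> bool" where
  "short_exact E A F B G \<longleftrightarrow> bundle_hom E F A \<and> bundle_hom F G B \<and>
    (\<forall>a b c. \<forall>x\<in>chart_dom E a \<inter> chart_dom F b \<inter> chart_dom G c.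
      inj ((*v) (A a b x)) \<and>
      range ((*v) (A a b x)) = {w. B b c x *v w = 0} \<and>
      surj ((*v) (B b c x)))"

text \<open>The family \<open>S\<^sub>n\<^sub>,\<^sub>k\<close>, with \<open>n + 1 = CARD('v)\<close>, \<open>n + k = CARD('w)\<close>, \<open>k = CARD('i)\<close>.\<close>

definition steiner_bundle ::
  "('w::finite) itself \<Rightarrow> ('i::finite) itself \<Rightarrow> ('a, 'v::finite, 'r::finite) vbundle \<Rightarrow> bool" where
  "steiner_bundle _ _ S \<longleftrightarrow> vector_bundle S \<and>
    (\<exists>A B. short_exact (dual S) A (trivial_bundle :: (unit, 'v, 'w) vbundle)
      B (twisted_bundle :: ('v, 'v, 'i) vbundle))"

text \<open>The sections over \<open>Z\<close> of the restriction of \<open>E\<close> to \<open>Z\<close>, by their components in the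
  charts. The components are set to zero where they are meaningless, so that equality of
  sections is equality of functions.\<close>

definition sections ::
  "('a, 'v::finite, 'r::finite) vbundle \<Rightarrow> 'v proj set \<Rightarrow> ('a \<Rightarrow> 'v proj \<Rightarrow> complex ^ 'r) set" where
  "sections E Z = {s.
    (\<forall>a i. regular_on (chart_dom E a \<inter> Z) (\<lambda>x. s a x $ i)) \<and>
    (\<forall>a b. \<forall>x\<in>chart_dom E a \<inter> chart_dom E b \<inter> Z. s a x = transition E a b x *v s b x) \<and>
    (\<forall>a x. x \<notin> chart_dom E a \<inter> Z \<longrightarrow> s a x = 0)}"

definition unstable_hyperplane ::
  "('a, 'v::finite, 'r::finite) vbundle \<Rightarrow> 'v proj \<Rightarrow> bool" where
  "unstable_hyperplane S h \<longleftrightarrow> (\<exists>s\<in>sections (dual S) (hyperplane h). s \<noteq> (\<lambda>_ _. 0))"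


subsection \<open>Logarithmic forms\<close>

text \<open>A regular 1-form on \<open>U\<close> is identified with its pullback \<open>\<Sum>\<^sub>i \<omega>\<^sub>i dx\<^sub>i\<close> to the punctured cone.
  The pullbacks are the forms with coefficients homogeneous of degree \<open>-1\<close> that
  vanish on the Euler vector field (Euler sequence).\<close>

definition one_forms :: "('v::finite) proj set \<Rightarrow> (complex ^ 'v \<Rightarrow> complex ^ 'v) set" where
  "one_forms U = {\<omega>.
    (\<forall>i. homog_regular (- 1) U (\<lambda>x. \<omega> x $ i)) \<and>
    (\<forall>x\<in>punctured_cone U. pairing (\<omega> x) x = 0) \<and>
    (\<forall>x. x \<notin> punctured_cone U \<longrightarrow> \<omega> x = 0)}"

definition differential :: "(('v::finite) proj \<Rightarrow> complex) \<Rightarrow> complex ^ 'v \<Rightarrow> complex ^ 'v" where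
  "differential f x = (\<chi> i. deriv (\<lambda>t. f (pt (x + t *s axis i 1))) 0)"

definition dlog :: "(('v::finite) proj \<Rightarrow> complex) \<Rightarrow> complex ^ 'v \<Rightarrow> complex ^ 'v" where
  "dlog f x = (1 / f (pt x)) *s differential f x"

text \<open>An equation of the hyperplane \<open>h\<close> on the open set where the linear form \<open>\<mu>\<close> is not zero.\<close>

definition local_equation ::
  "complex ^ 'v \<Rightarrow> ('v::finite) proj \<Rightarrow> 'v proj \<Rightarrow> complex" where
  "local_equation \<mu> h l = pairing (coords h) (coords l) / pairing \<mu> (coords l)"

text \<open>Sections over \<open>U\<close> of \<open>\<Omega>(log \<H>)\<close> for a normal crossing \<open>\<H>\<close>: forms regular on \<open>U\<close> off the
  hyperplanes and, near each point \<open>l\<close> of \<open>U\<close>, of the form \<open>\<theta> + \<Sum> u\<^sub>h dlog z\<^sub>h\<close> with \<open>\<theta>\<close>, \<open>u\<^sub>h\<close>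
  regular and \<open>z\<^sub>h = 0\<close> local equations of the hyperplanes \<open>h\<close> through \<open>l\<close>.\<close>

definition log_forms ::
  "('v::finite) proj set \<Rightarrow> 'v proj set \<Rightarrow> (complex ^ 'v \<Rightarrow> complex ^ 'v) set" where
  "log_forms \<H> U = {\<omega>.
    \<omega> \<in> one_forms (U - (\<Union>h\<in>\<H>. hyperplane h)) \<and>
    (\<forall>l\<in>U. \<exists>N \<mu> u \<theta>. zariski_open N \<and> l \<in> N \<and> N \<subseteq> U \<and>
      (\<forall>m\<in>N. pairing \<mu> (coords m) \<noteq> 0) \<and>
      (\<forall>h\<in>\<H>. regular_on N (u h)) \<and> \<theta> \<in> one_forms N \<and>
      (\<forall>x\<in>punctured_cone (N - (\<Union>h\<in>\<H>. hyperplane h)).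
        \<omega> x = \<theta> x +
          (\<Sum>h\<in>{h\<in>\<H>. l \<in> hyperplane h}. u h (pt x) *s dlog (local_equation \<mu> h) x)))}"

text \<open>An isomorphism of sheaves of \<open>O\<close>-modules from the sheaf of sections of \<open>S\<close> to \<open>\<Omega>(log \<H>)\<close>.\<close>

definition sheaf_iso_log ::
  "('a, 'v::finite, 'r::finite) vbundle \<Rightarrow> 'v proj set \<Rightarrow>
    ('v proj set \<Rightarrow> ('a \<Rightarrow> 'v proj \<Rightarrow> complex ^ 'r) \<Rightarrow> complex ^ 'v \<Rightarrow> complex ^ 'v) \<Rightarrow> bool" where
  "sheaf_iso_log S \<H> \<phi> \<longleftrightarrow>
    (\<forall>U. zariski_open U \<longrightarrow>
      bij_betw (\<phi> U) (sections S U) (log_forms \<H> U) \<and>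
      (\<forall>s\<in>sections S U. \<forall>t\<in>sections S U.
        \<phi> U (\<lambda>a x. s a x + t a x) = (\<lambda>x. \<phi> U s x + \<phi> U t x)) \<and>
      (\<forall>f. \<forall>s\<in>sections S U. regular_on U f \<longrightarrow>
        \<phi> U (\<lambda>a x. f x *s s a x) = (\<lambda>x. f (pt x) *s \<phi> U s x)) \<and>
      (\<forall>U'. \<forall>s\<in>sections S U. zariski_open U' \<and> U' \<subseteq> U \<longrightarrow>
        \<phi> U' (\<lambda>a x. if x \<in> U' then s a x else 0) =
          (\<lambda>x. if x \<in> punctured_cone U' then \<phi> U s x else 0)))"

definition logarithmic_bundle ::
  "nat \<Rightarrow> ('a, 'v::finite, 'r::finite) vbundle \<Rightarrow> bool" where
  "logarithmic_bundle m S \<longleftrightarrow>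
    (\<exists>\<H>. normal_crossing \<H> \<and> card \<H> = m \<and> (\<exists>\<phi>. sheaf_iso_log S \<H> \<phi>))"

end

theory Submission
  imports Defs "HOL-Complex_Analysis.Cauchy_Integral_Formula"
begin

text \<open>
  Since global sections of \<open>O(1)\<close> are linear forms, \<open>S\<close> is given by a bilinear map
  \<open>B : V\<^sup>* \<times> W \<rightarrow> I\<close> with \<open>B x\<close> onto for \<open>x \<noteq> 0\<close>, the fibre of the dual bundle at \<open>x\<close> being the
  kernel of \<open>B x\<close>. As functions on a hyperplane are constant, an unstable hyperplane \<open>h\<close> is the
  same as a vector \<open>w\<close> with \<open>B x w = h(x) \<iota>\<close>, a pure tensor \<open>\<iota> \<otimes> h\<close> in \<open>W \<subseteq> I \<otimes> V\<close>.

  If \<open>k \<ge> 2\<close>, the Hopf-type inequality for nonsingular complex bilinear maps forces such tensors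
  with distinct \<open>h\<close> into general position: any \<open>k\<close> of the \<open>\<iota>\<close>, any \<open>n + 1\<close> of the \<open>h\<close> and any
  \<open>n + k\<close> of the \<open>w\<close> are independent. Hence \<open>n + k + 1\<close> of them satisfy exactly one relation, which
  can be scaled to \<open>\<Sum> w h = 0\<close>. A section of \<open>S\<close>, lifted to a covector \<open>\<eta>\<close> on \<open>W\<close>, is then sent to
  the logarithmic form \<open>\<Sum> \<eta>(w h) dh / h\<close>, and this is an isomorphism. If \<open>k = 1\<close>, every
  hyperplane is unstable and \<open>n + 2\<close> of them can be chosen in general position.

  Conversely, under an isomorphism of \<open>S\<close> with logarithmic forms the residue along a hyperplane
  \<open>h\<close> becomes a nonzero section over \<open>h\<close> of the dual of \<open>S\<close>.
\<close>

subsection \<open>Linear algebra\<close>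

text \<open>Distinct hyperplanes only give pairwise independent \<open>h\<close>; general position
  has to be extracted from the surjectivity of \<open>B x\<close> at every point, in two passes.
  Pairwise independence of one family of factors forces the other family into general position, so
  the \<open>h\<close> control the \<open>\<iota>\<close>, and for k >= 2 the \<open>\<iota>\<close>
  control the \<open>h\<close>. The normalisation \<Sum> w h = 0 has a double effect. It makes the
  coefficients of \<Sum> \<eta>(w h) dh / h sum to 0, so the form vanishes on the Euler field, and
  it makes the transposed map land in the fibre of the dual bundle. Uniqueness of the relation gives
  injectivity, normal crossing gives local surjectivity. All passages to the hyperplanes themselves
  are limits along complex lines in general position, so residues, extension of identities and
  global sections reduce to functions of one variable.\<close>

lemma pairing_add_left: "pairing (a + b) x = pairing a x + pairing b x"
  and pairing_add_right: "pairing a (x + y) = pairing a x + pairing a y"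
  and pairing_scale_left: "pairing (c *s a) x = c * pairing a x"
  and pairing_scale_right: "pairing a (c *s x) = c * pairing a x"
  and pairing_0_left [simp]: "pairing 0 x = 0"
  and pairing_0_right [simp]: "pairing a 0 = 0"
  by (simp_all add: pairing_def algebra_simps sum.distrib sum_distrib_left)

lemma pairing_diff_left: "pairing (a - b) x = pairing a x - pairing b x"
  by (simp add: pairing_def algebra_simps sum_subtractf)

lemma pairing_sum_left: "pairing (\<Sum>t\<in>T. f t) x = (\<Sum>t\<in>T. pairing (f t) x)"
  by (induction T rule: infinite_finite_induct) (simp_all add: pairing_add_left)

lemma pairing_sum_right: "pairing a (\<Sum>t\<in>T. f t) = (\<Sum>t\<in>T. pairing a (f t))"
  by (induction T rule: infinite_finite_induct) (simp_all add: pairing_add_right)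

lemma pairing_commute: "pairing a b = pairing b a"
  by (simp add: pairing_def mult.commute)

lemma pairing_axis_right [simp]: "pairing a (axis i 1) = a $ i"
  by (simp add: pairing_def axis_def if_distrib cong: if_cong)

lemma pairing_axis_left [simp]: "pairing (axis i 1) a = a $ i"
  by (simp add: pairing_commute[of "axis i 1"])

lemma pairing_eqI: "(\<And>x. pairing a x = pairing b x) \<Longrightarrow> a = b"
  by (metis pairing_axis_right vec_eq_iff)

lemma pairing_eq_0I: "(\<And>x. pairing a x = 0) \<Longrightarrow> a = 0"
  by (rule pairing_eqI) simp

lemma pairing_transpose: "pairing a (A *v x) = pairing (transpose A *v a) x"
proof -
  have "pairing a (A *v x) = (\<Sum>i\<in>UNIV. \<Sum>j\<in>UNIV. a $ i * (A $ i $ j * x $ j))"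
    by (simp add: pairing_def matrix_vector_mult_def sum_distrib_left)
  also have "\<dots> = (\<Sum>j\<in>UNIV. \<Sum>i\<in>UNIV. a $ i * (A $ i $ j * x $ j))"
    by (rule sum.swap)
  also have "\<dots> = pairing (transpose A *v a) x"
    by (simp add: pairing_def matrix_vector_mult_def transpose_def sum_distrib_right sum_distrib_left)
      (simp add: mult_ac)
  finally show ?thesis .
qed

lemma continuous_on_pairing [continuous_intros]:
  "continuous_on S f \<Longrightarrow> continuous_on S (\<lambda>x. pairing a (f x))"
  unfolding pairing_def by (intro continuous_intros)

section \<open>Underdetermined systems of linear equations\<close>

lemma nontrivial_solution:
  fixes a :: "'i \<Rightarrow> 'j \<Rightarrow> 'f::field"
  assumes "finite J" "finite I" "card J < card I"
  shows "\<exists>c. (\<exists>i\<in>I. c i \<noteq> 0) \<and> (\<forall>j\<in>J. (\<Sum>i\<in>I. c i * a i j) = 0)"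
  using assms
proof (induction J arbitrary: I a rule: finite_induct)
  case empty
  then have "I \<noteq> {}" by auto
  then show ?case by (intro exI[of _ "\<lambda>_. 1"]) auto
next
  case (insert j J)
  show ?case
  proof (cases "\<forall>i\<in>I. a i j = 0")
    case True
    obtain c where "\<exists>i\<in>I. c i \<noteq> 0" "\<forall>j\<in>J. (\<Sum>i\<in>I. c i * a i j) = 0"
      using insert.IH[of I a] insert.prems insert.hyps by auto
    with True show ?thesis by (intro exI[of _ c]) auto
  next
    case False
    then obtain p where p: "p \<in> I" "a p j \<noteq> 0" by blast
    define a' where "a' i l = a i l - a i j / a p j * a p l" for i l
    have "card J < card (I - {p})"
      using insert.prems insert.hyps p by simp
    then obtain c where c: "\<exists>i\<in>I - {p}. c i \<noteq> 0" "\<forall>l\<in>J. (\<Sum>i\<in>I - {p}. c i * a' i l) = 0"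
      using insert.IH[of "I - {p}" a'] insert.prems by auto
    define q where "q = - (\<Sum>i\<in>I - {p}. c i * a i j) / a p j"
    have sum_eq: "(\<Sum>i\<in>I. (c(p := q)) i * a i l) = q * a p l + (\<Sum>i\<in>I - {p}. c i * a i l)" for l
      using p insert.prems by (simp add: sum.remove)
    have "(\<Sum>i\<in>I. (c(p := q)) i * a i l) = 0" if "l \<in> insert j J" for l
    proof (cases "l = j")
      case True
      then show ?thesis using p unfolding sum_eq by (simp add: q_def)
    next
      case False
      then have "0 = (\<Sum>i\<in>I - {p}. c i * a' i l)" using that c by simp
      also have "\<dots> = (\<Sum>i\<in>I - {p}. c i * a i l) - (\<Sum>i\<in>I - {p}. c i * a i j) / a p j * a p l"
        by (simp add: a'_def algebra_simps sum_subtractf sum_distrib_left sum_divide_distrib)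
      finally show ?thesis unfolding sum_eq by (simp add: q_def)
    qed
    moreover have "\<exists>i\<in>I. (c(p := q)) i \<noteq> 0" using c by auto
    ultimately show ?thesis by blast
  qed
qed

definition linear_form :: "(complex ^ 'n \<Rightarrow> complex) \<Rightarrow> bool" where
  "linear_form f \<longleftrightarrow> (\<forall>u v. f (u + v) = f u + f v) \<and> (\<forall>c u. f (c *s u) = c * f u)"

lemma linear_form_sum:
  assumes "linear_form f"
  shows "f (\<Sum>t\<in>T. c t *s u t) = (\<Sum>t\<in>T. c t * f (u t))"
proof -
  have "f 0 = 0" using assms unfolding linear_form_def by (metis mult_zero_left vector_smult_lzero)
  then show ?thesis
    using assms by (induction T rule: infinite_finite_induct) (simp_all add: linear_form_def)
qed

lemma linear_form_pairing: "linear_form (pairing a)"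
  by (simp add: linear_form_def pairing_add_right pairing_scale_right)

text \<open>Fewer equations than unknowns, with the set of forms itself as index set. This suits the
  later dimension counts, where the equations come from several families and may coincide.\<close>

lemma linear_form_common_zero:
  fixes F :: "(complex ^ 'n::finite \<Rightarrow> complex) set"
  assumes "finite F" "card F < CARD('n)" "\<And>f. f \<in> F \<Longrightarrow> linear_form f"
  shows "\<exists>u. u \<noteq> 0 \<and> (\<forall>f\<in>F. f u = 0)"
proof -
  obtain c where c: "\<exists>i\<in>(UNIV::'n set). c i \<noteq> 0"
    "\<forall>f\<in>F. (\<Sum>i\<in>UNIV. c i * f (axis i 1)) = 0"
    using nontrivial_solution[of F "UNIV::'n set" "\<lambda>i f. f (axis i 1)"] assms by auto
  define u where "u = (\<chi> i. c i)"
  have "f u = 0" if "f \<in> F" for f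
  proof -
    have "f u = f (\<Sum>i\<in>UNIV. u $ i *s axis i 1)" by (simp add: basis_expansion)
    also have "\<dots> = 0" using c that assms(3) unfolding linear_form_sum[OF assms(3)[OF that]]
      by (simp add: u_def)
    finally show ?thesis .
  qed
  moreover have "u \<noteq> 0" using c by (auto simp: u_def vec_eq_iff)
  ultimately show ?thesis by blast
qed

text \<open>Independence of an indexed family: a repetition \<open>f s = f t\<close> is a dependence
  here, while \<open>vec.independent\<close> of the image would not see it.\<close>

definition lin_indep :: "('t \<Rightarrow> complex ^ 'n) \<Rightarrow> 't set \<Rightarrow> bool" where
  "lin_indep f T \<longleftrightarrow> (\<forall>c. (\<Sum>t\<in>T. c t *s f t) = 0 \<longrightarrow> (\<forall>t\<in>T. c t = 0))"

lemma lin_indepD: "lin_indep f T \<Longrightarrow> (\<Sum>t\<in>T. c t *s f t) = 0 \<Longrightarrow> t \<in> T \<Longrightarrow> c t = 0"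
  unfolding lin_indep_def by blast

lemma lin_indep_subset:
  assumes "lin_indep f T" "R \<subseteq> T" "finite T"
  shows "lin_indep f R"
  unfolding lin_indep_def
proof (intro allI impI ballI)
  fix c t assume c: "(\<Sum>t\<in>R. c t *s f t) = 0" and t: "t \<in> R"
  have "(\<Sum>t\<in>T. (if t \<in> R then c t else 0) *s f t) = (\<Sum>t\<in>R. c t *s f t)"
    using assms by (intro sum.mono_neutral_cong_right) auto
  with c lin_indepD[OF assms(1), of "\<lambda>t. if t \<in> R then c t else 0" t] t assms(2)
  show "c t = 0" by auto
qed

lemma lin_indep_nonzero:
  assumes "lin_indep f T" "t \<in> T" "finite T"
  shows "f t \<noteq> 0"
proof
  assume "f t = 0"
  moreover have "lin_indep f {t}" using assms lin_indep_subset by blast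
  ultimately show False using lin_indepD[of f "{t}" "\<lambda>_. 1" t] by simp
qed

lemma lin_indep_insert:
  assumes "lin_indep f T" "finite T" "t \<notin> T" and "\<And>c. f t \<noteq> (\<Sum>r\<in>T. c r *s f r)"
  shows "lin_indep f (insert t T)"
  unfolding lin_indep_def
proof (intro allI impI)
  fix c assume c: "(\<Sum>r\<in>insert t T. c r *s f r) = 0"
  then have *: "c t *s f t + (\<Sum>r\<in>T. c r *s f r) = 0" using assms by simp
  have "c t = 0"
  proof (rule ccontr)
    assume nz: "c t \<noteq> 0"
    have "f t = inverse (c t) *s (c t *s f t)" using nz by (simp add: vector_smult_assoc)
    also have "\<dots> = inverse (c t) *s (- (\<Sum>r\<in>T. c r *s f r))"
      using * by (simp add: add_eq_0_iff2)
    also have "\<dots> = (\<Sum>r\<in>T. (- inverse (c t) * c r) *s f r)"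
      by (simp add: vec.scale_sum_right vector_smult_assoc sum_negf vec.scale_minus_right)
    finally show False using assms(4)[of "\<lambda>r. - inverse (c t) * c r"] by simp
  qed
  with * have "\<forall>r\<in>T. c r = 0" using lin_indepD[OF assms(1), of c] by simp
  with \<open>c t = 0\<close> show "\<forall>r\<in>insert t T. c r = 0" by simp
qed

lemma lin_indep_imp_independent:
  assumes "lin_indep f T" "finite T"
  shows "inj_on f T" and "vec.independent (f ` T)"
proof -
  show inj: "inj_on f T"
  proof (rule inj_onI, rule ccontr)
    fix s t assume st: "s \<in> T" "t \<in> T" "f s = f t" "s \<noteq> t"
    then have "lin_indep f {s, t}" using assms lin_indep_subset[of f T "{s,t}"] by blast
    then show False
      using lin_indepD[of f "{s, t}" "\<lambda>r. if r = s then 1 else - 1" s] st by simp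
  qed
  show "vec.independent (f ` T)"
  proof (rule vec.independent_if_scalars_zero)
    fix c x assume "(\<Sum>x\<in>f ` T. c x *s x) = 0" "x \<in> f ` T"
    then show "c x = 0"
      using lin_indepD[OF assms(1), of "c \<circ> f"] inj by (auto simp: sum.reindex)
  qed (use assms in simp)
qed

lemma independent_imp_lin_indep:
  assumes "finite T" "inj_on f T" "vec.independent (f ` T)"
  shows "lin_indep f T"
  unfolding lin_indep_def
proof (intro allI impI ballI)
  fix c t assume c: "(\<Sum>t\<in>T. c t *s f t) = 0" and t: "t \<in> T"
  define g where "g = the_inv_into T f"
  have "(\<Sum>x\<in>f ` T. c (g x) *s x) = (\<Sum>t\<in>T. c t *s f t)"
    using assms by (simp add: sum.reindex g_def the_inv_into_f_f)
  then have "c (g (f t)) = 0"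
    using c t assms vec.dependent_finite[of "f ` T"] by auto
  then show "c t = 0" using assms t by (simp add: g_def the_inv_into_f_f)
qed

lemma lin_indep_card_le:
  fixes f :: "'t \<Rightarrow> complex ^ 'n::finite"
  assumes "lin_indep f T" "finite T"
  shows "card T \<le> CARD('n)"
proof (rule ccontr)
  assume "\<not> card T \<le> CARD('n)"
  then obtain c where c: "\<exists>t\<in>T. c t \<noteq> 0" "\<forall>i. (\<Sum>t\<in>T. c t * f t $ i) = 0"
    using nontrivial_solution[of "UNIV :: 'n set" T "\<lambda>t i. f t $ i"] assms by auto
  then have "(\<Sum>t\<in>T. c t *s f t) = 0" by (simp add: vec_eq_iff)
  with c lin_indepD[OF assms(1)] show False by blast
qed

text \<open>If \<open>y\<close> were outside the span, adjoining it under the new index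
  \<open>None\<close> would produce more independent vectors than the dimension allows.\<close>

lemma lin_indep_span:
  fixes f :: "'t \<Rightarrow> complex ^ 'n::finite"
  assumes "lin_indep f T" "finite T" "card T = CARD('n)"
  obtains c where "y = (\<Sum>t\<in>T. c t *s f t)"
proof (rule ccontr)
  assume neg: "\<not> thesis"
  define g where "g = (\<lambda>t. case t of None \<Rightarrow> y | Some t \<Rightarrow> f t)"
  have *: "(\<Sum>r\<in>Some ` T. c r *s g r) = (\<Sum>t\<in>T. c (Some t) *s f t)" for c
    by (simp add: sum.reindex g_def)
  have "lin_indep g (Some ` T)"
    unfolding lin_indep_def *
  proof (intro allI impI ballI)
    fix c r assume "(\<Sum>t\<in>T. c (Some t) *s f t) = 0" "r \<in> Some ` T"
    then show "c r = 0" using lin_indepD[OF assms(1), of "\<lambda>t. c (Some t)"] by auto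
  qed
  then have "lin_indep g (insert None (Some ` T))"
  proof (rule lin_indep_insert)
    fix c
    have "y \<noteq> (\<Sum>t\<in>T. c (Some t) *s f t)" using neg that[of "\<lambda>t. c (Some t)"] by blast
    then show "g None \<noteq> (\<Sum>r\<in>Some ` T. c r *s g r)" unfolding * by (simp add: g_def)
  qed (use assms in auto)
  from lin_indep_card_le[OF this] show False
    using assms by (simp add: card_image)
qed

lemma dual_vector:
  fixes f :: "'t \<Rightarrow> complex ^ 'n::finite"
  assumes "lin_indep f T" "finite T" "t \<in> T"
  obtains v where "pairing (f t) v = 1" "\<And>s. s \<in> T \<Longrightarrow> s \<noteq> t \<Longrightarrow> pairing (f s) v = 0"
proof -
  have inj: "inj_on f T" and ind: "vec.independent (f ` T)"
    using lin_indep_imp_independent assms by blast+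
  \<comment> \<open>Only one coordinate of \<open>g\<close> matters: \<open>undefined\<close> serves
    as an arbitrary fixed index, and \<open>g x $ undefined\<close> as a function of
    \<open>x\<close> is the functional dual to \<open>f t\<close>.\<close>
  obtain g :: "complex ^ 'n \<Rightarrow> complex ^ 'n" where g: "Vector_Spaces.linear (*s) (*s) g"
    "\<forall>x\<in>f ` T. g x = (if x = f t then axis undefined 1 else 0)"
    using vec.linear_independent_extend[OF ind, of "\<lambda>x. if x = f t then axis undefined 1 else 0"]
    by blast
  define v where "v = (\<chi> i. g (axis i 1) $ undefined)"
  have "pairing x v = g x $ undefined" for x
    by (subst linear_componentwise[OF g(1)]) (simp add: pairing_def v_def)
  then show thesis
    using g(2) assms inj that[of v] by (auto simp: inj_on_eq_iff)
qed

text \<open>\<open>B\<close> is the part of a completed basis outside the family. Evaluation on it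
  gives coordinates on the annihilator of the family, so that membership of a covector in zero can
  be tested there by \<open>CARD('n) - card T\<close> equations.\<close>

lemma lin_indep_extend:
  fixes f :: "'t \<Rightarrow> complex ^ 'n::finite"
  assumes "lin_indep f T" "finite T"
  obtains B where "finite B" "card B + card T = CARD('n)"
    "\<And>z. (\<And>t. t \<in> T \<Longrightarrow> pairing z (f t) = 0) \<Longrightarrow> (\<And>b. b \<in> B \<Longrightarrow> pairing z b = 0) \<Longrightarrow> z = 0"
proof -
  have inj: "inj_on f T" and ind: "vec.independent (f ` T)"
    using lin_indep_imp_independent assms by blast+
  define C where "C = vec.extend_basis (f ` T)"
  have C: "vec.independent C" "vec.span C = UNIV" "f ` T \<subseteq> C"
    unfolding C_def using ind
    by (simp_all add: vec.independent_extend_basis vec.extend_basis_superset)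
  have fin: "finite C" using C vec.finiteI_independent by blast
  have card: "card C = CARD('n)"
    using C by (metis vec.dim_eq_card vec.dim_span vec.span_UNIV vec_dim_card)
  show thesis
  proof
    show "finite (C - f ` T)" using fin by simp
    show "card (C - f ` T) + card T = CARD('n)"
      using fin C card inj assms card_mono[OF fin C(3)]
      by (simp add: card_Diff_subset card_image)
    fix z assume z: "\<And>t. t \<in> T \<Longrightarrow> pairing z (f t) = 0" "\<And>b. b \<in> C - f ` T \<Longrightarrow> pairing z b = 0"
    have "vec.span C \<subseteq> {y. pairing z y = 0}"
      using z by (intro vec.span_minimal)
        (auto simp: vec.subspace_def pairing_add_right pairing_scale_right)
    then show "z = 0" using C(2) by (intro pairing_eq_0I) blast
  qed
qed

section \<open>The Hermitian norm\<close>

lemma norm_vec_power2: "(norm (x :: complex ^ 'n::finite))\<^sup>2 = (\<Sum>i\<in>UNIV. (cmod (x $ i))\<^sup>2)"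
  by (simp add: norm_vec_def L2_set_def sum_nonneg)

text \<open>Orthogonality removes the cross term. The condition is complex linear in
  \<open>d\<close>, since the conjugate falls on \<open>x\<close>, so it counts as a single linear
  equation.\<close>

lemma norm_add_orthogonal:
  fixes x d :: "complex ^ 'n::finite"
  assumes "(\<Sum>i\<in>UNIV. cnj (x $ i) * d $ i) = 0"
  shows "(norm (x + t *s d))\<^sup>2 = (norm x)\<^sup>2 + (cmod t)\<^sup>2 * (norm d)\<^sup>2"
proof -
  have pt: "(cmod (a + t * b))\<^sup>2 = (cmod a)\<^sup>2 + 2 * Re (t * (cnj a * b)) + (cmod t)\<^sup>2 * (cmod b)\<^sup>2"
    for a b :: complex
    by (simp add: cmod_power2) (simp add: power2_eq_square algebra_simps)
  have "(norm (x + t *s d))\<^sup>2 = (norm x)\<^sup>2 + 2 * Re (t * (\<Sum>i\<in>UNIV. cnj (x $ i) * d $ i))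
    + (cmod t)\<^sup>2 * (norm d)\<^sup>2"
    by (simp add: norm_vec_power2 pt sum.distrib sum_distrib_left)
  with assms show ?thesis by simp
qed

lemma norm_smult_vec: "norm (c *s (x :: complex ^ 'n::finite)) = cmod c * norm x"
proof -
  have "(norm (c *s x))\<^sup>2 = (cmod c * norm x)\<^sup>2"
    by (simp add: norm_vec_power2 norm_mult power_mult_distrib sum_distrib_left)
  then show ?thesis by (simp add: power2_eq_iff_nonneg)
qed


subsection \<open>Surjective pencils of linear maps\<close>

lemma parallelogram_identity:
  "(norm (a + b))\<^sup>2 + (norm (a - b))\<^sup>2 = 2 * (norm a)\<^sup>2 + 2 * (norm (b :: 'a::real_inner))\<^sup>2"
  by (simp add: power2_norm_eq_inner inner_add inner_diff inner_commute)

locale steiner_map =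
  fixes B :: "complex ^ 'v::finite \<Rightarrow> complex ^ 'w::finite \<Rightarrow> complex ^ 'i::finite"
  assumes add_left: "B (x + y) w = B x w + B y w"
    and scale_left: "B (c *s x) w = c *s B x w"
    and add_right: "B x (w + w') = B x w + B x w'"
    and scale_right: "B x (c *s w) = c *s B x w"
    and surj: "x \<noteq> 0 \<Longrightarrow> surj (B x)"
    and dims: "CARD('w) + 1 = CARD('v) + CARD('i)"
begin

lemma zero_left [simp]: "B 0 w = 0"
  using scale_left[of 0 0 w] by simp

lemma zero_right [simp]: "B x 0 = 0"
  using scale_right[of x 0 0] by simp

lemma sum_right: "B x (\<Sum>t\<in>T. f t) = (\<Sum>t\<in>T. B x (f t))"
  by (induction T rule: infinite_finite_induct) (simp_all add: add_right)

lemma sum_left: "B (\<Sum>t\<in>T. f t) w = (\<Sum>t\<in>T. B (f t) w)"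
  by (induction T rule: infinite_finite_induct) (simp_all add: add_left)

text \<open>Fibrewise transpose: the covector \<open>\<psi>\<close> of I pulled back along
  \<open>B x\<close> to a covector of W. Surjectivity of \<open>B x\<close> becomes nonsingularity
  of this bilinear map.\<close>

definition adj :: "complex ^ 'v \<Rightarrow> complex ^ 'i \<Rightarrow> complex ^ 'w" where
  "adj x \<psi> = (\<chi> j. pairing \<psi> (B x (axis j 1)))"

lemma pairing_adj: "pairing (adj x \<psi>) w = pairing \<psi> (B x w)"
proof -
  have "B x w = B x (\<Sum>j\<in>UNIV. w $ j *s axis j 1)" by (simp only: basis_expansion)
  also have "\<dots> = (\<Sum>j\<in>UNIV. w $ j *s B x (axis j 1))" by (simp add: sum_right scale_right)
  finally have "pairing \<psi> (B x w) = (\<Sum>j\<in>UNIV. w $ j * pairing \<psi> (B x (axis j 1)))"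
    by (simp add: pairing_sum_right pairing_scale_right)
  then show ?thesis
    unfolding pairing_def[of "adj x \<psi>"] by (simp add: adj_def mult.commute)
qed

lemma adj_add_left: "adj (x + y) \<psi> = adj x \<psi> + adj y \<psi>"
  and adj_scale_left: "adj (c *s x) \<psi> = c *s adj x \<psi>"
  and adj_add_right: "adj x (\<psi> + \<phi>) = adj x \<psi> + adj x \<phi>"
  and adj_scale_right: "adj x (c *s \<psi>) = c *s adj x \<psi>"
  by (simp_all add: adj_def vec_eq_iff add_left scale_left pairing_add_left pairing_add_right
      pairing_scale_left pairing_scale_right)

lemma adj_eq_0D:
  assumes "adj x \<psi> = 0" "x \<noteq> 0"
  shows "\<psi> = 0"
proof (rule pairing_eq_0I)
  fix y
  obtain w where "y = B x w" using surj[OF assms(2)] by blast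
  then show "pairing \<psi> y = 0" using pairing_adj[of x \<psi> w] assms(1) by simp
qed

lemma continuous_on_adj: "continuous_on S (\<lambda>p. adj (fst p) (snd p))"
proof -
  have "adj x \<psi> = (\<chi> j. \<Sum>v\<in>UNIV. x $ v * pairing (B (axis v 1) (axis j 1)) \<psi>)" for x \<psi>
  proof -
    have "pairing \<psi> (B x w) = (\<Sum>v\<in>UNIV. x $ v * pairing (B (axis v 1) w) \<psi>)" for w
    proof -
      have "B x w = B (\<Sum>v\<in>UNIV. x $ v *s axis v 1) w" by (simp only: basis_expansion)
      then show ?thesis
        by (simp add: sum_left scale_left pairing_sum_right pairing_scale_right pairing_commute[of \<psi>])
    qed
    then show ?thesis by (simp add: adj_def)
  qed
  then show ?thesis by (simp add: continuous_intros)
qed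

text \<open>Minimise \<open>|adj x \<psi>|\<close> over unit vectors. At the minimum there are too few equations to keep
  \<open>adj x \<psi>\<close> from being stationary to first order in a direction \<open>(d, e)\<close> with \<open>d\<close> orthogonal
  to \<open>x\<close>. Averaging \<open>|adj (x + t d) (\<psi> + t e)|\<^sup>2\<close> over \<open>t = r, -r, i r, -i r\<close> kills the term
  in \<open>r\<^sup>2\<close>, although \<open>|x + t d|\<^sup>2\<close> grows like \<open>r\<^sup>2\<close>, against minimality.\<close>

theorem nonsingular_bound:
  fixes w :: "'t \<Rightarrow> complex ^ 'w"
  assumes X: "finite X" "card X < CARD('v)" and Y: "finite Y" "card Y < CARD('i)"
    and w: "lin_indep w T" "finite T"
    and vanish: "\<And>x \<psi> t. (\<And>a. a \<in> X \<Longrightarrow> pairing a x = 0) \<Longrightarrow>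
      (\<And>b. b \<in> Y \<Longrightarrow> pairing b \<psi> = 0) \<Longrightarrow> t \<in> T \<Longrightarrow> pairing \<psi> (B x (w t)) = 0"
  shows "card T \<le> card X + card Y"
proof (rule ccontr)
  assume less: "\<not> card T \<le> card X + card Y"
  define XS where "XS = {x::complex ^ 'v. \<forall>a\<in>X. pairing a x = 0}"
  define YS where "YS = {\<psi>::complex ^ 'i. \<forall>b\<in>Y. pairing b \<psi> = 0}"
  define K where "K = (XS \<inter> sphere 0 1) \<times> (YS \<inter> sphere 0 1)"
  have sub: "x + c *s y \<in> XS" if "x \<in> XS" "y \<in> XS" for x y c
    using that by (simp add: XS_def pairing_add_right pairing_scale_right)
  have sub': "x + c *s y \<in> YS" if "x \<in> YS" "y \<in> YS" for x y c
    using that by (simp add: YS_def pairing_add_right pairing_scale_right)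
  have "\<exists>u. u \<noteq> 0 \<and> (\<forall>f\<in>pairing ` X. f u = 0)"
    using X card_image_le[of X pairing]
    by (intro linear_form_common_zero) (auto simp: linear_form_pairing)
  then obtain x1 where x1: "x1 \<noteq> 0" "x1 \<in> XS" by (auto simp: XS_def)
  have "\<exists>u. u \<noteq> 0 \<and> (\<forall>f\<in>pairing ` Y. f u = 0)"
    using Y card_image_le[of Y pairing]
    by (intro linear_form_common_zero) (auto simp: linear_form_pairing)
  then obtain y1 where y1: "y1 \<noteq> 0" "y1 \<in> YS" by (auto simp: YS_def)
  have scale: "c *s x \<in> XS" if "x \<in> XS" for x c
    using that by (simp add: XS_def pairing_scale_right)
  have scale': "c *s x \<in> YS" if "x \<in> YS" for x c
    using that by (simp add: YS_def pairing_scale_right)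
  have unit: "norm (of_real (1 / norm x) *s x) = 1" if "x \<noteq> 0" for x :: "complex ^ 'n::finite"
    using that by (simp add: norm_smult_vec norm_divide)
  have closed: "closed {x. \<forall>a\<in>A. pairing a x = 0}" for A :: "(complex ^ 'n::finite) set"
  proof -
    have "{x. \<forall>a\<in>A. pairing a x = 0} = (\<Inter>a\<in>A. {x. pairing a x = 0})" by auto
    then show ?thesis
      by (auto intro!: closed_INT closed_Collect_eq continuous_intros)
  qed
  have "compact K"
    unfolding K_def XS_def YS_def
    by (intro compact_Times closed_Int_compact closed compact_sphere)
  moreover have "(of_real (1 / norm x1) *s x1, of_real (1 / norm y1) *s y1) \<in> K"
    using scale[OF x1(2)] scale'[OF y1(2)] unit[OF x1(1)] unit[OF y1(1)] by (simp add: K_def)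
  then have "K \<noteq> {}" by blast
  ultimately obtain p where p: "p \<in> K" "\<forall>q\<in>K. norm (adj (fst p) (snd p)) \<le> norm (adj (fst q) (snd q))"
    using continuous_attains_inf[of K "\<lambda>p. norm (adj (fst p) (snd p))"]
      continuous_on_norm[OF continuous_on_adj] by blast
  define x where "x = fst p"
  define \<psi> where "\<psi> = snd p"
  define m where "m = norm (adj x \<psi>)"
  have x: "x \<in> XS" "norm x = 1" and \<psi>: "\<psi> \<in> YS" "norm \<psi> = 1"
    using p(1) by (auto simp: K_def x_def \<psi>_def)
  have "x \<noteq> 0" "\<psi> \<noteq> 0" using x \<psi> by auto
  then have "m > 0" using adj_eq_0D[of x \<psi>] by (auto simp: m_def)
  have lower: "m * norm u * norm \<phi> \<le> norm (adj u \<phi>)" if "u \<in> XS" "\<phi> \<in> YS" for u \<phi>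
  proof (cases "u = 0 \<or> \<phi> = 0")
    case True
    then show ?thesis by auto
  next
    case False
    define u' where "u' = of_real (1 / norm u) *s u"
    define \<phi>' where "\<phi>' = of_real (1 / norm \<phi>) *s \<phi>"
    have "(u', \<phi>') \<in> K"
      using False unit[of u] unit[of \<phi>] scale[OF that(1)] scale'[OF that(2)]
      by (simp add: K_def u'_def \<phi>'_def)
    then have "m \<le> norm (adj u' \<phi>')" using p(2) by (auto simp: m_def x_def \<psi>_def)
    also have "\<dots> = norm (adj u \<phi>) / (norm u * norm \<phi>)"
      unfolding u'_def \<phi>'_def adj_scale_left adj_scale_right norm_smult_vec
      by (simp add: norm_divide)
    finally show ?thesis using False by (simp add: field_simps)
  qed
  obtain C where C: "finite C" "card C + card T = CARD('w)"
    "\<And>z. (\<And>t. t \<in> T \<Longrightarrow> pairing z (w t) = 0) \<Longrightarrow> (\<And>b. b \<in> C \<Longrightarrow> pairing z b = 0) \<Longrightarrow> z = 0"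
    using lin_indep_extend[OF w] by blast
  define d where "d u = (\<chi> i. u $ Inl i)" for u :: "complex ^ ('v + 'i)"
  define e where "e u = (\<chi> i. u $ Inr i)" for u :: "complex ^ ('v + 'i)"
  have lin [simp]: "d (u + v) = d u + d v" "e (u + v) = e u + e v" "d (c *s u) = c *s d u"
    "e (c *s u) = c *s e u" for u v c
    by (simp_all add: d_def e_def vec_eq_iff)
  \<comment> \<open>The pair \<open>(d, e)\<close> has
    \<open>CARD('v) + CARD('i) = CARD('w) + 1\<close> coordinates. The equations are membership in
    \<open>XS\<close> and \<open>YS\<close>, one orthogonality, and
    \<open>card C = CARD('w) - card T\<close> conditions for stationarity. As
    \<open>card T > card X + card Y\<close>, they number at most \<open>CARD('w)\<close>; in the
    critical case there is no room for a second orthogonality, of \<open>e\<close> to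
    \<open>\<psi>\<close>.\<close>
  define F where "F = (\<lambda>a u. pairing a (d u)) ` X \<union> (\<lambda>b u. pairing b (e u)) ` Y \<union>
    {\<lambda>u. \<Sum>i\<in>UNIV. cnj (x $ i) * d u $ i} \<union>
    (\<lambda>b u. pairing (adj (d u) \<psi> + adj x (e u)) b) ` C"
  have "card F \<le> card X + card Y + 1 + card C"
    unfolding F_def using X Y C
    by (intro card_Un_le[THEN order_trans] add_mono card_image_le) auto
  then have "card F < CARD('v + 'i)" using less C(2) dims by simp
  moreover have "finite F" using X Y C by (simp add: F_def)
  moreover have "linear_form f" if "f \<in> F" for f
    using that unfolding F_def linear_form_def
    by (auto simp: adj_add_left adj_add_right adj_scale_left adj_scale_right pairing_add_left
        pairing_add_right pairing_scale_left pairing_scale_right algebra_simps sum.distrib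
        sum_distrib_left)
  ultimately obtain u where u: "u \<noteq> 0" "\<forall>f\<in>F. f u = 0"
    using linear_form_common_zero[of F] by blast
  have d: "d u \<in> XS" and e: "e u \<in> YS" and orth: "(\<Sum>i\<in>UNIV. cnj (x $ i) * d u $ i) = 0"
    and van: "\<And>b. b \<in> C \<Longrightarrow> pairing (adj (d u) \<psi> + adj x (e u)) b = 0"
    using u(2) by (auto simp: F_def XS_def YS_def)
  \<comment> \<open>The elements of \<open>C\<close> test the covector only in directions
    complementary to the \<open>w t\<close>; on the \<open>w t\<close> themselves
    \<open>vanish\<close> kills both summands.\<close>
  have stat: "adj (d u) \<psi> + adj x (e u) = 0"
  proof (rule C(3)[OF _ van])
    fix t assume t: "t \<in> T"
    show "pairing (adj (d u) \<psi> + adj x (e u)) (w t) = 0"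
      using vanish[of "d u" \<psi> t] vanish[of x "e u" t] d e x \<psi> t
      by (simp add: pairing_add_left pairing_adj XS_def YS_def)
  qed
  have "d u \<noteq> 0"
  proof
    assume du: "d u = 0"
    then have "adj x (e u) = 0" using stat adj_scale_left[of 0 0 \<psi>] by simp
    then have "e u = 0" using adj_eq_0D \<open>x \<noteq> 0\<close> by blast
    with du have "u $ i = 0" for i
      by (cases i) (auto simp: d_def e_def vec_eq_iff)
    then show False using u(1) by (simp add: vec_eq_iff)
  qed
  define \<gamma> where "\<gamma> = adj (d u) (e u)"
  have expand: "adj (x + t *s d u) (\<psi> + t *s e u) = adj x \<psi> + t\<^sup>2 *s \<gamma>" for t
  proof -
    have "adj (x + t *s d u) (\<psi> + t *s e u) =
      adj x \<psi> + t *s (adj (d u) \<psi> + adj x (e u)) + t\<^sup>2 *s \<gamma>"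
      by (simp add: adj_add_left adj_add_right adj_scale_left adj_scale_right \<gamma>_def
          vec_eq_iff power2_eq_square algebra_simps)
    with stat show ?thesis by simp
  qed
  define a where "a = (norm (d u))\<^sup>2"
  have "a > 0" using \<open>d u \<noteq> 0\<close> by (simp add: a_def)
  have point: "m\<^sup>2 * (1 + (cmod t)\<^sup>2 * a) * (norm (\<psi> + t *s e u))\<^sup>2 \<le> (norm (adj x \<psi> + t\<^sup>2 *s \<gamma>))\<^sup>2" for t
  proof -
    have "(m * norm (x + t *s d u) * norm (\<psi> + t *s e u))\<^sup>2 \<le> (norm (adj x \<psi> + t\<^sup>2 *s \<gamma>))\<^sup>2"
      using lower[OF sub[OF x(1) d] sub'[OF \<psi>(1) e], of t t] \<open>m > 0\<close>
      unfolding expand by (intro power_mono) auto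
    then show ?thesis
      using norm_add_orthogonal[OF orth, of t] x by (simp add: power_mult_distrib a_def)
  qed
  have pair: "m\<^sup>2 * (1 + (cmod t)\<^sup>2 * a) \<le> (norm (adj x \<psi> + t\<^sup>2 *s \<gamma>))\<^sup>2" for t
  proof -
    \<comment> \<open>Since \<open>e\<close> is not known to be orthogonal to \<open>\<psi>\<close>,
      averaging over \<open>t\<close> and \<open>- t\<close> removes that cross term instead. The
      right-hand side depends only on \<open>t\<^sup>2\<close> and is the same for both
      signs.\<close>
    have "(norm (\<psi> + t *s e u))\<^sup>2 + (norm (\<psi> + (- t) *s e u))\<^sup>2 = 2 + 2 * (norm (t *s e u))\<^sup>2"
      using parallelogram_identity[of \<psi> "t *s e u"] \<psi> by simp
    then have "2 \<le> (norm (\<psi> + t *s e u))\<^sup>2 + (norm (\<psi> + (- t) *s e u))\<^sup>2" by simp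
    then have "m\<^sup>2 * (1 + (cmod t)\<^sup>2 * a) * 2 \<le>
      m\<^sup>2 * (1 + (cmod t)\<^sup>2 * a) * ((norm (\<psi> + t *s e u))\<^sup>2 + (norm (\<psi> + (- t) *s e u))\<^sup>2)"
      using \<open>a > 0\<close> by (intro mult_left_mono) auto
    also have "\<dots> \<le> 2 * (norm (adj x \<psi> + t\<^sup>2 *s \<gamma>))\<^sup>2"
      using point[of t] point[of "- t"] by (simp add: distrib_left)
    finally show ?thesis by simp
  qed
  \<comment> \<open>Chosen so that
    \<open>r\<^sup>2 * (norm \<gamma>)\<^sup>2 < m\<^sup>2 * a\<close>; the added 1 avoids a
    division by zero and makes the inequality strict.\<close>
  define r where "r = sqrt (m\<^sup>2 * a / ((norm \<gamma>)\<^sup>2 + 1))"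
  have pos: "m\<^sup>2 * a > 0" using \<open>m > 0\<close> \<open>a > 0\<close> by simp
  have g1: "(norm \<gamma>)\<^sup>2 + 1 > 0" by (simp add: add_nonneg_pos)
  have r2: "r\<^sup>2 = m\<^sup>2 * a / ((norm \<gamma>)\<^sup>2 + 1)"
    using pos g1 by (simp add: r_def)
  have "r\<^sup>2 > 0" using pos g1 by (simp add: r2)
  \<comment> \<open>The squares of \<open>r\<close> and \<open>\<i> * r\<close> are opposite, so the
    parallelogram identity cancels the term mixing \<open>adj x \<psi>\<close> and
    \<open>\<gamma>\<close>.\<close>
  have "2 * (m\<^sup>2 * (1 + r\<^sup>2 * a)) \<le>
    (norm (adj x \<psi> + (of_real (r\<^sup>2)) *s \<gamma>))\<^sup>2 + (norm (adj x \<psi> - (of_real (r\<^sup>2)) *s \<gamma>))\<^sup>2"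
    using pair[of "of_real r"] pair[of "\<i> * of_real r"]
    by (simp add: norm_mult power_mult_distrib)
  also have "\<dots> = 2 * m\<^sup>2 + 2 * (r\<^sup>2 * norm \<gamma>)\<^sup>2"
    using parallelogram_identity[of "adj x \<psi>" "of_real (r\<^sup>2) *s \<gamma>"]
    by (simp add: norm_smult_vec m_def norm_power)
  finally have "r\<^sup>2 * (m\<^sup>2 * a) \<le> r\<^sup>2 * (r\<^sup>2 * (norm \<gamma>)\<^sup>2)"
    by (simp add: algebra_simps power2_eq_square)
  then have "m\<^sup>2 * a \<le> r\<^sup>2 * (norm \<gamma>)\<^sup>2" using \<open>r\<^sup>2 > 0\<close> mult_le_cancel_left_pos by blast
  also have "\<dots> = m\<^sup>2 * a * ((norm \<gamma>)\<^sup>2 / ((norm \<gamma>)\<^sup>2 + 1))" by (simp add: r2)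
  also have "\<dots> < m\<^sup>2 * a * 1"
    using pos g1 by (intro mult_strict_left_mono) auto
  finally show False by simp
qed

text \<open>For a nonzero \<open>w\<close> the bound with no constraints and this single vector
  would read 1 <= 0. Geometrically, W embeds into I \<otimes> V: the dual bundle has no nonzero
  global section.\<close>

lemma eq_0I:
  assumes "\<And>x. B x w = 0"
  shows "w = 0"
proof (rule ccontr)
  assume "w \<noteq> 0"
  then have "lin_indep (\<lambda>_. w) {()}" by (simp add: lin_indep_def)
  then have "card {()} \<le> card ({}::(complex ^ 'v) set) + card ({}::(complex ^ 'i) set)"
    by (rule nonsingular_bound[of "{}" "{}" "\<lambda>_. w" "{()}", rotated 4]) (auto simp: assms)
  then show False by simp
qed


text \<open>The roles of the two families of factors of the pure tensors \<open>a t \<otimes> b t\<close> are symmetric.\<close>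

lemma factors_indep:
  fixes a :: "'t \<Rightarrow> complex ^ 'p::finite" and b :: "'t \<Rightarrow> complex ^ 'q::finite"
    and w :: "'t \<Rightarrow> complex ^ 'w"
  assumes rel: "\<And>d \<xi> R. R \<subseteq> T \<Longrightarrow> (\<Sum>t\<in>R. d t *s w t) = 0 \<Longrightarrow>
      (\<Sum>t\<in>R. d t * pairing (a t) \<xi> *s b t) = 0"
    and bound: "\<And>R t. R \<subseteq> T \<Longrightarrow> t \<in> T \<Longrightarrow> t \<notin> R \<Longrightarrow> card R < CARD('q) \<Longrightarrow>
      \<exists>c. b t = (\<Sum>r\<in>R. c r *s b r) \<Longrightarrow> \<not> lin_indep w (insert t R)"
    and pairwise: "\<And>s t. s \<in> T \<Longrightarrow> t \<in> T \<Longrightarrow> s \<noteq> t \<Longrightarrow> lin_indep a {s, t}"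
    and nonzero: "\<And>t. t \<in> T \<Longrightarrow> b t \<noteq> 0"
    and "finite T" "R \<subseteq> T" "card R \<le> CARD('q)"
  shows "lin_indep b R"
proof -
  have "finite R" by (rule finite_subset) fact+
  then show ?thesis
    using \<open>R \<subseteq> T\<close> \<open>card R \<le> CARD('q)\<close>
  proof (induction R rule: finite_induct)
    case empty
    then show ?case by (simp add: lin_indep_def)
  next
    case (insert t R)
    then have IH: "lin_indep b R" and t: "t \<in> T" "R \<subseteq> T" "card R < CARD('q)" by auto
    show ?case
    proof (rule lin_indep_insert[OF IH insert.hyps(1,2)], rule notI)
      fix c assume c: "b t = (\<Sum>r\<in>R. c r *s b r)"
      have "\<not> lin_indep w (insert t R)" using bound[of R t] c t insert.hyps by blast
      then obtain d s where d: "(\<Sum>r\<in>insert t R. d r *s w r) = 0" "s \<in> insert t R" "d s \<noteq> 0"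
        unfolding lin_indep_def by blast
      \<comment> \<open>Insert the expansion \<open>c\<close> of \<open>b t\<close> into the
        relation contracted with \<open>\<xi>\<close>; independence of the \<open>b r\<close>
        separates the coefficients.\<close>
      have coeff: "d t * c r * pairing (a t) \<xi> + d r * pairing (a r) \<xi> = 0" if "r \<in> R" for r \<xi>
      proof (rule lin_indepD[OF IH _ that])
        have "(\<Sum>r\<in>insert t R. d r * pairing (a r) \<xi> *s b r) = 0"
          using rel[of "insert t R" d \<xi>] d insert.prems by blast
        then have "d t * pairing (a t) \<xi> *s b t + (\<Sum>r\<in>R. d r * pairing (a r) \<xi> *s b r) = 0"
          using insert.hyps by simp
        then show "(\<Sum>r\<in>R. (d t * c r * pairing (a t) \<xi> + d r * pairing (a r) \<xi>) *s b r) = 0"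
          unfolding c
          by (simp add: vec.scale_sum_right vector_smult_assoc vector_sadd_rdistrib sum.distrib mult_ac)
      qed
      \<comment> \<open>As \<open>\<xi>\<close> is arbitrary, \<open>coeff\<close> is a relation
        between \<open>a t\<close> and \<open>a r\<close> alone, and pairwise independence kills
        both coefficients.\<close>
      have both: "d t * c r = 0 \<and> d r = 0" if "r \<in> R" for r
      proof -
        have rt: "lin_indep a {t, r}" "t \<noteq> r" using pairwise that t insert.hyps by auto
        have "(d t * c r) *s a t + d r *s a r = 0"
          using coeff[OF that]
          by (intro pairing_eq_0I) (simp add: pairing_add_left pairing_scale_left)
        then have "(\<Sum>s\<in>{t, r}. (if s = t then d t * c r else d r) *s a s) = 0" using rt(2) by simp
        from lin_indepD[OF rt(1) this] rt(2) show ?thesis by force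
      qed
      with d have "d t \<noteq> 0" by blast
      with both have "c r = 0" if "r \<in> R" for r using that by auto
      then show False using c nonzero[OF t(1)] by simp
    qed
  qed
qed

end

section \<open>Pure tensors in general position\<close>

locale steiner_tensors = steiner_map B
  for B :: "complex ^ 'v::finite \<Rightarrow> complex ^ 'w::finite \<Rightarrow> complex ^ 'i::finite" +
  fixes T :: "'t set" and h :: "'t \<Rightarrow> complex ^ 'v" and w :: "'t \<Rightarrow> complex ^ 'w"
    and \<iota> :: "'t \<Rightarrow> complex ^ 'i"
  assumes finite_T: "finite T"
    and tensor: "t \<in> T \<Longrightarrow> B x (w t) = pairing (h t) x *s \<iota> t"
    and w_nonzero: "t \<in> T \<Longrightarrow> w t \<noteq> 0"
    and h_pairwise: "s \<in> T \<Longrightarrow> t \<in> T \<Longrightarrow> s \<noteq> t \<Longrightarrow> lin_indep h {s, t}"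
begin

lemma \<iota>_nonzero: "t \<in> T \<Longrightarrow> \<iota> t \<noteq> 0"
  using tensor[of t] w_nonzero[of t] eq_0I[of "w t"] by auto

lemma h_nonzero: "t \<in> T \<Longrightarrow> h t \<noteq> 0"
  using tensor[of t] w_nonzero[of t] eq_0I[of "w t"] by auto

lemma relation:
  assumes "R \<subseteq> T" "(\<Sum>t\<in>R. d t *s w t) = 0"
  shows "(\<Sum>t\<in>R. d t * pairing (h t) x *s \<iota> t) = 0"
proof -
  have "(\<Sum>t\<in>R. d t * pairing (h t) x *s \<iota> t) = B x (\<Sum>t\<in>R. d t *s w t)"
    using assms(1) by (auto simp: sum_right scale_right tensor vector_smult_assoc intro!: sum.cong)
  then show ?thesis using assms(2) by simp
qed

lemma relation':
  assumes "R \<subseteq> T" "(\<Sum>t\<in>R. d t *s w t) = 0"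
  shows "(\<Sum>t\<in>R. d t * pairing (\<iota> t) \<psi> *s h t) = 0"
proof (rule pairing_eq_0I)
  fix x
  have "pairing (\<Sum>t\<in>R. d t * pairing (\<iota> t) \<psi> *s h t) x =
    pairing (\<Sum>t\<in>R. d t * pairing (h t) x *s \<iota> t) \<psi>"
    by (simp add: pairing_sum_left pairing_scale_left mult_ac)
  then show "pairing (\<Sum>t\<in>R. d t * pairing (\<iota> t) \<psi> *s h t) x = 0"
    using relation[OF assms] by simp
qed

text \<open>Covectors killing the \<open>\<iota> r\<close> with \<open>r \<in> R\<close> also kill
  an \<open>\<iota> t\<close> in their span. So the \<open>card R + 1\<close> vectors
  \<open>w\<close> satisfy the hypotheses of \<open>nonsingular_bound\<close> with only
  \<open>card R\<close> constraints, hence are dependent, which is the input of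
  \<open>factors_indep\<close>.\<close>

lemma \<iota>_indep:
  assumes "R \<subseteq> T" "card R \<le> CARD('i)"
  shows "lin_indep \<iota> R"
proof (rule factors_indep[OF relation _ h_pairwise \<iota>_nonzero finite_T assms])
  fix R t assume R: "R \<subseteq> T" "t \<in> T" "t \<notin> R" "card R < CARD('i)"
  have fin: "finite R" using R finite_T finite_subset by blast
  assume "\<exists>c. \<iota> t = (\<Sum>r\<in>R. c r *s \<iota> r)"
  then obtain c where c: "\<iota> t = (\<Sum>r\<in>R. c r *s \<iota> r)" by blast
  show "\<not> lin_indep w (insert t R)"
  proof
    assume "lin_indep w (insert t R)"
    then have "card (insert t R) \<le> card ({}::(complex ^ 'v) set) + card (\<iota> ` R)"
    proof (rule nonsingular_bound[rotated 4])
      show "card (\<iota> ` R) < CARD('i)" using card_image_le[OF fin, of \<iota>] R by linarith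
      fix x \<psi> s assume "\<And>b. b \<in> \<iota> ` R \<Longrightarrow> pairing b \<psi> = 0" and s: "s \<in> insert t R"
      then have "pairing \<psi> (\<iota> r) = 0" if "r \<in> R" for r
        using that by (simp add: pairing_commute[of \<psi>])
      then have "pairing \<psi> (\<iota> s) = 0"
        using s by (auto simp: c pairing_sum_right pairing_scale_right)
      then show "pairing \<psi> (B x (w s)) = 0"
        using s R by (subst tensor) (auto simp: pairing_scale_right)
    qed (use fin in auto)
    then show False using card_image_le[OF fin, of \<iota>] fin R by simp
  qed
qed

text \<open>The mirror image of \<open>\<iota>_indep\<close>, with the constraints on the side of
  \<open>x\<close>. Its input is pairwise independence of the \<open>\<iota>\<close>, hence
  \<open>2 \<le> CARD('i)\<close>; when I is a line, the conclusion can fail.\<close>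

lemma h_indep:
  assumes "R \<subseteq> T" "card R \<le> CARD('v)" and "2 \<le> CARD('i)"
  shows "lin_indep h R"
proof (rule factors_indep[OF relation' _ _ h_nonzero finite_T assms(1,2)])
  show "lin_indep \<iota> {s, t}" if "s \<in> T" "t \<in> T" "s \<noteq> t" for s t
    using \<iota>_indep[of "{s, t}"] that assms(3) by simp
  fix R t assume R: "R \<subseteq> T" "t \<in> T" "t \<notin> R" "card R < CARD('v)"
  have fin: "finite R" using R finite_T finite_subset by blast
  assume "\<exists>c. h t = (\<Sum>r\<in>R. c r *s h r)"
  then obtain c where c: "h t = (\<Sum>r\<in>R. c r *s h r)" by blast
  show "\<not> lin_indep w (insert t R)"
  proof
    assume "lin_indep w (insert t R)"
    then have "card (insert t R) \<le> card (h ` R) + card ({}::(complex ^ 'i) set)"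
    proof (rule nonsingular_bound[rotated 4])
      show "card (h ` R) < CARD('v)" using card_image_le[OF fin, of h] R by linarith
      fix x \<psi> s assume "\<And>b. b \<in> h ` R \<Longrightarrow> pairing b x = 0" and s: "s \<in> insert t R"
      then have "pairing (h s) x = 0"
        by (auto simp: c pairing_sum_left pairing_scale_left)
      then show "pairing \<psi> (B x (w s)) = 0"
        using s R by (subst tensor) (auto simp: pairing_scale_right)
    qed (use fin in auto)
    then show False using card_image_le[OF fin, of h] fin R by simp
  qed
qed

text \<open>Contract a relation with support \<open>J\<close> with a covector dual to one
  \<open>\<iota> k\<close> within a set \<open>K\<close> of at most \<open>CARD('i)\<close> of the
  \<open>\<iota>\<close>. What survives is a relation among the \<open>h\<close> over
  \<open>k\<close> and \<open>J - K\<close>. Independence of the \<open>h\<close> enters as a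
  hypothesis, so that one-dimensional I is covered as well.\<close>

lemma w_indep:
  assumes h_indep: "\<And>R. R \<subseteq> T \<Longrightarrow> card R \<le> CARD('v) \<Longrightarrow> lin_indep h R"
    and R: "R \<subseteq> T" "card R \<le> CARD('w)"
  shows "lin_indep w R"
  unfolding lin_indep_def
proof (intro allI impI, rule ccontr)
  fix d assume d: "(\<Sum>t\<in>R. d t *s w t) = 0" and "\<not> (\<forall>t\<in>R. d t = 0)"
  define J where "J = {t \<in> R. d t \<noteq> 0}"
  have J: "J \<subseteq> T" "finite J" "J \<noteq> {}" "card J \<le> CARD('w)"
    using R finite_subset[OF _ finite_T] \<open>\<not> _\<close> card_mono[of R J]
    by (auto simp: J_def intro: le_trans)
  have "(\<Sum>t\<in>J. d t *s w t) = 0"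
    using d R finite_subset[OF R(1) finite_T]
    by (subst (asm) sum.mono_neutral_right[of R J]) (auto simp: J_def)
  note rel = relation'[OF J(1) this]
  have "\<exists>K. K \<subseteq> J \<and> card K = min (card J) CARD('i)"
    using J(2) by (metis min.cobounded1 obtain_subset_with_card_n)
  then obtain K where K: "K \<subseteq> J" "card K = min (card J) CARD('i)" by blast
  have "K \<noteq> {}" using K J by (auto simp: min_def split: if_splits)
  then obtain k where k: "k \<in> K" by blast
  have finK: "finite K" using K J finite_subset by blast
  have "lin_indep \<iota> K" using \<iota>_indep K J by (metis min.cobounded2 subset_trans)
  then obtain \<psi> where \<psi>: "pairing (\<iota> k) \<psi> = 1" "\<And>s. s \<in> K \<Longrightarrow> s \<noteq> k \<Longrightarrow> pairing (\<iota> s) \<psi> = 0"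
    using dual_vector[OF _ finK k] by blast
  define L where "L = insert k (J - K)"
  have L: "L \<subseteq> J" "finite L" using K k J by (auto simp: L_def)
  have "(\<Sum>t\<in>L. d t * pairing (\<iota> t) \<psi> *s h t) = 0"
    using rel[of \<psi>] L J \<psi> K by (subst (asm) sum.mono_neutral_right[of J L]) (auto simp: L_def)
  moreover have "lin_indep h L"
  proof (rule h_indep)
    have "card L = Suc (card J - card K)"
      using k K J finK by (simp add: L_def card_Diff_subset)
    \<comment> \<open>If \<open>card K = CARD('i)\<close>, then \<open>card J - CARD('i) + 1 \<le>
      CARD('w) - CARD('i) + 1 = CARD('v)\<close>; otherwise \<open>K = J\<close> and
      \<open>L\<close> is a singleton.\<close>
    also have "\<dots> \<le> CARD('v)" using K J(4) dims by (auto simp: min_def Suc_le_eq)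
    finally show "card L \<le> CARD('v)" .
  qed (use L J in blast)
  ultimately have "d k * pairing (\<iota> k) \<psi> = 0"
    using lin_indepD[of h L "\<lambda>t. d t * pairing (\<iota> t) \<psi>" k] by (simp add: L_def)
  then show False using \<psi>(1) k K by (auto simp: J_def)
qed

text \<open>A relation that vanishes at one index involves at most \<open>CARD('w)\<close> of the
  vectors and is trivial by \<open>w_indep\<close>. So a nonzero relation has no zero coefficient,
  and subtracting the multiple of \<open>c\<close> that cancels at \<open>s\<close> gives
  proportionality.\<close>

lemma unique_relation:
  assumes h_indep: "\<And>R. R \<subseteq> T \<Longrightarrow> card R \<le> CARD('v) \<Longrightarrow> lin_indep h R"
    and card: "card T = CARD('w) + 1"
  obtains c where "\<And>t. t \<in> T \<Longrightarrow> c t \<noteq> 0" "(\<Sum>t\<in>T. c t *s w t) = 0"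
    "\<And>d. (\<Sum>t\<in>T. d t *s w t) = 0 \<Longrightarrow> \<exists>e. \<forall>t\<in>T. d t = e * c t"
proof -
  have vanish: "\<forall>t\<in>T. d t = 0" if d: "(\<Sum>t\<in>T. d t *s w t) = 0" "s \<in> T" "d s = 0" for d s
  proof -
    have "lin_indep w (T - {s})"
      using w_indep[OF h_indep, of "T - {s}"] card d(2) finite_T by auto
    moreover have "(\<Sum>t\<in>T - {s}. d t *s w t) = 0"
      using d finite_T by (simp add: sum.remove)
    ultimately show ?thesis using d(3) unfolding lin_indep_def by (metis DiffI singletonD)
  qed
  have "\<not> lin_indep w T" using lin_indep_card_le[of w T] finite_T card by auto
  then obtain c s where c: "(\<Sum>t\<in>T. c t *s w t) = 0" "s \<in> T" "c s \<noteq> 0"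
    unfolding lin_indep_def by blast
  have nz: "c t \<noteq> 0" if "t \<in> T" for t using vanish[OF c(1) that] c by blast
  have "\<exists>e. \<forall>t\<in>T. d t = e * c t" if d: "(\<Sum>t\<in>T. d t *s w t) = 0" for d
  proof -
    define e where "e = d s / c s"
    have "(\<Sum>t\<in>T. (d t - e * c t) *s w t) =
      (\<Sum>t\<in>T. d t *s w t) - e *s (\<Sum>t\<in>T. c t *s w t)"
      by (simp add: vec_eq_iff left_diff_distrib sum_subtractf sum_distrib_left mult.assoc)
    also have "\<dots> = 0" unfolding d c(1) by simp
    finally have "\<forall>t\<in>T. d t - e * c t = 0"
      by (rule vanish[OF _ c(2)]) (use c(3) in \<open>simp add: e_def\<close>)
    then show ?thesis by (intro exI[of _ e]) simp
  qed
  with nz c(1) that show thesis by blast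
qed

end


subsection \<open>Projective points and homogeneous regular functions\<close>

lemma pt_coords [simp]: "pt (coords l) = l"
  by (rule Quotient3_abs_rep[OF Quotient3_proj])

lemma coords_nonzero [simp]: "coords l \<noteq> 0"
  using Quotient3_rep_reflp[OF Quotient3_proj, of l] by simp

lemma pt_eq_iff:
  assumes "x \<noteq> 0" "y \<noteq> 0"
  shows "pt x = pt y \<longleftrightarrow> (\<exists>c. y = c *s x)"
  using Quotient3_rel[OF Quotient3_proj, of x y] assms vector_smult_lid
  by (metis (no_types, lifting))

lemma pt_scale [simp]:
  assumes "c \<noteq> 0" "x \<noteq> 0"
  shows "pt (c *s x) = pt x"
  using assms by (subst eq_commute, subst pt_eq_iff) auto

lemma coords_pt:
  assumes "x \<noteq> 0"
  obtains c where "c \<noteq> 0" "coords (pt x) = c *s x"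
proof -
  obtain c where c: "coords (pt x) = c *s x"
    using pt_eq_iff[of x "coords (pt x)"] assms by auto
  moreover have "c \<noteq> 0" using c coords_nonzero[of "pt x"] by auto
  ultimately show thesis using that by blast
qed

lemma inj_coords: "inj coords"
  by (rule inj_on_inverseI[where g = pt]) simp

lemma pairing_coords_pt_eq_0_iff:
  assumes "x \<noteq> 0"
  shows "pairing a (coords (pt x)) = 0 \<longleftrightarrow> pairing a x = 0"
  using coords_pt[OF assms] by (metis pairing_scale_right mult_eq_0_iff)

lemma mem_hyperplane_pt:
  "x \<noteq> 0 \<Longrightarrow> pt x \<in> hyperplane h \<longleftrightarrow> pairing (coords h) x = 0"
  by (simp add: hyperplane_def pairing_coords_pt_eq_0_iff)

section \<open>Homogeneous polynomials\<close>

lemma hpoly_homogeneous: "hpoly d p \<Longrightarrow> p (c *s x) = c ^ d * p x"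
  by (induction rule: hpoly.induct) (auto simp: algebra_simps power_add)

lemma hpoly_const_mult: "hpoly d p \<Longrightarrow> hpoly d (\<lambda>x. c * p x)"
  using hpoly.mult[OF hpoly.const[of c]] by simp

lemma hpoly_power: "hpoly d p \<Longrightarrow> hpoly (n * d) (\<lambda>x. p x ^ n)"
  by (induction n) (use hpoly.const[of 1] in \<open>auto intro: hpoly.mult\<close>)

lemma hpoly_zero: "hpoly d (\<lambda>x :: complex ^ 'v. 0)"
  using hpoly_const_mult[OF hpoly_power[OF hpoly.coord, of d undefined], of 0] by simp

lemma hpoly_sum: "(\<And>i. i \<in> I \<Longrightarrow> hpoly d (p i)) \<Longrightarrow> hpoly d (\<lambda>x. \<Sum>i\<in>I. p i x)"
  by (induction I rule: infinite_finite_induct) (auto intro: hpoly_zero hpoly.add)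

lemma hpoly_pairing: "hpoly 1 (pairing a)"
  unfolding pairing_def[abs_def] by (intro hpoly_sum hpoly_const_mult hpoly.coord)

lemma continuous_on_hpoly: "hpoly d p \<Longrightarrow> continuous_on S (p :: complex ^ 'v::finite \<Rightarrow> complex)"
  by (induction rule: hpoly.induct) (auto intro!: continuous_intros)

lemma hpoly_line_holomorphic:
  "hpoly d p \<Longrightarrow> (\<lambda>t. p (x + t *s z)) holomorphic_on S"
  by (induction rule: hpoly.induct) (auto intro!: holomorphic_intros)

section \<open>Punctured cones and Zariski open sets\<close>

lemma punctured_cone_Int [simp]: "punctured_cone (A \<inter> B) = punctured_cone A \<inter> punctured_cone B"
  and punctured_cone_UNIV [simp]: "punctured_cone UNIV = - {0}"
  and punctured_cone_mono: "A \<subseteq> B \<Longrightarrow> punctured_cone A \<subseteq> punctured_cone B"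
  by (auto simp: punctured_cone_def)

lemma punctured_cone_iff: "x \<in> punctured_cone Z \<longleftrightarrow> x \<noteq> 0 \<and> pt x \<in> Z"
  by (simp add: punctured_cone_def)

lemma coords_in_punctured_cone [simp]: "coords l \<in> punctured_cone Z \<longleftrightarrow> l \<in> Z"
  by (simp add: punctured_cone_def)

lemma punctured_cone_scale:
  "x \<in> punctured_cone Z \<Longrightarrow> c \<noteq> 0 \<Longrightarrow> c *s x \<in> punctured_cone Z"
  by (simp add: punctured_cone_def)

lemma zariski_open_basic: "hpoly d g \<Longrightarrow> zariski_open {l. g (coords l) \<noteq> 0}"
  unfolding zariski_open_def by (rule exI[of _ "{g}"]) auto

lemma hpoly_coords_pt_eq_0_iff:
  assumes "hpoly d g" "x \<noteq> 0"
  shows "g (coords (pt x)) = 0 \<longleftrightarrow> g x = 0"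
proof -
  obtain c where "c \<noteq> 0" "coords (pt x) = c *s x" using coords_pt[OF assms(2)] .
  then show ?thesis using hpoly_homogeneous[OF assms(1)] by simp
qed

lemma zariski_open_nbhd:
  assumes "zariski_open U" "x \<in> punctured_cone U"
  shows "\<exists>d g. hpoly d g \<and> g x \<noteq> 0 \<and> (\<forall>y. y \<noteq> 0 \<longrightarrow> g y \<noteq> 0 \<longrightarrow> y \<in> punctured_cone U)"
proof -
  obtain P where P: "\<forall>p\<in>P. \<exists>d. hpoly d p" "U = {l. \<exists>p\<in>P. p (coords l) \<noteq> 0}"
    using assms(1) unfolding zariski_open_def by blast
  then obtain d g where g: "g \<in> P" "hpoly d g" "g (coords (pt x)) \<noteq> 0"
    using assms(2) by (auto simp: punctured_cone_def)
  show ?thesis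
  proof (intro exI conjI allI impI)
    show "hpoly d g" by fact
    show "g x \<noteq> 0" using g assms(2) hpoly_coords_pt_eq_0_iff by (auto simp: punctured_cone_def)
    show "y \<in> punctured_cone U" if "y \<noteq> 0" "g y \<noteq> 0" for y
      using that g P(2) hpoly_coords_pt_eq_0_iff by (auto simp: punctured_cone_def)
  qed
qed

lemma zariski_open_UNIV [simp]: "zariski_open UNIV"
  using zariski_open_basic[OF hpoly.const[of 1]] by simp

lemma zariski_open_Int [intro]:
  assumes "zariski_open U" "zariski_open U'"
  shows "zariski_open (U \<inter> U')"
proof -
  obtain P where P: "\<forall>p\<in>P. \<exists>d. hpoly d p" "U = {l. \<exists>p\<in>P. p (coords l) \<noteq> 0}"
    using assms(1) unfolding zariski_open_def by blast
  obtain P' where P': "\<forall>p\<in>P'. \<exists>d. hpoly d p" "U' = {l. \<exists>p\<in>P'. p (coords l) \<noteq> 0}"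
    using assms(2) unfolding zariski_open_def by blast
  show ?thesis
    unfolding zariski_open_def
  proof (intro exI conjI)
    show "\<forall>p\<in>(\<lambda>(p, q) x. p x * q x) ` (P \<times> P'). \<exists>d. hpoly d p"
      using P(1) P'(1) by (fastforce intro: hpoly.mult)
    show "U \<inter> U' = {l. \<exists>p\<in>(\<lambda>(p, q) x. p x * q x) ` (P \<times> P'). p (coords l) \<noteq> 0}"
      using P(2) P'(2) by fastforce
  qed
qed

lemma zariski_open_pairing: "zariski_open {l. pairing a (coords l) \<noteq> 0}"
  by (rule zariski_open_basic[OF hpoly_pairing])

lemma zariski_open_Diff_hyperplanes:
  assumes "zariski_open U" "finite \<H>"
  shows "zariski_open (U - (\<Union>h\<in>\<H>. hyperplane h))"
  using assms(2)
proof (induction \<H> rule: finite_induct)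
  case empty
  then show ?case using assms by simp
next
  case (insert h \<H>)
  have "U - (\<Union>h\<in>insert h \<H>. hyperplane h) =
    (U - (\<Union>h\<in>\<H>. hyperplane h)) \<inter> {l. pairing (coords h) (coords l) \<noteq> 0}"
    by (auto simp: hyperplane_def)
  with insert show ?case by (auto intro: zariski_open_pairing)
qed

text \<open>Zariski open sets are open in the classical topology, polynomials being continuous. This
  is what allows residues to be computed, and identities to be extended, by limits along
  lines.\<close>

lemma eventually_in_punctured_cone:
  fixes U :: "'v::finite proj set"
  assumes "zariski_open U" "x \<in> punctured_cone U"
  shows "\<forall>\<^sub>F y in nhds x. y \<in> punctured_cone U"
proof -
  obtain d g where g: "hpoly d g" "g x \<noteq> 0" "\<And>y. y \<noteq> 0 \<Longrightarrow> g y \<noteq> 0 \<Longrightarrow> y \<in> punctured_cone U"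
    using zariski_open_nbhd[OF assms] by blast
  have "open {y. y \<noteq> 0 \<and> g y \<noteq> 0}"
    by (intro open_Collect_conj open_Collect_neq continuous_on_hpoly[OF g(1)] continuous_intros)
  moreover have "x \<in> {y. y \<noteq> 0 \<and> g y \<noteq> 0}" using assms(2) g(2) by (simp add: punctured_cone_def)
  ultimately show ?thesis
    unfolding eventually_nhds using g(3) by blast
qed

lemma tendsto_line: "((\<lambda>t. x + t *s z) \<longlongrightarrow> x + t0 *s z) (at t0 within S)"
  for x z :: "complex ^ 'v::finite"
proof -
  have "continuous_on UNIV (\<lambda>t. x + t *s z)"
    unfolding vector_scalar_mult_def by (intro continuous_intros)
  then show ?thesis
    by (metis UNIV_I continuous_on_def tendsto_within_subset subset_UNIV)
qed

lemma eventually_line: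
  fixes x z :: "complex ^ 'v::finite"
  assumes "\<forall>\<^sub>F y in nhds (x + t0 *s z). P y"
  shows "\<forall>\<^sub>F t in nhds t0. P (x + t *s z)"
proof -
  have "((\<lambda>t. x + t *s z) \<longlongrightarrow> x + t0 *s z) (at t0)" by (rule tendsto_line)
  then have "((\<lambda>t. x + t *s z) \<longlongrightarrow> x + t0 *s z) (nhds t0)"
    using tendsto_at_iff_tendsto_nhds[of "\<lambda>t. x + t *s z" t0] by simp
  then show ?thesis using assms by (rule eventually_compose_filterlim[rotated])
qed

lemma eventually_line_in_punctured_cone:
  fixes x z :: "complex ^ 'v::finite"
  assumes "zariski_open U" "x \<in> punctured_cone U"
  shows "\<forall>\<^sub>F t in at 0. x + t *s z \<in> punctured_cone U"
proof -
  have "\<forall>\<^sub>F t in nhds 0. x + t *s z \<in> punctured_cone U"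
    using eventually_line[where x = x and ?t0.0 = 0 and z = z]
      eventually_in_punctured_cone[OF assms] by simp
  then show ?thesis using eventually_nhds_conv_at by blast
qed

section \<open>Regular functions of a given degree on cones\<close>

lemma homog_regularD:
  assumes "homog_regular m Z f" "x \<in> punctured_cone Z"
  shows "\<exists>d e p q. hpoly d p \<and> hpoly e q \<and> int d = int e + m \<and> q x \<noteq> 0 \<and>
    (\<forall>y\<in>punctured_cone Z. q y \<noteq> 0 \<longrightarrow> f y = p y / q y)"
  using assms unfolding homog_regular_def by blast

lemma homog_regularI:
  assumes "\<And>x. x \<in> punctured_cone Z \<Longrightarrow> \<exists>d e p q. hpoly d p \<and> hpoly e q \<and> int d = int e + m \<and>
    q x \<noteq> 0 \<and> (\<forall>y\<in>punctured_cone Z. q y \<noteq> 0 \<longrightarrow> f y = p y / q y)"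
  shows "homog_regular m Z f"
  using assms unfolding homog_regular_def by blast

lemma homog_regular_cong:
  assumes "homog_regular m Z f" "\<And>x. x \<in> punctured_cone Z \<Longrightarrow> g x = f x"
  shows "homog_regular m Z g"
  using assms unfolding homog_regular_def by simp

lemma homog_regular_cong_degree:
  assumes "homog_regular m Z f" "m = m'" "\<And>x. x \<in> punctured_cone Z \<Longrightarrow> g x = f x"
  shows "homog_regular m' Z g"
  using homog_regular_cong[OF assms(1,3)] assms(2) by simp

lemma homog_regular_subset:
  assumes "homog_regular m Z f" "Y \<subseteq> Z"
  shows "homog_regular m Y f"
  using assms punctured_cone_mono[OF assms(2)] unfolding homog_regular_def by blast

lemma homog_regular_homogeneous:
  assumes "homog_regular m Z f" "x \<in> punctured_cone Z" "c \<noteq> 0"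
  shows "f (c *s x) = c powi m * f x"
proof -
  obtain d e p q where pq: "hpoly d p" "hpoly e q" "int d = int e + m" "q x \<noteq> 0"
    and f: "\<And>y. y \<in> punctured_cone Z \<Longrightarrow> q y \<noteq> 0 \<Longrightarrow> f y = p y / q y"
    using homog_regularD[OF assms(1,2)] by blast
  have "q (c *s x) \<noteq> 0" using hpoly_homogeneous[OF pq(2)] pq(4) assms(3) by simp
  then have "f (c *s x) = p (c *s x) / q (c *s x)"
    using f punctured_cone_scale assms by blast
  also have "\<dots> = c ^ d / c ^ e * (p x / q x)"
    using hpoly_homogeneous[OF pq(1)] hpoly_homogeneous[OF pq(2)] by simp
  also have "c ^ d / c ^ e = c powi (int d - int e)"
    using assms(3) by (simp add: power_int_diff)
  finally show ?thesis using f[OF assms(2) pq(4)] pq(3) by simp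
qed

lemma homog_regular_hpoly: "hpoly d p \<Longrightarrow> homog_regular (int d) Z p"
  unfolding homog_regular_def
  by (intro ballI exI[of _ d] exI[of _ 0] exI[of _ p] exI[of _ "\<lambda>_. 1"]) (auto intro: hpoly.const)

lemma homog_regular_const: "homog_regular 0 Z (\<lambda>_. c)"
  using homog_regular_hpoly[OF hpoly.const] by simp

lemma homog_regular_pairing: "homog_regular 1 Z (pairing a)"
  using homog_regular_hpoly[OF hpoly_pairing] by simp

lemma homog_regular_add:
  assumes "homog_regular m Z f" "homog_regular m Z g"
  shows "homog_regular m Z (\<lambda>x. f x + g x)"
proof (rule homog_regularI)
  fix x assume x: "x \<in> punctured_cone Z"
  obtain d e p q where 1: "hpoly d p" "hpoly e q" "int d = int e + m" "q x \<noteq> 0"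
    "\<And>y. y \<in> punctured_cone Z \<Longrightarrow> q y \<noteq> 0 \<Longrightarrow> f y = p y / q y"
    using homog_regularD[OF assms(1) x] by blast
  obtain d' e' p' q' where 2: "hpoly d' p'" "hpoly e' q'" "int d' = int e' + m" "q' x \<noteq> 0"
    "\<And>y. y \<in> punctured_cone Z \<Longrightarrow> q' y \<noteq> 0 \<Longrightarrow> g y = p' y / q' y"
    using homog_regularD[OF assms(2) x] by blast
  have "d' + e = d + e'" using 1(3) 2(3) by linarith
  then have "hpoly (d + e') (\<lambda>x. p x * q' x + p' x * q x)"
    using hpoly.add[OF hpoly.mult[OF 1(1) 2(2)]] hpoly.mult[OF 2(1) 1(2)] by simp
  moreover have "hpoly (e + e') (\<lambda>x. q x * q' x)" using 1 2 by (intro hpoly.mult)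
  ultimately show "\<exists>d e p q. hpoly d p \<and> hpoly e q \<and> int d = int e + m \<and>
    q x \<noteq> 0 \<and> (\<forall>y\<in>punctured_cone Z. q y \<noteq> 0 \<longrightarrow> f y + g y = p y / q y)"
    using 1(3,4,5) 2(4,5)
    by (intro exI[of _ "d + e'"] exI[of _ "e + e'"] exI[of _ "\<lambda>x. p x * q' x + p' x * q x"]
        exI[of _ "\<lambda>x. q x * q' x"]) (auto simp: add_frac_eq)
qed

lemma homog_regular_mult:
  assumes "homog_regular m Z f" "homog_regular m' Z g"
  shows "homog_regular (m + m') Z (\<lambda>x. f x * g x)"
proof (rule homog_regularI)
  fix x assume x: "x \<in> punctured_cone Z"
  obtain d e p q where 1: "hpoly d p" "hpoly e q" "int d = int e + m" "q x \<noteq> 0"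
    "\<And>y. y \<in> punctured_cone Z \<Longrightarrow> q y \<noteq> 0 \<Longrightarrow> f y = p y / q y"
    using homog_regularD[OF assms(1) x] by blast
  obtain d' e' p' q' where 2: "hpoly d' p'" "hpoly e' q'" "int d' = int e' + m'" "q' x \<noteq> 0"
    "\<And>y. y \<in> punctured_cone Z \<Longrightarrow> q' y \<noteq> 0 \<Longrightarrow> g y = p' y / q' y"
    using homog_regularD[OF assms(2) x] by blast
  show "\<exists>d e p q. hpoly d p \<and> hpoly e q \<and> int d = int e + (m + m') \<and>
    q x \<noteq> 0 \<and> (\<forall>y\<in>punctured_cone Z. q y \<noteq> 0 \<longrightarrow> f y * g y = p y / q y)"
    using 1(3,4,5) 2(3,4,5) hpoly.mult[OF 1(1) 2(1)] hpoly.mult[OF 1(2) 2(2)]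
    by (intro exI[of _ "d + d'"] exI[of _ "e + e'"] exI[of _ "\<lambda>x. p x * p' x"]
        exI[of _ "\<lambda>x. q x * q' x"]) auto
qed

lemma homog_regular_inverse:
  assumes "homog_regular m Z f" "\<And>x. x \<in> punctured_cone Z \<Longrightarrow> f x \<noteq> 0"
  shows "homog_regular (- m) Z (\<lambda>x. inverse (f x))"
proof (rule homog_regularI)
  fix x assume x: "x \<in> punctured_cone Z"
  obtain d e p q where 1: "hpoly d p" "hpoly e q" "int d = int e + m" "q x \<noteq> 0"
    "\<And>y. y \<in> punctured_cone Z \<Longrightarrow> q y \<noteq> 0 \<Longrightarrow> f y = p y / q y"
    using homog_regularD[OF assms(1) x] by blast
  have "p x \<noteq> 0" using 1(4,5) x assms(2)[OF x] by auto
  \<comment> \<open>The fraction is \<open>q q / (p q)\<close> rather than \<open>q / p\<close>: a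
    nonzero denominator then guarantees \<open>q y \<noteq> 0\<close>, where the formula for
    \<open>f\<close> is valid.\<close>
  then show "\<exists>d e p q. hpoly d p \<and> hpoly e q \<and> int d = int e + - m \<and>
    q x \<noteq> 0 \<and> (\<forall>y\<in>punctured_cone Z. q y \<noteq> 0 \<longrightarrow> inverse (f y) = p y / q y)"
    using 1(3,4,5) hpoly.mult[OF 1(2) 1(2)] hpoly.mult[OF 1(1) 1(2)]
    by (intro exI[of _ "e + e"] exI[of _ "d + e"] exI[of _ "\<lambda>x. q x * q x"]
        exI[of _ "\<lambda>x. p x * q x"]) auto
qed

lemma homog_regular_divide:
  assumes "homog_regular m Z f" "homog_regular m' Z g" "\<And>x. x \<in> punctured_cone Z \<Longrightarrow> g x \<noteq> 0"
  shows "homog_regular (m - m') Z (\<lambda>x. f x / g x)"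
  using homog_regular_mult[OF assms(1) homog_regular_inverse[OF assms(2,3)]]
  by (simp add: divide_inverse)

lemma homog_regular_cmult: "homog_regular m Z f \<Longrightarrow> homog_regular m Z (\<lambda>x. c * f x)"
  using homog_regular_mult[OF homog_regular_const[of Z c]] by fastforce

lemma homog_regular_diff:
  assumes "homog_regular m Z f" "homog_regular m Z g"
  shows "homog_regular m Z (\<lambda>x. f x - g x)"
  using homog_regular_add[OF assms(1) homog_regular_cmult[OF assms(2), of "- 1"]] by simp

lemma homog_regular_zero: "homog_regular m Z (\<lambda>_. 0)"
proof (cases "m \<ge> 0")
  case True
  then show ?thesis using homog_regular_hpoly[OF hpoly_zero, of "nat m"] by simp
next
  case False
  show ?thesis
  proof (rule homog_regularI)
    fix x :: "complex ^ 'a" assume "x \<in> punctured_cone Z"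
    then obtain i where i: "x $ i \<noteq> 0" by (auto simp: punctured_cone_def vec_eq_iff)
    have "hpoly (nat (- m)) (\<lambda>x::complex^'a. x $ i ^ nat (- m))"
      using hpoly_power[OF hpoly.coord, of "nat (- m)" i] by simp
    then show "\<exists>d e p q. hpoly d p \<and> hpoly e q \<and> int d = int e + m \<and>
      q x \<noteq> 0 \<and> (\<forall>y\<in>punctured_cone Z. q y \<noteq> 0 \<longrightarrow> 0 = p y / q y)"
      using i False hpoly.const[of 0]
      by (intro exI[of _ 0] exI[of _ "nat (- m)"] exI[of _ "\<lambda>_. 0"] exI[of _ "\<lambda>x. x $ i ^ nat (- m)"]) auto
  qed
qed

lemma homog_regular_sum:
  "(\<And>i. i \<in> I \<Longrightarrow> homog_regular m Z (f i)) \<Longrightarrow> homog_regular m Z (\<lambda>x. \<Sum>i\<in>I. f i x)"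
  by (induction I rule: infinite_finite_induct) (auto intro: homog_regular_zero homog_regular_add)

lemma homog_regular_prod:
  "(\<And>i. i \<in> I \<Longrightarrow> homog_regular 0 Z (f i)) \<Longrightarrow> homog_regular 0 Z (\<lambda>x. \<Prod>i\<in>I. f i x)"
proof (induction I rule: infinite_finite_induct)
  case (insert i I)
  then show ?case using homog_regular_mult[of 0 Z "f i" 0] by simp
qed (auto intro: homog_regular_const)

lemma homog_regular_local:
  assumes "\<And>x. x \<in> punctured_cone Z \<Longrightarrow>
    \<exists>N. zariski_open N \<and> pt x \<in> N \<and> homog_regular m (N \<inter> Z) f"
  shows "homog_regular m Z f"
proof (rule homog_regularI)
  fix x assume x: "x \<in> punctured_cone Z"
  then obtain N where N: "zariski_open N" "pt x \<in> N" "homog_regular m (N \<inter> Z) f"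
    using assms by blast
  then have xN: "x \<in> punctured_cone N" using x by (simp add: punctured_cone_def)
  then have xNZ: "x \<in> punctured_cone (N \<inter> Z)" using x by simp
  obtain d e p q where 1: "hpoly d p" "hpoly e q" "int d = int e + m" "q x \<noteq> 0"
    "\<And>y. y \<in> punctured_cone (N \<inter> Z) \<Longrightarrow> q y \<noteq> 0 \<Longrightarrow> f y = p y / q y"
    using homog_regularD[OF N(3) xNZ] by blast
  obtain c g where g: "hpoly c g" "g x \<noteq> 0" "\<And>y. y \<noteq> 0 \<Longrightarrow> g y \<noteq> 0 \<Longrightarrow> y \<in> punctured_cone N"
    using zariski_open_nbhd[OF N(1) xN] by blast
  \<comment> \<open>The factor \<open>g\<close> vanishes outside the cone over \<open>N\<close>, so
    it confines the quotient formula to \<open>N\<close> without changing its value or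
    degree.\<close>
  have "\<forall>y\<in>punctured_cone Z. q y * g y \<noteq> 0 \<longrightarrow> f y = (p y * g y) / (q y * g y)"
    using 1(5) g(3) by (auto simp: punctured_cone_def)
  then show "\<exists>d e p q. hpoly d p \<and> hpoly e q \<and> int d = int e + m \<and>
    q x \<noteq> 0 \<and> (\<forall>y\<in>punctured_cone Z. q y \<noteq> 0 \<longrightarrow> f y = p y / q y)"
    using 1(3,4) g(2) hpoly.mult[OF 1(1) g(1)] hpoly.mult[OF 1(2) g(1)]
    by (intro exI[of _ "d + c"] exI[of _ "e + c"] exI[of _ "\<lambda>x. p x * g x"]
        exI[of _ "\<lambda>x. q x * g x"]) auto
qed

lemma continuous_on_homog_regular:
  fixes f :: "complex ^ 'v::finite \<Rightarrow> complex"
  assumes "homog_regular m Z f"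
  shows "continuous_on (punctured_cone Z) f"
  unfolding continuous_on_def
proof
  fix x assume x: "x \<in> punctured_cone Z"
  obtain d e p q where 1: "hpoly d p" "hpoly e q" and deg: "int d = int e + m" and 2: "q x \<noteq> 0"
    "\<And>y. y \<in> punctured_cone Z \<Longrightarrow> q y \<noteq> 0 \<Longrightarrow> f y = p y / q y"
    using homog_regularD[OF assms(1) x] by blast
  have cont: "(p \<longlongrightarrow> p x) (at x within punctured_cone Z)" "(q \<longlongrightarrow> q x) (at x within punctured_cone Z)"
    using continuous_on_hpoly[OF 1(1)] continuous_on_hpoly[OF 1(2)] x unfolding continuous_on_def
    by blast+
  then have "((\<lambda>y. p y / q y) \<longlongrightarrow> f x) (at x within punctured_cone Z)"
    using 2 x by (auto intro!: tendsto_eq_intros)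
  moreover have "\<forall>\<^sub>F y in at x within punctured_cone Z. f y = p y / q y"
    using tendsto_imp_eventually_ne[OF cont(2) 2(1)] 2(2)
    by (auto simp: eventually_at_filter elim!: eventually_mono)
  ultimately show "(f \<longlongrightarrow> f x) (at x within punctured_cone Z)"
    using tendsto_cong[of f "\<lambda>y. p y / q y" "at x within punctured_cone Z" "f x"] by blast
qed

lemma homog_regular_tendsto_line:
  fixes f :: "complex ^ 'v::finite \<Rightarrow> complex"
  assumes "homog_regular m U f" "zariski_open U" "x \<in> punctured_cone U"
  shows "((\<lambda>t. f (x + t *s z)) \<longlongrightarrow> f x) (at 0)"
proof (rule continuous_on_tendsto_compose[OF continuous_on_homog_regular[OF assms(1)]])
  show "((\<lambda>t. x + t *s z) \<longlongrightarrow> x) (at 0)" using tendsto_line[of x z 0] by simp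
  show "\<forall>\<^sub>F t in at 0. x + t *s z \<in> punctured_cone U"
    by (rule eventually_line_in_punctured_cone[OF assms(2,3)])
qed fact

lemma homog_regular_line_differentiable:
  fixes f :: "complex ^ 'v::finite \<Rightarrow> complex"
  assumes "homog_regular m Z f" and line: "\<And>t. x + t *s z \<in> punctured_cone Z"
  shows "(\<lambda>t. f (x + t *s z)) holomorphic_on UNIV"
  unfolding holomorphic_on_def
proof
  fix t0 :: complex
  obtain d e p q where 1: "hpoly d p" "hpoly e q" and deg: "int d = int e + m" and 2: "q (x + t0 *s z) \<noteq> 0"
    "\<And>y. y \<in> punctured_cone Z \<Longrightarrow> q y \<noteq> 0 \<Longrightarrow> f y = p y / q y"
    using homog_regularD[OF assms(1) line[of t0]] by blast
  have hol: "(\<lambda>t. p (x + t *s z)) holomorphic_on UNIV" "(\<lambda>t. q (x + t *s z)) holomorphic_on UNIV"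
    by (rule hpoly_line_holomorphic, fact)+
  define S where "S = {t. q (x + t *s z) \<noteq> 0}"
  have "open S"
    unfolding S_def using hol(2) by (intro open_Collect_neq holomorphic_on_imp_continuous_on) auto
  moreover have "t0 \<in> S" using 2(1) by (simp add: S_def)
  moreover have "(\<lambda>t. p (x + t *s z) / q (x + t *s z)) holomorphic_on S"
    by (intro holomorphic_intros holomorphic_on_subset[OF hol(1)] holomorphic_on_subset[OF hol(2)])
      (auto simp: S_def)
  then have "(\<lambda>t. f (x + t *s z)) holomorphic_on S"
    by (rule holomorphic_transform) (use 2(2) line in \<open>auto simp: S_def\<close>)
  ultimately show "(\<lambda>t. f (x + t *s z)) field_differentiable (at t0 within UNIV)"
    using holomorphic_on_open holomorphic_on_imp_differentiable_at by auto
qed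

section \<open>Regular functions and regular matrices\<close>

lemma regular_on_subset: "regular_on Z f \<Longrightarrow> Y \<subseteq> Z \<Longrightarrow> regular_on Y f"
  unfolding regular_on_def by (rule homog_regular_subset)

lemma regular_on_cong: "regular_on Z f \<Longrightarrow> (\<And>l. l \<in> Z \<Longrightarrow> g l = f l) \<Longrightarrow> regular_on Z g"
  unfolding regular_on_def by (erule homog_regular_cong) (simp add: punctured_cone_def)

lemma regular_on_const: "regular_on Z (\<lambda>_. c)"
  unfolding regular_on_def by (rule homog_regular_const)

lemma regular_on_add: "regular_on Z f \<Longrightarrow> regular_on Z g \<Longrightarrow> regular_on Z (\<lambda>l. f l + g l)"
  unfolding regular_on_def by (rule homog_regular_add)

lemma regular_on_mult: "regular_on Z f \<Longrightarrow> regular_on Z g \<Longrightarrow> regular_on Z (\<lambda>l. f l * g l)"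
  unfolding regular_on_def using homog_regular_mult[of 0 Z _ 0] by simp

lemma regular_on_divide:
  "regular_on Z f \<Longrightarrow> regular_on Z g \<Longrightarrow> (\<And>l. l \<in> Z \<Longrightarrow> g l \<noteq> 0) \<Longrightarrow> regular_on Z (\<lambda>l. f l / g l)"
  unfolding regular_on_def using homog_regular_divide[of 0 Z _ 0] by (simp add: punctured_cone_def)

lemma regular_on_sum:
  "(\<And>i. i \<in> I \<Longrightarrow> regular_on Z (f i)) \<Longrightarrow> regular_on Z (\<lambda>l. \<Sum>i\<in>I. f i l)"
  unfolding regular_on_def by (rule homog_regular_sum)

lemma regular_on_prod:
  "(\<And>i. i \<in> I \<Longrightarrow> regular_on Z (f i)) \<Longrightarrow> regular_on Z (\<lambda>l. \<Prod>i\<in>I. f i l)"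
  unfolding regular_on_def by (rule homog_regular_prod)

lemma regular_on_local:
  assumes "\<And>l. l \<in> Z \<Longrightarrow> \<exists>N. zariski_open N \<and> l \<in> N \<and> regular_on (N \<inter> Z) f"
  shows "regular_on Z f"
  unfolding regular_on_def
  by (rule homog_regular_local) (use assms in \<open>auto simp: punctured_cone_def regular_on_def\<close>)

lemma regular_on_mult_vec:
  assumes "\<And>i j. regular_on Z (\<lambda>l. A l $ i $ j)" "\<And>j. regular_on Z (\<lambda>l. v l $ j)"
  shows "regular_on Z (\<lambda>l. (A l *v v l) $ i)"
  using assms by (simp add: matrix_vector_mult_def regular_on_sum regular_on_mult)

lemma regular_on_mult_matrix:
  assumes "\<And>i j. regular_on Z (\<lambda>l. A l $ i $ j)" "\<And>i j. regular_on Z (\<lambda>l. A' l $ i $ j)"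
  shows "regular_on Z (\<lambda>l. (A l ** A' l) $ i $ j)"
  using assms by (simp add: matrix_matrix_mult_def regular_on_sum regular_on_mult)

lemma regular_on_det:
  assumes "\<And>i j. regular_on Z (\<lambda>l. A l $ i $ j)"
  shows "regular_on Z (\<lambda>l. det (A l))"
  unfolding det_def
  by (intro regular_on_sum regular_on_mult regular_on_prod regular_on_const assms)

lemma regular_on_nonzero_nbhd:
  assumes "regular_on N f" "zariski_open N" "l \<in> N" "f l \<noteq> 0"
  obtains N' where "zariski_open N'" "l \<in> N'" "N' \<subseteq> N" "\<And>m. m \<in> N' \<Longrightarrow> f m \<noteq> 0"
proof -
  have l: "coords l \<in> punctured_cone N" using assms by simp
  obtain d e p q where 1: "hpoly d p" "hpoly e q" and deg: "int d = int e + 0" and 2: "q (coords l) \<noteq> 0"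
    "\<And>y. y \<in> punctured_cone N \<Longrightarrow> q y \<noteq> 0 \<Longrightarrow> f (pt y) = p y / q y"
    using homog_regularD[OF assms(1)[unfolded regular_on_def] l] by blast
  have p: "p (coords l) \<noteq> 0" using 2(1) 2(2)[OF l] assms(4) by auto
  show thesis
  proof
    show "zariski_open (N \<inter> {m. p (coords m) \<noteq> 0} \<inter> {m. q (coords m) \<noteq> 0})"
      using 1 assms(2) by (intro zariski_open_Int zariski_open_basic)
    show "f m \<noteq> 0" if "m \<in> N \<inter> {m. p (coords m) \<noteq> 0} \<inter> {m. q (coords m) \<noteq> 0}" for m
      using 2(2)[of "coords m"] that by auto
  qed (use assms p 2 in auto)
qed

text \<open>A left inverse \<open>P\<close> of \<open>A l\<close> makes \<open>P ** A m\<close> a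
  square matrix that is the identity at \<open>l\<close>, hence invertible where its determinant is
  nonzero. Cramer's rule, applied to the columns of \<open>P\<close>, expresses its inverse times
  \<open>P\<close> by regular functions.\<close>

lemma regular_left_inverse:
  fixes A :: "'v::finite proj \<Rightarrow> complex ^ 'r::finite ^ 'w::finite"
  assumes reg: "\<And>i j. regular_on N (\<lambda>m. A m $ i $ j)" and N: "zariski_open N" "l \<in> N"
    and inj: "inj ((*v) (A l))"
  obtains N' L where "zariski_open N'" "l \<in> N'" "N' \<subseteq> N" "\<And>i j. regular_on N' (\<lambda>m. L m $ i $ j)"
    "\<And>m. m \<in> N' \<Longrightarrow> L m ** A m = mat 1"
proof -
  obtain P where P: "P ** A l = mat 1" using inj matrix_left_invertible_injective by blast
  define D where "D m = P ** A m" for m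
  have regD: "regular_on N (\<lambda>m. D m $ i $ j)" for i j
    unfolding D_def by (intro regular_on_mult_matrix reg regular_on_const)
  have "det (D l) \<noteq> 0" by (simp add: D_def P)
  then obtain N' where N': "zariski_open N'" "l \<in> N'" "N' \<subseteq> N" "\<And>m. m \<in> N' \<Longrightarrow> det (D m) \<noteq> 0"
    using regular_on_nonzero_nbhd[OF regular_on_det[OF regD] N] by blast
  define L where "L m = (\<chi> k j. det (\<chi> a b. if b = k then column j P $ a else D m $ a $ b) / det (D m))" for m
  have reg': "regular_on N' (\<lambda>m. L m $ i $ j)" for i j
  proof -
    have "regular_on N' (\<lambda>m. det (\<chi> a b. if b = i then column j P $ a else D m $ a $ b))"
    proof (rule regular_on_det)
      fix a b
      show "regular_on N' (\<lambda>m. (\<chi> a b. if b = i then column j P $ a else D m $ a $ b) $ a $ b)"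
        by (cases "b = i") (auto intro: regular_on_const regular_on_subset[OF regD N'(3)])
    qed
    moreover have "regular_on N' (\<lambda>m. det (D m))"
      using regular_on_det regD regular_on_subset N'(3) by blast
    ultimately show ?thesis using N'(4) by (simp add: L_def regular_on_divide)
  qed
  have inv: "L m ** A m = mat 1" if "m \<in> N'" for m
  proof -
    have "column j (L m) = (\<chi> k. det (\<chi> a b. if b = k then column j P $ a else D m $ a $ b) / det (D m))" for j
      by (subst column_def) (simp add: L_def)
    then have col: "D m *v column j (L m) = column j P" for j
      using cramer[OF N'(4)[OF that], of "column j (L m)" "column j P"]
      by simp
    have "D m ** L m = P"
      using col by (simp add: vec_eq_iff matrix_matrix_mult_def matrix_vector_mult_def column_def)
    then have "D m ** (L m ** A m) = D m" by (simp add: matrix_mul_assoc D_def)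
    moreover have "\<exists>E. E ** D m = mat 1"
      using N'(4)[OF that] invertible_det_nz invertible_left_inverse by blast
    then obtain E where "E ** D m = mat 1"
      by blast
    ultimately show ?thesis by (metis matrix_mul_assoc matrix_mul_lid)
  qed
  show thesis using that N' reg' inv by blast
qed


subsection \<open>Global sections of \<open>O(m)\<close>\<close>

text \<open>A section of \<open>O(m)\<close> is bounded on the unit sphere, so it grows along a line that misses
  the origin at most like a polynomial of degree \<open>m\<close>, and Liouville's theorem applies.\<close>

lemma homog_regular_line_polynomial:
  fixes f :: "complex ^ 'v::finite \<Rightarrow> complex"
  assumes f: "homog_regular (int m) Z f"
    and X: "punctured_cone Z = X - {0}" "closed X" "\<And>c x. x \<in> X \<Longrightarrow> c *s x \<in> X"
    and line: "\<And>t. x + t *s y \<in> punctured_cone Z"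
  shows "\<exists>c. \<forall>t. f (x + t *s y) = (\<Sum>k\<le>m. c k * t ^ k)"
proof -
  have "compact (X \<inter> sphere 0 1)" using X(2) by (intro closed_Int_compact compact_sphere)
  moreover have "continuous_on (X \<inter> sphere 0 1) f"
    using continuous_on_homog_regular[OF f] by (rule continuous_on_subset) (auto simp: X(1))
  ultimately have "bounded (f ` (X \<inter> sphere 0 1))"
    by (intro compact_imp_bounded compact_continuous_image)
  then obtain C where "C > 0" "\<forall>y\<in>f ` (X \<inter> sphere 0 1). cmod y \<le> C"
    unfolding bounded_pos by blast
  then have C: "cmod (f u) \<le> C" if "u \<in> X" "norm u = 1" for u using that by simp
  have bound: "cmod (f u) \<le> C * norm u ^ m" if "u \<in> punctured_cone Z" for u
  proof -
    have u: "u \<in> X" "u \<noteq> 0" using that X(1) by auto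
    define u' where "u' = of_real (1 / norm u) *s u"
    have u': "u' \<in> X" unfolding u'_def by (rule X(3)) (rule u(1))
    have u'_norm: "norm u' = 1" using u(2) by (simp add: u'_def norm_smult_vec norm_divide)
    then have "u' \<noteq> 0" by auto
    then have "u' \<in> punctured_cone Z" using u' X(1) by simp
    then have "f (of_real (norm u) *s u') = of_real (norm u) ^ m * f u'"
      using homog_regular_homogeneous[OF f, of u' "of_real (norm u)"] u(2) by simp
    moreover have "of_real (norm u) *s u' = u" using u by (simp add: u'_def vector_smult_assoc)
    ultimately have "cmod (f u) = norm u ^ m * cmod (f u')" by (simp add: norm_mult norm_power)
    also have "\<dots> \<le> norm u ^ m * C" using C[OF u' u'_norm] by (intro mult_left_mono) auto
    finally show ?thesis by (simp add: mult.commute)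
  qed
  have growth: "cmod (f (x + t *s y)) \<le> (C * (norm x + norm y) ^ m) * cmod t ^ m" if "1 \<le> cmod t" for t
  proof -
    have "norm (x + t *s y) \<le> norm x + cmod t * norm y"
      using norm_triangle_ineq[of x "t *s y"] by (simp add: norm_smult_vec)
    also have "\<dots> \<le> (norm x + norm y) * cmod t"
      using that mult_left_mono[OF that, of "norm x"] by (simp add: algebra_simps)
    finally have "norm (x + t *s y) ^ m \<le> ((norm x + norm y) * cmod t) ^ m"
      by (intro power_mono) auto
    then have "C * norm (x + t *s y) ^ m \<le> C * ((norm x + norm y) * cmod t) ^ m"
      using \<open>C > 0\<close> by simp
    with bound[OF line] have "cmod (f (x + t *s y)) \<le> C * ((norm x + norm y) * cmod t) ^ m"
      by (rule order_trans)
    then show ?thesis by (simp add: power_mult_distrib mult.assoc)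
  qed
  show ?thesis
    by (intro exI allI) (rule Liouville_polynomial[OF homog_regular_line_differentiable[OF f line] growth])
qed

text \<open>The growth bound has degree 0, so \<open>f\<close> is constant along every line in the
  cone that misses the origin. Distinct points have independent representatives \<open>x\<close> and
  \<open>y\<close>, and \<open>f\<close> takes the same value at \<open>x\<close>,
  \<open>x + y\<close> and \<open>y\<close>.\<close>

lemma regular_on_hyperplane_const:
  fixes h :: "'v::finite proj"
  assumes "regular_on (hyperplane h) f"
  obtains c where "\<And>l. l \<in> hyperplane h \<Longrightarrow> f l = c"
proof -
  define X where "X = {x. pairing (coords h) x = 0}"
  have "x \<in> punctured_cone (hyperplane h) \<longleftrightarrow> x \<in> X - {0}" for x
    by (cases "x = 0") (simp_all add: punctured_cone_iff mem_hyperplane_pt X_def)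
  then have X: "punctured_cone (hyperplane h) = X - {0}" "closed X" "\<And>c x. x \<in> X \<Longrightarrow> c *s x \<in> X"
    by (auto simp: X_def pairing_scale_right intro!: closed_Collect_eq continuous_intros)
  have f: "homog_regular (int 0) (hyperplane h) (\<lambda>x. f (pt x))"
    using assms by (simp add: regular_on_def)
  have step: "f (pt (x + y)) = f (pt x)"
    if "x \<in> X" "y \<in> X" "\<And>c. x + c *s y \<noteq> 0" for x y
  proof -
    have "x + t *s y \<in> punctured_cone (hyperplane h)" for t
      using that X(1) by (simp add: X_def pairing_add_right pairing_scale_right)
    from homog_regular_line_polynomial[OF f X this] obtain c
      where c: "\<And>t. f (pt (x + t *s y)) = c (0::nat)" by auto
    show ?thesis using c[of 0] c[of 1] by simp
  qed
  have "f l = f m" if "l \<in> hyperplane h" "m \<in> hyperplane h" for l m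
  proof (cases "l = m")
    case False
    have lm: "coords l \<in> X" "coords m \<in> X" using that by (simp_all add: X_def hyperplane_def)
    have no: "coords a + c *s coords b \<noteq> 0" if "a \<noteq> b" for a b :: "'v proj" and c
    proof
      assume "coords a + c *s coords b = 0"
      then have "coords a = (- c) *s coords b" by (simp add: add_eq_0_iff2)
      then have "pt (coords a) = pt (coords b)" by (metis coords_nonzero pt_eq_iff)
      with that show False by simp
    qed
    show ?thesis
      using step[OF lm no[OF False]] step[OF lm(2,1) no[OF False[symmetric]]]
      by (simp add: add.commute)
  qed simp
  then show thesis using that by (metis (full_types))
qed

text \<open>Along a line missing the origin \<open>f\<close> equals \<open>c 0 + c 1 * t\<close>. By
  homogeneity, with s = 1 / t, the value at \<open>y + s *s x\<close> is
  \<open>s * c 0 + c 1\<close>; letting s tend to 0 identifies \<open>c 1\<close> with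
  \<open>f y\<close>, which is additivity.\<close>

lemma homog_regular_1_linear:
  fixes f :: "complex ^ 'v::finite \<Rightarrow> complex"
  assumes f: "homog_regular 1 UNIV f"
  obtains a where "\<And>x. x \<noteq> 0 \<Longrightarrow> f x = pairing a x"
proof -
  have hom: "f (c *s x) = c * f x" if "x \<noteq> 0" "c \<noteq> 0" for c x
    using homog_regular_homogeneous[OF f, of x c] that by simp
  have f': "homog_regular (int 1) UNIV f" using f by simp
  have add: "f (x + y) = f x + f y" if no: "\<And>c. x + c *s y \<noteq> 0" and y: "y \<noteq> 0" for x y
  proof -
    have "\<exists>c. \<forall>t. f (x + t *s y) = (\<Sum>k\<le>1. c k * t ^ k)"
      by (rule homog_regular_line_polynomial[OF f', where X = UNIV]) (use no in auto)
    then obtain c where "\<forall>t. f (x + t *s y) = (\<Sum>k\<le>1. c k * t ^ k)" by blast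
    then have c: "f (x + t *s y) = c 0 + c 1 * t" for t by simp
    have "f (y + s *s x) = s * c 0 + c 1" if "s \<noteq> 0" for s
    proof -
      have eq: "y + s *s x = s *s (x + inverse s *s y)"
        using that by (simp add: vector_add_ldistrib vector_smult_assoc)
      have "f (y + s *s x) = s * f (x + inverse s *s y)"
        by (subst eq) (rule hom[OF no that])
      also have "\<dots> = s * c 0 + c 1" unfolding c using that by (simp add: field_simps)
      finally show ?thesis .
    qed
    then have "\<forall>\<^sub>F s in at 0. f (y + s *s x) = s * c 0 + c 1"
      by (simp add: eventually_at_filter)
    moreover have "((\<lambda>s. f (y + s *s x)) \<longlongrightarrow> f y) (at 0)"
      using homog_regular_tendsto_line[OF f, of y x] y by simp
    ultimately have "((\<lambda>s. s * c 0 + c 1) \<longlongrightarrow> f y) (at 0)"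
      by (rule Lim_transform_eventually[rotated])
    moreover have "((\<lambda>s. s * c 0 + c 1) \<longlongrightarrow> c 1) (at 0)" by (auto intro!: tendsto_eq_intros)
    ultimately have "f y = c 1" using tendsto_unique[of "at (0::complex)"] by auto
    then show ?thesis using c[of 0] c[of 1] by simp
  qed
  define F where "F x = (if x = 0 then 0 else f x)" for x
  have F_scale: "F (c *s x) = c * F x" for c x by (auto simp: F_def hom)
  have "F (x + y) = F x + F y" for x y
  proof (cases "x = 0 \<or> y = 0")
    case False
    show ?thesis
    proof (cases "\<exists>c. x + c *s y = 0")
      case True
      then obtain c where c: "x = (- c) *s y" by (auto simp: add_eq_0_iff2)
      then have "x + y = (- c + 1) *s y" by (simp only: vector_sadd_rdistrib vector_smult_lid)
      then have "F (x + y) = (- c + 1) * F y" by (simp only: F_scale)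
      also have "\<dots> = F x + F y" unfolding c F_scale by (simp add: algebra_simps)
      finally show ?thesis .
    next
      case no: False
      then have "x + 1 *s y \<noteq> 0" by blast
      then show ?thesis using add[of x y] False no by (simp add: F_def)
    qed
  qed (auto simp: F_def)
  then have lin: "linear_form F" using F_scale by (simp add: linear_form_def)
  have "F x = pairing (\<chi> i. F (axis i 1)) x" for x
  proof -
    have "F x = F (\<Sum>i\<in>UNIV. x $ i *s axis i 1)" by (simp add: basis_expansion)
    also have "\<dots> = (\<Sum>i\<in>UNIV. x $ i * F (axis i 1))" using linear_form_sum[OF lin] .
    finally show ?thesis by (simp add: pairing_def mult.commute)
  qed
  moreover have "F x = f x" if "x \<noteq> 0" for x using that by (simp add: F_def)
  ultimately show thesis using that[of "\<chi> i. F (axis i 1)"] by simp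
qed


subsection \<open>Sections of vector bundles\<close>

lemma chart_dom_dual [simp]: "chart_dom (dual S) = chart_dom S"
  and transition_dual [simp]: "transition (dual S) a b l = transpose (transition S b a l)"
  by (simp_all add: dual_def)

lemma sectionsI:
  assumes "\<And>a i. regular_on (chart_dom E a \<inter> Z) (\<lambda>l. s a l $ i)"
    and "\<And>a b l. l \<in> chart_dom E a \<Longrightarrow> l \<in> chart_dom E b \<Longrightarrow> l \<in> Z \<Longrightarrow> s a l = transition E a b l *v s b l"
    and "\<And>a l. l \<notin> chart_dom E a \<inter> Z \<Longrightarrow> s a l = 0"
  shows "s \<in> sections E Z"
  using assms unfolding sections_def by blast

lemma sections_regular: "s \<in> sections E Z \<Longrightarrow> regular_on (chart_dom E a \<inter> Z) (\<lambda>l. s a l $ i)"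
  unfolding sections_def by blast

lemma sections_transition:
  "s \<in> sections E Z \<Longrightarrow> l \<in> chart_dom E a \<Longrightarrow> l \<in> chart_dom E b \<Longrightarrow> l \<in> Z \<Longrightarrow>
    s a l = transition E a b l *v s b l"
  unfolding sections_def by blast

lemma sections_outside: "s \<in> sections E Z \<Longrightarrow> l \<notin> chart_dom E a \<inter> Z \<Longrightarrow> s a l = 0"
  unfolding sections_def by blast

lemma vector_bundle_cover:
  assumes "vector_bundle E"
  obtains a where "l \<in> chart_dom E a"
  using assms unfolding vector_bundle_def by blast

lemma vector_bundle_open: "vector_bundle E \<Longrightarrow> zariski_open (chart_dom E a)"
  and vector_bundle_regular:
    "vector_bundle E \<Longrightarrow> regular_on (chart_dom E a \<inter> chart_dom E b) (\<lambda>l. transition E a b l $ i $ j)"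
  and vector_bundle_cocycle: "vector_bundle E \<Longrightarrow> l \<in> chart_dom E a \<Longrightarrow> l \<in> chart_dom E b \<Longrightarrow>
    l \<in> chart_dom E c \<Longrightarrow> transition E a b l ** transition E b c l = transition E a c l"
  unfolding vector_bundle_def by blast+


subsection \<open>Steiner bundles as pencils of linear maps\<close>

text \<open>With a right inverse \<open>R\<close> of \<open>B\<close>, the map sending
  \<open>(d, e)\<close> to \<open>A d + R e\<close> is injective: \<open>B\<close> recovers
  \<open>e\<close>, and then \<open>A\<close> recovers \<open>d\<close>.\<close>

lemma exact_dim_le:
  fixes A :: "complex ^ 'r::finite ^ 'w::finite" and B :: "complex ^ 'w ^ 'i::finite"
  assumes "inj ((*v) A)" "range ((*v) A) \<subseteq> {w. B *v w = 0}" "surj ((*v) B)"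
  shows "CARD('r) + CARD('i) \<le> CARD('w)"
proof (rule ccontr)
  assume less: "\<not> CARD('r) + CARD('i) \<le> CARD('w)"
  obtain R where R: "B ** R = mat 1" using assms(3) matrix_right_invertible_surjective by blast
  define d where "d u = (\<chi> i. u $ Inl i)" for u :: "complex ^ ('r + 'i)"
  define e where "e u = (\<chi> i. u $ Inr i)" for u :: "complex ^ ('r + 'i)"
  have lin [simp]: "d (u + v) = d u + d v" "e (u + v) = e u + e v" "d (c *s u) = c *s d u"
    "e (c *s u) = c *s e u" for u v c
    by (simp_all add: d_def e_def vec_eq_iff)
  define F where "F = (\<lambda>i u. (A *v d u + R *v e u) $ i) ` UNIV"
  have "card F \<le> CARD('w)" unfolding F_def by (rule card_image_le) simp
  then have "card F < CARD('r + 'i)" using less by simp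
  moreover have "linear_form f" if "f \<in> F" for f
    using that unfolding F_def linear_form_def
    by (auto simp: matrix_vector_right_distrib vector_scalar_commute algebra_simps)
  ultimately obtain u where u: "u \<noteq> 0" "\<forall>f\<in>F. f u = 0"
    using linear_form_common_zero[of F] by (auto simp: F_def)
  then have sum: "A *v d u + R *v e u = 0" by (auto simp: F_def vec_eq_iff)
  have "B *v (A *v d u) = 0" using assms(2) by blast
  moreover have "B *v (R *v e u) = e u" by (simp add: matrix_vector_mul_assoc R)
  ultimately have e0: "e u = 0"
    using arg_cong[OF sum, of "(*v) B"] by (simp add: matrix_vector_right_distrib)
  then have "A *v d u = A *v 0" using sum by simp
  then have d0: "d u = 0" using assms(1) by (metis injD)
  have "u $ i = 0" for i
    using d0 e0 by (cases i) (auto simp: d_def e_def vec_eq_iff)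
  then show False using u(1) by (simp add: vec_eq_iff)
qed

text \<open>\<open>A\<close> is the inclusion of the dual bundle into W \<otimes> O, and
  \<open>A_transition\<close> its compatibility with the inverse transposed cocycle.
  \<open>rank\<close>, that is r <= n, provides n >= 1 and later keeps a system of equations
  underdetermined.\<close>

locale steiner_resolution = steiner_map B
  for B :: "complex ^ 'v::finite \<Rightarrow> complex ^ 'w::finite \<Rightarrow> complex ^ 'i::finite" +
  fixes S :: "('a, 'v, 'r::finite) vbundle" and A :: "'a \<Rightarrow> 'v proj \<Rightarrow> complex ^ 'r ^ 'w"
  assumes S: "vector_bundle S"
    and A_regular: "regular_on (chart_dom S a) (\<lambda>l. A a l $ p $ q)"
    and A_transition: "l \<in> chart_dom S a \<Longrightarrow> l \<in> chart_dom S b \<Longrightarrow>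
      A b l ** transpose (transition S a b l) = A a l"
    and A_inj: "l \<in> chart_dom S a \<Longrightarrow> inj ((*v) (A a l))"
    and A_range: "l \<in> chart_dom S a \<Longrightarrow> range ((*v) (A a l)) = {w. B (coords l) w = 0}"
    and rank: "CARD('r) < CARD('v)"

text \<open>The entries of the second map in the chart \<open>c\<close>, multiplied by
  \<open>x $ c\<close>, agree on overlaps. Each is therefore a section of O(1) on the whole space,
  hence a linear form \<open>C p q\<close>, and these forms are the coefficients of
  \<open>B\<close>.\<close>

lemma steiner_bundle_resolution:
  fixes S :: "('a, 'v::finite, 'r::finite) vbundle"
  assumes "steiner_bundle TYPE('w::finite) TYPE('i::finite) S"
    and dims: "CARD('w) + 1 = CARD('v) + CARD('i)"
  obtains B :: "complex ^ 'v \<Rightarrow> complex ^ 'w \<Rightarrow> complex ^ 'i" and A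
  where "steiner_resolution B S A"
proof -
  let ?T = "trivial_bundle :: (unit, 'v, 'w) vbundle"
  let ?G = "twisted_bundle :: ('v, 'v, 'i) vbundle"
  obtain \<A> \<B> where ex: "short_exact (dual S) \<A> ?T \<B> ?G" and S: "vector_bundle S"
    using assms(1) unfolding steiner_bundle_def by blast
  define A where "A a = \<A> a ()" for a
  define M where "M c = \<B> () c" for c
  have homA: "bundle_hom (dual S) ?T \<A>" and homB: "bundle_hom ?T ?G \<B>"
    and exact': "\<forall>l\<in>chart_dom (dual S) a \<inter> chart_dom ?T () \<inter> chart_dom ?G c.
      inj ((*v) (\<A> a () l)) \<and> range ((*v) (\<A> a () l)) = {w. \<B> () c l *v w = 0} \<and>
      surj ((*v) (\<B> () c l))" for a c
    using ex unfolding short_exact_def by blast+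
  have exact: "inj ((*v) (A a l))" "range ((*v) (A a l)) = {w. M c l *v w = 0}" "surj ((*v) (M c l))"
    if "l \<in> chart_dom S a" "coords l $ c \<noteq> 0" for a c l
    using exact'[of a c] that by (simp_all add: A_def M_def dual_def trivial_bundle_def twisted_bundle_def)
  have A_reg: "regular_on (chart_dom S a) (\<lambda>l. A a l $ p $ q)" for a p q
    using homA by (simp add: bundle_hom_def A_def dual_def trivial_bundle_def)
  have A_trans: "A b l ** transpose (transition S a b l) = A a l"
    if "l \<in> chart_dom S a" "l \<in> chart_dom S b" for a b l
  proof -
    have "\<forall>l\<in>chart_dom (dual S) a \<inter> chart_dom (dual S) b \<inter> chart_dom ?T () \<inter> chart_dom ?T ().
      \<A> b () l ** transition (dual S) b a l = transition ?T () () l ** \<A> a () l"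
      using homA unfolding bundle_hom_def by blast
    then show ?thesis using that by (simp add: A_def dual_def trivial_bundle_def)
  qed
  have M_reg: "regular_on {l. coords l $ c \<noteq> 0} (\<lambda>l. M c l $ p $ q)" for c p q
    using homB by (simp add: bundle_hom_def M_def trivial_bundle_def twisted_bundle_def)
  have M_trans: "coords l $ c * M c l $ p $ q = coords l $ c' * M c' l $ p $ q"
    if "coords l $ c \<noteq> 0" "coords l $ c' \<noteq> 0" for l c c' p q
  proof -
    have "\<forall>l\<in>chart_dom ?T () \<inter> chart_dom ?T () \<inter> chart_dom ?G c \<inter> chart_dom ?G c'.
      \<B> () c' l ** transition ?T () () l = transition ?G c' c l ** \<B> () c l"
      using homB unfolding bundle_hom_def by blast
    then have "M c' l = mat (coords l $ c / coords l $ c') ** M c l"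
      using that by (simp add: M_def trivial_bundle_def twisted_bundle_def)
    then have "M c' l $ p $ q = (mat (coords l $ c / coords l $ c') ** M c l) $ p $ q" by simp
    also have "\<dots> = coords l $ c / coords l $ c' * M c l $ p $ q"
      by (simp add: matrix_matrix_mult_def mat_def if_distrib if_distribR cong: if_cong)
    finally show ?thesis using that by simp
  qed
  have ex_C: "\<exists>C. \<forall>x c. x \<noteq> 0 \<longrightarrow> x $ c \<noteq> 0 \<longrightarrow> x $ c * M c (pt x) $ p $ q = pairing C x" for p q
  proof -
    have ex_c: "\<exists>c. x $ c \<noteq> 0" if "x \<noteq> 0" for x :: "complex ^ 'v"
      using that by (auto simp: vec_eq_iff)
    \<comment> \<open>The chart is picked arbitrarily among those containing the point;
      \<open>M_trans\<close> makes the value independent of it.\<close>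
    define f where "f x = x $ (SOME c. x $ c \<noteq> 0) * M (SOME c. x $ c \<noteq> 0) (pt x) $ p $ q"
      for x :: "complex ^ 'v"
    have f_eq: "f x = x $ c * M c (pt x) $ p $ q" if x: "x \<noteq> 0" "x $ c \<noteq> 0" for x c
    proof -
      define c' where "c' = (SOME c. x $ c \<noteq> 0)"
      have c': "x $ c' \<noteq> 0" unfolding c'_def by (rule someI) (rule x(2))
      obtain e where e: "e \<noteq> 0" "coords (pt x) = e *s x" using coords_pt[OF x(1)] .
      have "e * (x $ c * M c (pt x) $ p $ q) = e * (x $ c' * M c' (pt x) $ p $ q)"
        using M_trans[of "pt x" c c' p q] e c' x by (simp add: mult.assoc)
      then show ?thesis using e(1) by (simp add: f_def c'_def)
    qed
    have "homog_regular 1 UNIV f"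
    proof (rule homog_regular_local)
      fix x :: "complex ^ 'v" assume "x \<in> punctured_cone UNIV"
      then obtain c where c: "x \<noteq> 0" "x $ c \<noteq> 0" using ex_c by auto
      define N where "N = {l. coords l $ c \<noteq> 0}"
      have cone: "y \<noteq> 0 \<and> y $ c \<noteq> 0" if "y \<in> punctured_cone N" for y
        using that pairing_coords_pt_eq_0_iff[of y "axis c 1"] by (auto simp: N_def punctured_cone_def)
      have "homog_regular (1 + 0) N (\<lambda>x. pairing (axis c 1) x * M c (pt x) $ p $ q)"
        using M_reg[of c p q] unfolding regular_on_def N_def
        by (intro homog_regular_mult homog_regular_pairing)
      then have "homog_regular 1 N (\<lambda>x. pairing (axis c 1) x * M c (pt x) $ p $ q)" by simp
      then have "homog_regular 1 N f"
        by (rule homog_regular_cong) (use f_eq cone in auto)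
      moreover have "zariski_open N"
        using zariski_open_pairing[of "axis c 1"] by (simp add: N_def)
      moreover have "pt x \<in> N"
        using c pairing_coords_pt_eq_0_iff[of x "axis c 1"] by (auto simp: N_def)
      ultimately show "\<exists>N. zariski_open N \<and> pt x \<in> N \<and> homog_regular 1 (N \<inter> UNIV) f"
        by auto
    qed
    then obtain C where "\<And>x. x \<noteq> 0 \<Longrightarrow> f x = pairing C x" using homog_regular_1_linear by blast
    then show ?thesis by (intro exI[of _ C] allI impI) (simp flip: f_eq)
  qed
  define C where "C p q = (SOME a. \<forall>x c. x \<noteq> 0 \<longrightarrow> x $ c \<noteq> 0 \<longrightarrow>
      x $ c * M c (pt x) $ p $ q = pairing a x)" for p q
  have C: "x $ c * M c (pt x) $ p $ q = pairing (C p q) x" if "x \<noteq> 0" "x $ c \<noteq> 0" for p q x c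
    using someI_ex[OF ex_C[of p q]] that unfolding C_def by blast
  define B where "B x w = (\<chi> p. \<Sum>q\<in>UNIV. pairing (C p q) x * w $ q)" for x w
  have B_eq: "B x w = x $ c *s (M c (pt x) *v w)" if "x \<noteq> 0" "x $ c \<noteq> 0" for x w c
    by (simp add: B_def vec_eq_iff matrix_vector_mult_def sum_distrib_left C[OF that, symmetric] mult.assoc)
  have "\<exists>a. l \<in> chart_dom S a" for l using S by (auto simp: vector_bundle_def)
  moreover have "\<exists>c. coords l $ c \<noteq> 0" for l :: "'v proj"
    using coords_nonzero[of l] by (auto simp: vec_eq_iff)
  ultimately have charts: "\<exists>a c. l \<in> chart_dom S a \<and> coords l $ c \<noteq> 0" for l by blast
  have "steiner_resolution B S A"
  proof unfold_locales
    show "B (x + y) w = B x w + B y w" "B (c *s x) w = c *s B x w"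
      "B x (w + w') = B x w + B x w'" "B x (c *s w) = c *s B x w" for x y w w' c
      by (simp_all add: B_def vec_eq_iff pairing_add_right pairing_scale_right algebra_simps
          sum.distrib sum_distrib_left)
    show "surj (B x)" if "x \<noteq> 0" for x
    proof -
      obtain a c where ac: "pt x \<in> chart_dom S a" "coords (pt x) $ c \<noteq> 0" using charts by blast
      then have xc: "x $ c \<noteq> 0"
        using pairing_coords_pt_eq_0_iff[OF that, of "axis c 1"] by simp
      have "y \<in> range (B x)" for y
      proof -
        obtain w where "inverse (x $ c) *s y = M c (pt x) *v w" using exact(3)[OF ac] by blast
        then have "B x w = x $ c *s (inverse (x $ c) *s y)" using B_eq[OF that xc] by simp
        then have "B x w = y" using xc by (simp add: vector_smult_assoc)
        then show ?thesis by blast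
      qed
      then show ?thesis by blast
    qed
    show "range ((*v) (A a l)) = {w. B (coords l) w = 0}" if "l \<in> chart_dom S a" for a l
    proof -
      obtain c where c: "coords l $ c \<noteq> 0" using charts by blast
      then show ?thesis using exact(2)[OF that c] B_eq[of "coords l" c] by simp
    qed
    show "inj ((*v) (A a l))" if "l \<in> chart_dom S a" for a l
      using charts exact(1)[OF that] by blast
    show "CARD('r) < CARD('v)"
    proof -
      obtain a c where "undefined \<in> chart_dom S a" "coords (undefined :: 'v proj) $ c \<noteq> 0"
        using charts by blast
      from exact[OF this] have "CARD('r) + CARD('i) \<le> CARD('w)"
        by (intro exact_dim_le[of "A a undefined" "M c undefined"]) auto
      then show ?thesis using dims by simp
    qed
  qed (use S A_reg A_trans dims in auto)
  then show thesis using that by blast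
qed

context steiner_resolution
begin

text \<open>The inclusion \<open>A\<close> turns the section into W-valued regular functions on the
  hyperplane, hence into a constant vector \<open>w\<close>. It lies in every fibre over the
  hyperplane, so \<open>B x w\<close>, linear in \<open>x\<close>, vanishes with
  \<open>coords h\<close> and factors through this form.\<close>

lemma unstable_hyperplane_tensor:
  assumes "unstable_hyperplane S h"
  obtains w \<iota> where "w \<noteq> 0" "\<And>x. B x w = pairing (coords h) x *s \<iota>"
proof -
  obtain s where s: "s \<in> sections (dual S) (hyperplane h)" "s \<noteq> (\<lambda>_ _. 0)"
    using assms unfolding unstable_hyperplane_def by blast
  have reg: "regular_on (chart_dom S a \<inter> hyperplane h) (\<lambda>l. s a l $ i)" for a i
    using sections_regular[OF s(1)] by simp
  have trans: "s b l = transpose (transition S a b l) *v s a l"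
    if "l \<in> chart_dom S a" "l \<in> chart_dom S b" "l \<in> hyperplane h" for a b l
    using sections_transition[OF s(1), of l b a] that by simp
  have supp: "s a l = 0" if "l \<notin> chart_dom S a \<inter> hyperplane h" for a l
    using sections_outside[OF s(1), of l a] that by simp
  have cover: "\<exists>a. l \<in> chart_dom S a" for l using S by (auto simp: vector_bundle_def)
  have opn: "zariski_open (chart_dom S a)" for a using S by (simp add: vector_bundle_def)
  define F where "F l = A (SOME a. l \<in> chart_dom S a) l *v s (SOME a. l \<in> chart_dom S a) l" for l
  have F: "F l = A a l *v s a l" if "l \<in> chart_dom S a" "l \<in> hyperplane h" for a l
  proof -
    define b where "b = (SOME a. l \<in> chart_dom S a)"
    have b: "l \<in> chart_dom S b" unfolding b_def by (rule someI) (rule that)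
    have "A a l *v s a l = (A a l ** transpose (transition S b a l)) *v s b l"
      using trans[OF b that] by (simp only: matrix_vector_mul_assoc)
    then show ?thesis using A_transition[OF b that(1)] by (simp add: F_def b_def)
  qed
  have "regular_on (hyperplane h) (\<lambda>l. F l $ j)" for j
  proof (rule regular_on_local)
    fix l assume "l \<in> hyperplane h"
    obtain a where a: "l \<in> chart_dom S a" using cover by blast
    have "regular_on (chart_dom S a \<inter> hyperplane h) (\<lambda>l. (A a l *v s a l) $ j)"
      by (intro regular_on_mult_vec regular_on_subset[OF A_regular] reg) auto
    then have "regular_on (chart_dom S a \<inter> hyperplane h) (\<lambda>l. F l $ j)"
      by (rule regular_on_cong) (simp add: F[of _ a])
    then show "\<exists>N. zariski_open N \<and> l \<in> N \<and> regular_on (N \<inter> hyperplane h) (\<lambda>l. F l $ j)"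
      using a opn by blast
  qed
  then have "\<exists>c. \<forall>l\<in>hyperplane h. F l $ j = c" for j
    by (rule regular_on_hyperplane_const) blast
  then obtain c where c: "\<And>j l. l \<in> hyperplane h \<Longrightarrow> F l $ j = c j" by metis
  define w where "w = (\<chi> j. c j)"
  have w: "F l = w" if "l \<in> hyperplane h" for l using c[OF that] by (simp add: w_def vec_eq_iff)
  obtain a l where al: "s a l \<noteq> 0" using s(2) by blast
  then have mem: "l \<in> chart_dom S a" "l \<in> hyperplane h" using supp by auto
  have "w \<noteq> 0"
    using w[OF mem(2)] F[OF mem] al injD[OF A_inj[OF mem(1)], of "s a l" 0] by auto
  have zero: "B x w = 0" if "pairing (coords h) x = 0" for x
  proof (cases "x = 0")
    case False
    obtain e where e: "e \<noteq> 0" "coords (pt x) = e *s x" using coords_pt[OF False] .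
    have "pt x \<in> hyperplane h" using that False by (simp add: mem_hyperplane_pt)
    moreover obtain a where a: "pt x \<in> chart_dom S a" using cover by blast
    ultimately have "w \<in> range ((*v) (A a (pt x)))" using w[of "pt x"] F[of "pt x" a] by auto
    then show ?thesis using A_range[OF a] e scale_left[of e x w] by simp
  qed simp
  obtain i where i: "coords h $ i \<noteq> 0" using coords_nonzero[of h] by (auto simp: vec_eq_iff)
  \<comment> \<open>A vector on which the form \<open>coords h\<close> is 1: subtracting a multiple
    of \<open>z\<close> moves any \<open>x\<close> into the hyperplane, so \<open>B z w\<close> is
    the required factor \<open>\<iota>\<close>.\<close>
  define z where "z = inverse (coords h $ i) *s axis i 1"
  have z: "pairing (coords h) z = 1" using i by (simp add: z_def pairing_scale_right)
  have "B x w = pairing (coords h) x *s B z w" for x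
  proof -
    have "B (x + (- pairing (coords h) x) *s z) w = 0"
      by (rule zero) (simp only: pairing_add_right pairing_scale_right z, simp)
    then have "B x w - pairing (coords h) x *s B z w = 0"
      unfolding add_left scale_left by simp
    then show ?thesis by simp
  qed
  with \<open>w \<noteq> 0\<close> that show thesis by blast
qed

end


subsection \<open>Logarithmic forms\<close>

lemma local_equation_pt:
  assumes "y \<noteq> 0"
  shows "local_equation \<mu> h (pt y) = pairing (coords h) y / pairing \<mu> y"
proof -
  obtain c where "c \<noteq> 0" "coords (pt y) = c *s y" using coords_pt[OF assms] .
  then show ?thesis by (simp add: local_equation_def pairing_scale_right)
qed

text \<open>This is d log (h / \<mu>) = dh / h - d\<mu> / \<mu>, obtained from the partial
  derivatives of a quotient of two affine functions of \<open>t\<close>.\<close>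

lemma dlog_local_equation:
  fixes h :: "'v::finite proj"
  assumes x: "x \<noteq> 0" and h: "pairing (coords h) x \<noteq> 0" and \<mu>: "pairing \<mu> x \<noteq> 0"
  shows "dlog (local_equation \<mu> h) x =
    (1 / pairing (coords h) x) *s coords h - (1 / pairing \<mu> x) *s \<mu>"
proof -
  let ?H = "pairing (coords h)" and ?M = "pairing \<mu>"
  have "differential (local_equation \<mu> h) x $ i = (coords h $ i * ?M x - ?H x * \<mu> $ i) / (?M x)\<^sup>2" for i
  proof -
    let ?f = "\<lambda>t. local_equation \<mu> h (pt (x + t *s axis i 1))"
    let ?g = "\<lambda>t. (?H x + t * coords h $ i) / (?M x + t * \<mu> $ i)"
    have "\<forall>\<^sub>F y in nhds x. y \<noteq> 0" using x t1_space_nhds by blast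
    then have "\<forall>\<^sub>F t in nhds 0. x + t *s axis i 1 \<noteq> 0"
      using eventually_line[where x = x and ?t0.0 = 0 and z = "axis i 1" and P = "\<lambda>y. y \<noteq> 0"] by simp
    then have ev: "\<forall>\<^sub>F t in nhds 0. ?f t = ?g t"
      by eventually_elim (simp add: local_equation_pt pairing_add_right pairing_scale_right)
    have "(?g has_field_derivative (coords h $ i * ?M x - ?H x * \<mu> $ i) / (?M x)\<^sup>2) (at 0)"
      using \<mu> by (auto intro!: derivative_eq_intros simp: power2_eq_square)
    then have "(?f has_field_derivative (coords h $ i * ?M x - ?H x * \<mu> $ i) / (?M x)\<^sup>2) (at 0)"
      using DERIV_cong_ev[OF refl ev refl] by blast
    then show ?thesis by (simp add: differential_def DERIV_imp_deriv)
  qed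
  then show ?thesis
    using x h \<mu> by (simp add: dlog_def local_equation_pt vec_eq_iff field_simps power2_eq_square)
qed

text \<open>A vector space over an infinite field is not a finite union of hyperplanes. The lemma
  supplies directions of lines that are contained in none of the hyperplanes.\<close>

lemma finite_forms_nonzero:
  fixes F :: "(complex ^ 'n::finite) set"
  assumes "finite F" "0 \<notin> F"
  obtains z where "\<And>a. a \<in> F \<Longrightarrow> pairing a z \<noteq> 0"
proof -
  have "\<exists>z. \<forall>a\<in>F. pairing a z \<noteq> 0"
    using assms
  proof (induction F rule: finite_induct)
    case (insert b F)
    then obtain z where z: "\<forall>a\<in>F. pairing a z \<noteq> 0" by auto
    have "b \<noteq> 0" using insert.prems by auto
    then obtain y where y: "pairing b y \<noteq> 0" using pairing_eq_0I by blast
    show ?case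
    proof (cases "pairing b z = 0")
      case True
      have "finite ((\<lambda>a. - pairing a z / pairing a y) ` F \<union> {0})" using insert.hyps by simp
      then obtain t where t: "t \<notin> (\<lambda>a. - pairing a z / pairing a y) ` F \<union> {0}"
        using ex_new_if_finite[OF infinite_UNIV_char_0] by blast
      have "pairing a (z + t *s y) \<noteq> 0" if "a \<in> insert b F" for a
      proof
        assume eq: "pairing a (z + t *s y) = 0"
        then have "pairing a z + t * pairing a y = 0"
          by (simp add: pairing_add_right pairing_scale_right)
        moreover have "a \<in> F" using that True t y calculation by auto
        moreover have "pairing a y \<noteq> 0" using calculation z by auto
        ultimately have "t = - pairing a z / pairing a y" by (simp add: field_simps add_eq_0_iff2)
        with t \<open>a \<in> F\<close> show False by blast
      qed
      then show ?thesis by blast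
    qed (use z in blast)
  qed simp
  then show thesis using that by blast
qed

lemma eventually_off_hyperplanes:
  fixes x z :: "complex ^ 'v::finite"
  assumes "finite \<H>" "\<And>h. h \<in> \<H> \<Longrightarrow> pairing (coords h) z \<noteq> 0"
  shows "\<forall>\<^sub>F t in at 0. \<forall>h\<in>\<H>. pairing (coords h) (x + t *s z) \<noteq> 0"
proof (rule eventually_ball_finite[OF assms(1)], rule ballI)
  fix h assume h: "h \<in> \<H>"
  have "\<forall>\<^sub>F t in at 0. t \<noteq> - pairing (coords h) x / pairing (coords h) z"
    by (rule eventually_neq_at_within)
  then show "\<forall>\<^sub>F t in at 0. pairing (coords h) (x + t *s z) \<noteq> 0"
    by eventually_elim
      (use assms(2)[OF h] in \<open>auto simp: pairing_add_right pairing_scale_right field_simps add_eq_0_iff2\<close>)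
qed

lemma normal_crossing_lin_indep:
  assumes "normal_crossing (\<H> :: 'v::finite proj set)" "M \<subseteq> \<H>" "card M \<le> CARD('v)"
  shows "lin_indep coords M"
proof (rule independent_imp_lin_indep)
  show "finite M" using assms finite_subset by (auto simp: normal_crossing_def)
  show "inj_on coords M" using inj_coords inj_on_subset by blast
  show "vec.independent (coords ` M)" using assms by (auto simp: normal_crossing_def)
qed

text \<open>\<open>CARD('v)\<close> independent equations span all linear forms, so they have no
  common nonzero solution.\<close>

lemma normal_crossing_through_point:
  assumes nc: "normal_crossing (\<H> :: 'v::finite proj set)" and x: "x \<noteq> 0"
  shows "card {h \<in> \<H>. pairing (coords h) x = 0} < CARD('v)"
proof (rule ccontr)
  assume "\<not> ?thesis"
  then obtain K where K: "K \<subseteq> {h \<in> \<H>. pairing (coords h) x = 0}" "card K = CARD('v)"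
    using obtain_subset_with_card_n[of "CARD('v)" "{h \<in> \<H>. pairing (coords h) x = 0}"]
    by (auto simp: not_less)
  have "finite K" using K(2) by (auto intro: card_ge_0_finite)
  have ind: "lin_indep coords K" using normal_crossing_lin_indep[OF nc, of K] K by auto
  have "pairing x y = 0" for y
  proof -
    obtain c where "y = (\<Sum>h\<in>K. c h *s coords h)"
      using lin_indep_span[OF ind \<open>finite K\<close> K(2)] .
    then have "pairing y x = (\<Sum>h\<in>K. c h * pairing (coords h) x)"
      by (simp add: pairing_sum_left pairing_scale_left)
    then show ?thesis using K(1) by (auto simp: pairing_commute[of x] intro!: sum.neutral)
  qed
  then show False using x pairing_eq_0I by blast
qed

text \<open>The inner condition of \<open>log_forms\<close> with its witnesses as parameters, so
  that the same \<open>u\<close> can be followed from a decomposition to the residues.\<close>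

definition log_decomposition ::
  "('v::finite) proj set \<Rightarrow> 'v proj set \<Rightarrow> (complex ^ 'v \<Rightarrow> complex ^ 'v) \<Rightarrow> 'v proj \<Rightarrow>
    'v proj set \<Rightarrow> complex ^ 'v \<Rightarrow> ('v proj \<Rightarrow> 'v proj \<Rightarrow> complex) \<Rightarrow>
    (complex ^ 'v \<Rightarrow> complex ^ 'v) \<Rightarrow> bool" where
  "log_decomposition \<H> U \<omega> l N \<mu> u \<theta> \<longleftrightarrow> zariski_open N \<and> l \<in> N \<and> N \<subseteq> U \<and>
    (\<forall>m\<in>N. pairing \<mu> (coords m) \<noteq> 0) \<and>
    (\<forall>h\<in>\<H>. regular_on N (u h)) \<and> \<theta> \<in> one_forms N \<and>
    (\<forall>x\<in>punctured_cone (N - (\<Union>h\<in>\<H>. hyperplane h)).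
      \<omega> x = \<theta> x + (\<Sum>h\<in>{h\<in>\<H>. l \<in> hyperplane h}. u h (pt x) *s dlog (local_equation \<mu> h) x))"

lemma log_forms_iff:
  "\<omega> \<in> log_forms \<H> U \<longleftrightarrow> \<omega> \<in> one_forms (U - (\<Union>h\<in>\<H>. hyperplane h)) \<and>
    (\<forall>l\<in>U. \<exists>N \<mu> u \<theta>. log_decomposition \<H> U \<omega> l N \<mu> u \<theta>)"
  unfolding log_forms_def log_decomposition_def mem_Collect_eq by (rule refl)

lemma punctured_cone_Diff_hyperplanes:
  "x \<in> punctured_cone (U - (\<Union>h\<in>\<H>. hyperplane h)) \<longleftrightarrow>
    x \<in> punctured_cone U \<and> (\<forall>h\<in>\<H>. pairing (coords h) x \<noteq> 0)"
  using mem_hyperplane_pt[of x] unfolding punctured_cone_iff by blast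

lemma one_formsI:
  assumes "\<And>i. homog_regular (- 1) U (\<lambda>x. \<omega> x $ i)"
    and "\<And>x. x \<in> punctured_cone U \<Longrightarrow> pairing (\<omega> x) x = 0"
    and "\<And>x. x \<notin> punctured_cone U \<Longrightarrow> \<omega> x = 0"
  shows "\<omega> \<in> one_forms U"
  using assms unfolding one_forms_def by blast

lemma one_formsD:
  assumes "\<omega> \<in> one_forms U"
  shows "homog_regular (- 1) U (\<lambda>x. \<omega> x $ i)"
    and "x \<in> punctured_cone U \<Longrightarrow> pairing (\<omega> x) x = 0"
    and "x \<notin> punctured_cone U \<Longrightarrow> \<omega> x = 0"
  using assms unfolding one_forms_def by blast+

text \<open>The form \<Sum> c h dh / h. The value 0 on the hyperplanes and off the cone over
  \<open>U\<close> is the one that \<open>one_forms\<close> prescribes.\<close>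

definition log_form ::
  "('v::finite) proj set \<Rightarrow> 'v proj set \<Rightarrow> ('v proj \<Rightarrow> 'v proj \<Rightarrow> complex) \<Rightarrow>
    complex ^ 'v \<Rightarrow> complex ^ 'v" where
  "log_form \<H> U c x = (if x \<in> punctured_cone (U - (\<Union>h\<in>\<H>. hyperplane h))
    then \<Sum>h\<in>\<H>. (c h (pt x) / pairing (coords h) x) *s coords h else 0)"

text \<open>As the coefficients sum to 0, subtracting (\<Sum> c h) d\<mu> / \<mu> changes nothing
  and turns each dh / h into \<open>dlog (local_equation \<mu> h)\<close>. On \<open>N\<close>,
  which avoids the hyperplanes not through \<open>l\<close>, the terms of those hyperplanes are
  regular and form \<open>\<theta>\<close>. The coefficients \<open>c\<close> are kept, so they can
  be read off as residues.\<close>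

lemma log_form_decomposition:
  assumes U: "zariski_open U" and fin: "finite \<H>"
    and reg: "\<And>h. h \<in> \<H> \<Longrightarrow> regular_on U (c h)"
    and sum0: "\<And>m. m \<in> U \<Longrightarrow> (\<Sum>h\<in>\<H>. c h m) = 0"
    and l: "l \<in> U"
  shows "\<exists>N \<mu> \<theta>. log_decomposition \<H> U (log_form \<H> U c) l N \<mu> c \<theta>"
proof -
  obtain i where i: "coords l $ i \<noteq> 0" using coords_nonzero[of l] by (auto simp: vec_eq_iff)
  define \<mu> :: "complex ^ 'a" where "\<mu> = axis i 1"
  define J where "J = {h \<in> \<H>. l \<in> hyperplane h}"
  define N where "N = (U \<inter> {m. pairing \<mu> (coords m) \<noteq> 0}) - (\<Union>h\<in>\<H> - J. hyperplane h)"
  define \<theta> where "\<theta> x = (if x \<in> punctured_cone N then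
    \<Sum>h\<in>\<H> - J. c h (pt x) *s ((1 / pairing (coords h) x) *s coords h - (1 / pairing \<mu> x) *s \<mu>) else 0)" for x
  have cone: "x \<in> punctured_cone U \<and> pairing \<mu> x \<noteq> 0 \<and> (\<forall>h\<in>\<H> - J. pairing (coords h) x \<noteq> 0)"
    if "x \<in> punctured_cone N" for x
    using that pairing_coords_pt_eq_0_iff[of x \<mu>] unfolding N_def punctured_cone_Diff_hyperplanes
    by (auto simp: punctured_cone_iff)
  have "N \<subseteq> U" by (auto simp: N_def)
  have openN: "zariski_open N"
    unfolding N_def by (intro zariski_open_Diff_hyperplanes zariski_open_Int U zariski_open_pairing) (use fin in simp)
  have lN: "l \<in> N" using l i by (auto simp: N_def J_def \<mu>_def)
  have \<theta>: "\<theta> \<in> one_forms N"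
  proof (rule one_formsI)
    fix k
    have "homog_regular (0 + (0 - 1)) N (\<lambda>x. \<Sum>h\<in>\<H> - J.
      c h (pt x) * (coords h $ k / pairing (coords h) x - \<mu> $ k / pairing \<mu> x))"
      using reg cone regular_on_subset[OF _ \<open>N \<subseteq> U\<close>] unfolding regular_on_def
      by (intro homog_regular_sum homog_regular_mult homog_regular_diff homog_regular_divide
          homog_regular_const homog_regular_pairing) auto
    then show "homog_regular (- 1) N (\<lambda>x. \<theta> x $ k)"
      by (rule homog_regular_cong_degree) (simp_all add: \<theta>_def right_diff_distrib)
  next
    fix x assume "x \<in> punctured_cone N"
    then show "pairing (\<theta> x) x = 0"
      using cone by (simp add: \<theta>_def pairing_sum_left pairing_scale_left pairing_diff_left)
  qed (simp add: \<theta>_def)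
  have "log_form \<H> U c x = \<theta> x + (\<Sum>h\<in>J. c h (pt x) *s dlog (local_equation \<mu> h) x)"
    if x: "x \<in> punctured_cone (N - (\<Union>h\<in>\<H>. hyperplane h))" for x
  proof -
    have xN: "x \<in> punctured_cone N" and off: "\<And>h. h \<in> \<H> \<Longrightarrow> pairing (coords h) x \<noteq> 0"
      using x unfolding punctured_cone_Diff_hyperplanes by auto
    note c = cone[OF xN]
    have x0: "x \<noteq> 0" "pt x \<in> U" using c by (auto simp: punctured_cone_iff)
    let ?g = "\<lambda>h. c h (pt x) *s ((1 / pairing (coords h) x) *s coords h - (1 / pairing \<mu> x) *s \<mu>)"
    have "(\<Sum>h\<in>J. c h (pt x) *s dlog (local_equation \<mu> h) x) = (\<Sum>h\<in>J. ?g h)"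
      by (intro sum.cong refl arg_cong2[of _ _ _ _ "(*s)"] dlog_local_equation x0)
        (use off c in \<open>auto simp: J_def\<close>)
    then have "\<theta> x + (\<Sum>h\<in>J. c h (pt x) *s dlog (local_equation \<mu> h) x) = (\<Sum>h\<in>\<H>. ?g h)"
      using xN fin sum.subset_diff[of J \<H> ?g] by (simp add: \<theta>_def J_def)
    also have "\<dots> = (\<Sum>h\<in>\<H>. (c h (pt x) / pairing (coords h) x) *s coords h)
      - ((\<Sum>h\<in>\<H>. c h (pt x)) / pairing \<mu> x) *s \<mu>"
      by (simp add: vec_eq_iff right_diff_distrib sum_subtractf sum_distrib_right sum_divide_distrib)
    also have "\<dots> = log_form \<H> U c x"
      using sum0[OF x0(2)] c off unfolding log_form_def
      by (simp add: punctured_cone_Diff_hyperplanes)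
    finally show ?thesis by simp
  qed
  moreover have "pairing \<mu> (coords m) \<noteq> 0" if "m \<in> N" for m using that by (simp add: N_def)
  ultimately have "log_decomposition \<H> U (log_form \<H> U c) l N \<mu> c \<theta>"
    unfolding log_decomposition_def J_def[symmetric]
    using openN lN \<open>N \<subseteq> U\<close> \<theta> reg regular_on_subset by blast
  then show ?thesis by blast
qed

lemma log_form_in_log_forms:
  assumes U: "zariski_open U" and fin: "finite \<H>"
    and reg: "\<And>h. h \<in> \<H> \<Longrightarrow> regular_on U (c h)"
    and sum0: "\<And>m. m \<in> U \<Longrightarrow> (\<Sum>h\<in>\<H>. c h m) = 0"
  shows "log_form \<H> U c \<in> log_forms \<H> U"
  unfolding log_forms_iff
proof (intro conjI ballI)
  let ?V = "U - (\<Union>h\<in>\<H>. hyperplane h)"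
  show "log_form \<H> U c \<in> one_forms ?V"
  proof (rule one_formsI)
    fix k
    have "homog_regular (0 - 1 + 0) ?V (\<lambda>x. \<Sum>h\<in>\<H>. c h (pt x) / pairing (coords h) x * coords h $ k)"
      using reg regular_on_subset[of U _ ?V] unfolding regular_on_def
      by (intro homog_regular_sum homog_regular_mult homog_regular_divide
          homog_regular_const homog_regular_pairing)
        (auto simp: punctured_cone_Diff_hyperplanes simp del: UN_simps)
    then show "homog_regular (- 1) ?V (\<lambda>x. log_form \<H> U c x $ k)"
      by (rule homog_regular_cong_degree) (simp_all add: log_form_def)
  next
    fix x assume x: "x \<in> punctured_cone ?V"
    then have off: "\<And>h. h \<in> \<H> \<Longrightarrow> pairing (coords h) x \<noteq> 0"
      unfolding punctured_cone_Diff_hyperplanes by blast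
    have "pairing (log_form \<H> U c x) x = (\<Sum>h\<in>\<H>. c h (pt x) / pairing (coords h) x * pairing (coords h) x)"
      using x by (simp add: log_form_def pairing_sum_left pairing_scale_left)
    also have "\<dots> = (\<Sum>h\<in>\<H>. c h (pt x))" using off by simp
    also have "\<dots> = 0" using x by (intro sum0) (simp add: punctured_cone_iff)
    finally show "pairing (log_form \<H> U c x) x = 0" .
  qed (simp add: log_form_def)
  show "\<exists>N \<mu> u \<theta>. log_decomposition \<H> U (log_form \<H> U c) l N \<mu> u \<theta>" if "l \<in> U" for l
    using log_form_decomposition[OF U fin reg sum0 that] by blast
qed


subsection \<open>Residues\<close>

text \<open>The residue along \<open>h\<close> at \<open>l\<close> is read off as a limit, along a line through \<open>l\<close> in
  general position, of \<open>h\<close> times the value of the form on a vector \<open>v\<close> that is tangent to the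
  other hyperplanes through \<open>l\<close>.\<close>

definition has_residue ::
  "('v::finite) proj set \<Rightarrow> 'v proj \<Rightarrow> (complex ^ 'v \<Rightarrow> complex ^ 'v) \<Rightarrow> 'v proj \<Rightarrow> complex \<Rightarrow> bool" where
  "has_residue \<H> h \<omega> l r \<longleftrightarrow>
    (\<forall>v z. pairing (coords h) v = 1 \<longrightarrow>
      (\<forall>h'\<in>\<H> - {h}. pairing (coords h') (coords l) = 0 \<longrightarrow> pairing (coords h') v = 0) \<longrightarrow>
      (\<forall>h'\<in>\<H>. pairing (coords h') z \<noteq> 0) \<longrightarrow>
      ((\<lambda>t. pairing (coords h) (coords l + t *s z) * pairing (\<omega> (coords l + t *s z)) v) \<longlongrightarrow> r) (at 0))"

text \<open>\<open>has_residue\<close> quantifies over all admissible \<open>v\<close> and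
  \<open>z\<close>, so an admissible pair must be shown to exist: normal crossing gives
  \<open>v\<close> as a vector dual to \<open>h\<close> among the hyperplanes through
  \<open>l\<close>, and \<open>z\<close> is a direction off all hyperplanes.\<close>

lemma has_residue_unique:
  assumes nc: "normal_crossing \<H>" and h: "h \<in> \<H>" "l \<in> hyperplane h"
    and r: "has_residue \<H> h \<omega> l r" and r': "has_residue \<H> h \<omega> l r'"
  shows "r = r'"
proof -
  have fin: "finite \<H>" using nc by (simp add: normal_crossing_def)
  define J where "J = {h \<in> \<H>. pairing (coords h) (coords l) = 0}"
  have ind: "lin_indep coords J"
    using normal_crossing_lin_indep[OF nc, of J] normal_crossing_through_point[OF nc, of "coords l"]
    by (simp add: J_def)
  have J: "finite J" "h \<in> J" using h fin by (auto simp: J_def hyperplane_def)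
  obtain v where v: "pairing (coords h) v = 1"
    "\<And>s. s \<in> J \<Longrightarrow> s \<noteq> h \<Longrightarrow> pairing (coords s) v = 0"
    using dual_vector[OF ind J] by blast
  have "finite (coords ` \<H>)" "0 \<notin> coords ` \<H>" using fin by (auto dest: sym)
  then obtain z where z: "\<And>a. a \<in> coords ` \<H> \<Longrightarrow> pairing a z \<noteq> 0"
    using finite_forms_nonzero by blast
  have vz: "pairing (coords h) v = 1"
    "\<forall>h'\<in>\<H> - {h}. pairing (coords h') (coords l) = 0 \<longrightarrow> pairing (coords h') v = 0"
    "\<forall>h'\<in>\<H>. pairing (coords h') z \<noteq> 0"
    using v z by (auto simp: J_def)
  let ?f = "\<lambda>t. pairing (coords h) (coords l + t *s z) * pairing (\<omega> (coords l + t *s z)) v"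
  have "(?f \<longlongrightarrow> r) (at 0)" "(?f \<longlongrightarrow> r') (at 0)"
    using r r' vz unfolding has_residue_def by blast+
  then show ?thesis using tendsto_unique[of "at (0::complex)"] by auto
qed

lemma has_residue_add:
  assumes "has_residue \<H> h \<omega> l r" "has_residue \<H> h \<omega>' l r'"
  shows "has_residue \<H> h (\<lambda>x. \<omega> x + \<omega>' x) l (r + r')"
  unfolding has_residue_def
proof (intro allI impI)
  fix v z
  assume vz: "pairing (coords h) v = 1"
    "\<forall>h'\<in>\<H> - {h}. pairing (coords h') (coords l) = 0 \<longrightarrow> pairing (coords h') v = 0"
    "\<forall>h'\<in>\<H>. pairing (coords h') z \<noteq> 0"
  have "((\<lambda>t. pairing (coords h) (coords l + t *s z) * pairing (\<omega> (coords l + t *s z)) v +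
      pairing (coords h) (coords l + t *s z) * pairing (\<omega>' (coords l + t *s z)) v) \<longlongrightarrow> r + r') (at 0)"
    using assms vz unfolding has_residue_def by (intro tendsto_add) blast+
  then show "((\<lambda>t. pairing (coords h) (coords l + t *s z) *
      pairing (\<omega> (coords l + t *s z) + \<omega>' (coords l + t *s z)) v) \<longlongrightarrow> r + r') (at 0)"
    by (simp add: pairing_add_left distrib_left)
qed

lemma has_residue_scale:
  assumes "has_residue \<H> h \<omega> l r" "regular_on U f" "zariski_open U" "l \<in> U"
  shows "has_residue \<H> h (\<lambda>x. f (pt x) *s \<omega> x) l (f l * r)"
  unfolding has_residue_def
proof (intro allI impI)
  fix v z
  assume vz: "pairing (coords h) v = 1"
    "\<forall>h'\<in>\<H> - {h}. pairing (coords h') (coords l) = 0 \<longrightarrow> pairing (coords h') v = 0"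
    "\<forall>h'\<in>\<H>. pairing (coords h') z \<noteq> 0"
  have f: "((\<lambda>t. f (pt (coords l + t *s z))) \<longlongrightarrow> f l) (at 0)"
    using homog_regular_tendsto_line[OF assms(2)[unfolded regular_on_def] assms(3), of "coords l" z]
      assms(4) by simp
  have "((\<lambda>t. f (pt (coords l + t *s z)) * (pairing (coords h) (coords l + t *s z) *
      pairing (\<omega> (coords l + t *s z)) v)) \<longlongrightarrow> f l * r) (at 0)"
    using assms(1) vz unfolding has_residue_def by (intro tendsto_mult f) blast
  then show "((\<lambda>t. pairing (coords h) (coords l + t *s z) *
      pairing (f (pt (coords l + t *s z)) *s \<omega> (coords l + t *s z)) v) \<longlongrightarrow> f l * r) (at 0)"
    by (simp add: pairing_scale_left mult.left_commute)
qed

lemma has_residue_zero: "has_residue \<H> h (\<lambda>_. 0) l 0"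
  by (simp add: has_residue_def)

lemma has_residue_sum:
  assumes "\<And>i. i \<in> I \<Longrightarrow> has_residue \<H> h (\<omega> i) l (r i)"
    "\<And>i. i \<in> I \<Longrightarrow> regular_on U (f i)" "zariski_open U" "l \<in> U"
  shows "has_residue \<H> h (\<lambda>x. \<Sum>i\<in>I. f i (pt x) *s \<omega> i x) l (\<Sum>i\<in>I. f i l * r i)"
  using assms(1,2)
proof (induction I rule: infinite_finite_induct)
  case (insert i I)
  have "has_residue \<H> h (\<lambda>x. f i (pt x) *s \<omega> i x) l (f i l * r i)"
    by (rule has_residue_scale[OF _ _ assms(3,4)]) (use insert.prems in auto)
  from has_residue_add[OF this] insert show ?case by simp
qed (simp_all add: has_residue_zero)

text \<open>The limit only sees the form near \<open>l\<close>, and lines through \<open>l\<close>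
  stay in the cone over \<open>U\<close> for small \<open>t\<close>.\<close>

lemma has_residue_restrict:
  assumes "zariski_open U" "l \<in> U"
  shows "has_residue \<H> h (\<lambda>x. if x \<in> punctured_cone U then \<omega> x else 0) l r \<longleftrightarrow> has_residue \<H> h \<omega> l r"
proof -
  have ev: "\<forall>\<^sub>F t in at 0. coords l + t *s z \<in> punctured_cone U" for z
    by (rule eventually_line_in_punctured_cone[OF assms(1)]) (simp add: assms(2))
  have "\<forall>\<^sub>F t in at 0. pairing (coords h) (coords l + t *s z) *
      pairing (if coords l + t *s z \<in> punctured_cone U then \<omega> (coords l + t *s z) else 0) v =
      pairing (coords h) (coords l + t *s z) * pairing (\<omega> (coords l + t *s z)) v" for z v
    using ev[of z] by eventually_elim simp
  note tc = tendsto_cong[OF this]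
  show ?thesis unfolding has_residue_def tc by (rule refl)
qed

text \<open>After multiplication by the equation of \<open>h\<close>, the term of \<open>h\<close>
  tends to \<open>u h m\<close>, because \<open>v\<close> is normalised. Other hyperplanes through
  \<open>m\<close> contribute no pole on \<open>v\<close>, and everything else is bounded and
  multiplied by a factor tending to 0. The point \<open>m\<close> may differ from the centre
  \<open>l\<close>, so the residue is the regular function \<open>u h\<close> on all of
  \<open>N \<inter> hyperplane h\<close>.\<close>

lemma log_decomposition_residue:
  assumes dec: "log_decomposition \<H> U \<omega> l N \<mu> u \<theta>" and fin: "finite \<H>"
    and h: "h \<in> \<H>" "l \<in> hyperplane h" and m: "m \<in> N" "m \<in> hyperplane h"
  shows "has_residue \<H> h \<omega> m (u h m)"
  unfolding has_residue_def
proof (intro allI impI)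
  fix v z
  assume v: "pairing (coords h) v = 1"
    "\<forall>h'\<in>\<H> - {h}. pairing (coords h') (coords m) = 0 \<longrightarrow> pairing (coords h') v = 0"
    and z: "\<forall>h'\<in>\<H>. pairing (coords h') z \<noteq> 0"
  define y where "y t = coords m + t *s z" for t
  let ?H = "pairing (coords h)"
  have N: "zariski_open N" and \<mu>: "\<And>m. m \<in> N \<Longrightarrow> pairing \<mu> (coords m) \<noteq> 0"
    and u: "\<And>h. h \<in> \<H> \<Longrightarrow> regular_on N (u h)" and \<theta>: "\<theta> \<in> one_forms N"
    and \<omega>: "\<And>x. x \<in> punctured_cone (N - (\<Union>h\<in>\<H>. hyperplane h)) \<Longrightarrow>
      \<omega> x = \<theta> x + (\<Sum>h\<in>{h\<in>\<H>. l \<in> hyperplane h}. u h (pt x) *s dlog (local_equation \<mu> h) x)"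
    using dec unfolding log_decomposition_def by blast+
  have mN: "coords m \<in> punctured_cone N" using m by simp
  have evN: "\<forall>\<^sub>F t in at 0. y t \<in> punctured_cone N"
    unfolding y_def by (rule eventually_line_in_punctured_cone[OF N mN])
  have evH: "\<forall>\<^sub>F t in at 0. \<forall>h\<in>\<H>. pairing (coords h) (coords m + t *s z) \<noteq> 0"
    by (rule eventually_off_hyperplanes[OF fin]) (use z in blast)
  define G where "G h' t = u h' (pt (y t)) * (?H (y t) *
    (pairing (coords h') v / pairing (coords h') (y t) - pairing \<mu> v / pairing \<mu> (y t)))" for h' t
  have ev: "\<forall>\<^sub>F t in at 0. ?H (y t) * pairing (\<theta> (y t)) v +
      (\<Sum>h'\<in>{h\<in>\<H>. l \<in> hyperplane h}. G h' t) = ?H (y t) * pairing (\<omega> (y t)) v"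
    using evN evH
  proof eventually_elim
    case (elim t)
    then have yt: "y t \<noteq> 0" "pt (y t) \<in> N" by (auto simp: punctured_cone_iff)
    then have \<mu>y: "pairing \<mu> (y t) \<noteq> 0" using \<mu> pairing_coords_pt_eq_0_iff by blast
    have off: "pairing (coords h') (y t) \<noteq> 0" if "h' \<in> \<H>" for h' using elim(2) that by (simp add: y_def)
    have "\<omega> (y t) = \<theta> (y t) + (\<Sum>h\<in>{h\<in>\<H>. l \<in> hyperplane h}. u h (pt (y t)) *s dlog (local_equation \<mu> h) (y t))"
      by (rule \<omega>) (use elim(1) off in \<open>simp add: punctured_cone_Diff_hyperplanes\<close>)
    also have "(\<Sum>h\<in>{h\<in>\<H>. l \<in> hyperplane h}. u h (pt (y t)) *s dlog (local_equation \<mu> h) (y t)) =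
      (\<Sum>h\<in>{h\<in>\<H>. l \<in> hyperplane h}. u h (pt (y t)) *s
        ((1 / pairing (coords h) (y t)) *s coords h - (1 / pairing \<mu> (y t)) *s \<mu>))"
      by (intro sum.cong refl arg_cong2[of _ _ _ _ "(*s)"] dlog_local_equation yt \<mu>y off) auto
    finally have "pairing (\<omega> (y t)) v = pairing (\<theta> (y t)) v + (\<Sum>h\<in>{h\<in>\<H>. l \<in> hyperplane h}. u h (pt (y t)) *
        (pairing (coords h) v / pairing (coords h) (y t) - pairing \<mu> v / pairing \<mu> (y t)))"
      by (simp add: pairing_add_left pairing_sum_left pairing_scale_left pairing_diff_left right_diff_distrib)
    then show ?case
      by (simp add: G_def distrib_left sum_distrib_left mult.left_commute)
  qed
  have yl: "(y \<longlongrightarrow> coords m) (at 0)" using tendsto_line[of "coords m" z 0] by (simp add: y_def[abs_def])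
  have pl: "((\<lambda>t. pairing a (y t)) \<longlongrightarrow> pairing a (coords m)) (at 0)" for a
    unfolding pairing_def by (intro tendsto_intros yl)
  have Hl: "((\<lambda>t. ?H (y t)) \<longlongrightarrow> 0) (at 0)"
    using pl[of "coords h"] m(2) by (simp add: hyperplane_def)
  have \<theta>l: "((\<lambda>t. pairing (\<theta> (y t)) v) \<longlongrightarrow> pairing (\<theta> (coords m)) v) (at 0)"
    unfolding pairing_def y_def
    by (intro tendsto_intros homog_regular_tendsto_line[OF one_formsD(1)[OF \<theta>] N mN])
  have ul: "((\<lambda>t. u h' (pt (y t))) \<longlongrightarrow> u h' m) (at 0)" if "h' \<in> \<H>" for h'
    using homog_regular_tendsto_line[OF u[OF that, unfolded regular_on_def] N mN, of z] by (simp add: y_def)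
  have \<mu>l: "((\<lambda>t. ?H (y t) * (pairing \<mu> v / pairing \<mu> (y t))) \<longlongrightarrow> 0) (at 0)"
    by (rule tendsto_eq_rhs[OF tendsto_mult[OF Hl tendsto_divide[OF tendsto_const pl]]])
      (use \<mu>[OF m(1)] in auto)
  have Gl: "(G h' \<longlongrightarrow> (if h' = h then u h m else 0)) (at 0)" if "h' \<in> \<H>" for h'
  proof -
    have "((\<lambda>t. ?H (y t) * (pairing (coords h') v / pairing (coords h') (y t))) \<longlongrightarrow>
      (if h' = h then 1 else 0)) (at 0)"
    proof (cases "h' = h")
      case True
      have "\<forall>\<^sub>F t in at 0. 1 = ?H (y t) * (pairing (coords h') v / pairing (coords h') (y t))"
        using evH
        by eventually_elim (use True v(1) h(1) in \<open>simp add: y_def\<close>)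
      then show ?thesis using True by (simp add: Lim_transform_eventually[OF tendsto_const])
    next
      case False
      show ?thesis
      proof (cases "pairing (coords h') (coords m) = 0")
        case True
        then show ?thesis using v(2) False that by simp
      next
        case no: False
        show ?thesis
          by (rule tendsto_eq_rhs[OF tendsto_mult[OF Hl tendsto_divide[OF tendsto_const pl]]])
            (use no False in auto)
      qed
    qed
    from tendsto_mult[OF ul[OF that] tendsto_diff[OF this \<mu>l]]
    have "(G h' \<longlongrightarrow> u h' m * ((if h' = h then 1 else 0) - 0)) (at 0)"
      by (simp add: G_def[abs_def] right_diff_distrib)
    then show ?thesis by (rule tendsto_eq_rhs) auto
  qed
  have "((\<lambda>t. ?H (y t) * pairing (\<theta> (y t)) v + (\<Sum>h'\<in>{h\<in>\<H>. l \<in> hyperplane h}. G h' t)) \<longlongrightarrow>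
    0 * pairing (\<theta> (coords m)) v + (\<Sum>h'\<in>{h\<in>\<H>. l \<in> hyperplane h}. if h' = h then u h m else 0)) (at 0)"
    by (intro tendsto_add tendsto_mult tendsto_sum Hl \<theta>l Gl) auto
  also have "0 * pairing (\<theta> (coords m)) v + (\<Sum>h'\<in>{h\<in>\<H>. l \<in> hyperplane h}. if h' = h then u h m else 0) = u h m"
    using h fin by simp
  finally show "((\<lambda>t. ?H (coords m + t *s z) * pairing (\<omega> (coords m + t *s z)) v) \<longlongrightarrow> u h m) (at 0)"
    unfolding y_def[symmetric] by (rule Lim_transform_eventually) (rule ev)
qed

text \<open>Residues exist by \<open>log_decomposition_residue\<close>; uniqueness identifies the
  chosen \<open>\<rho>\<close> with the local coefficient \<open>u\<close>, which makes it
  regular.\<close>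

lemma log_forms_residue:
  assumes nc: "normal_crossing \<H>" and \<omega>: "\<omega> \<in> log_forms \<H> U" and h: "h \<in> \<H>"
  obtains \<rho> where "regular_on (U \<inter> hyperplane h) \<rho>"
    "\<And>l. l \<in> U \<Longrightarrow> l \<in> hyperplane h \<Longrightarrow> has_residue \<H> h \<omega> l (\<rho> l)"
proof -
  have fin: "finite \<H>" using nc by (simp add: normal_crossing_def)
  define \<rho> where "\<rho> l = (SOME r. has_residue \<H> h \<omega> l r)" for l
  have local: "\<exists>N u. zariski_open N \<and> l \<in> N \<and> N \<subseteq> U \<and> regular_on N u \<and>
      (\<forall>m\<in>N \<inter> hyperplane h. has_residue \<H> h \<omega> m (u m))"
    if l: "l \<in> U" "l \<in> hyperplane h" for l
  proof -
    obtain N \<mu> u \<theta> where dec: "log_decomposition \<H> U \<omega> l N \<mu> u \<theta>"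
      using \<omega> l(1) unfolding log_forms_iff by blast
    then have "zariski_open N" "l \<in> N" "N \<subseteq> U" "regular_on N (u h)"
      using h unfolding log_decomposition_def by blast+
    moreover have "\<forall>m\<in>N \<inter> hyperplane h. has_residue \<H> h \<omega> m (u h m)"
      using log_decomposition_residue[OF dec fin h l(2)] by blast
    ultimately show ?thesis by blast
  qed
  have res: "has_residue \<H> h \<omega> l (\<rho> l)" if "l \<in> U" "l \<in> hyperplane h" for l
    unfolding \<rho>_def by (rule someI_ex) (use local[OF that] that in blast)
  moreover have "regular_on (U \<inter> hyperplane h) \<rho>"
  proof (rule regular_on_local)
    fix l assume "l \<in> U \<inter> hyperplane h"
    then obtain N u where N: "zariski_open N" "l \<in> N" "N \<subseteq> U" "regular_on N u"
      "\<forall>m\<in>N \<inter> hyperplane h. has_residue \<H> h \<omega> m (u m)"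
      using local by blast
    have "regular_on (N \<inter> (U \<inter> hyperplane h)) u" by (rule regular_on_subset[OF N(4)]) blast
    then have "regular_on (N \<inter> (U \<inter> hyperplane h)) \<rho>"
      by (rule regular_on_cong) (use N(5) res has_residue_unique[OF nc h] in blast)
    with N show "\<exists>N. zariski_open N \<and> l \<in> N \<and> regular_on (N \<inter> (U \<inter> hyperplane h)) \<rho>" by blast
  qed
  ultimately show thesis using that by blast
qed


subsection \<open>Logarithmic bundles have unstable hyperplanes\<close>

lemma sections_add:
  assumes "s \<in> sections E Z" "t \<in> sections E Z"
  shows "(\<lambda>a x. s a x + t a x) \<in> sections E Z"
proof (rule sectionsI)
  show "regular_on (chart_dom E a \<inter> Z) (\<lambda>x. (s a x + t a x) $ i)" for a i
    using assms by (simp add: regular_on_add sections_regular)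
  show "s a x + t a x = transition E a b x *v (s b x + t b x)"
    if "x \<in> chart_dom E a" "x \<in> chart_dom E b" "x \<in> Z" for a b x
    using sections_transition[OF assms(1) that] sections_transition[OF assms(2) that]
    by (simp only: matrix_vector_right_distrib)
qed (simp add: assms[THEN sections_outside])

lemma sections_scale:
  assumes "s \<in> sections E Z" "regular_on Z f"
  shows "(\<lambda>a x. f x *s s a x) \<in> sections E Z"
proof (rule sectionsI)
  show "regular_on (chart_dom E a \<inter> Z) (\<lambda>x. (f x *s s a x) $ i)" for a i
    using sections_regular[OF assms(1)] regular_on_subset[OF assms(2)] by (simp add: regular_on_mult)
  show "f x *s s a x = transition E a b x *v (f x *s s b x)"
    if "x \<in> chart_dom E a" "x \<in> chart_dom E b" "x \<in> Z" for a b x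
    using sections_transition[OF assms(1) that] by (simp only: vector_scalar_commute)
qed (simp add: assms(1)[THEN sections_outside])

lemma sections_zero: "(\<lambda>_ _. 0) \<in> sections E Z"
  by (rule sectionsI) (simp_all add: regular_on_const)

lemma sections_sum:
  assumes "\<And>j. j \<in> J \<Longrightarrow> s j \<in> sections E Z" "\<And>j. j \<in> J \<Longrightarrow> regular_on Z (f j)"
  shows "(\<lambda>a x. \<Sum>j\<in>J. f j x *s s j a x) \<in> sections E Z"
  using assms
proof (induction J rule: infinite_finite_induct)
  case (insert j J)
  have "(\<lambda>a x. f j x *s s j a x) \<in> sections E Z" using insert.prems by (intro sections_scale) auto
  from sections_add[OF this] insert show ?case by simp
qed (simp_all add: sections_zero)

lemma sections_restrict:
  assumes "s \<in> sections E U" "V \<subseteq> U"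
  shows "(\<lambda>a x. if x \<in> V then s a x else 0) \<in> sections E V"
proof (rule sectionsI)
  fix a i
  have "regular_on (chart_dom E a \<inter> V) (\<lambda>x. s a x $ i)"
    using sections_regular[OF assms(1)] by (rule regular_on_subset) (use assms(2) in blast)
  then show "regular_on (chart_dom E a \<inter> V) (\<lambda>x. (if x \<in> V then s a x else 0) $ i)"
    by (rule regular_on_cong) simp
next
  show "(if x \<in> V then s a x else 0) = transition E a b x *v (if x \<in> V then s b x else 0)"
    if "x \<in> chart_dom E a" "x \<in> chart_dom E b" "x \<in> V" for a b x
    using sections_transition[OF assms(1) that(1,2)] that(3) assms(2) by auto
qed (use sections_outside[OF assms(1)] assms(2) in auto)

context
  fixes S :: "('a, 'v::finite, 'r::finite) vbundle" and \<H> \<phi>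
  assumes iso: "sheaf_iso_log S \<H> \<phi>"
begin

lemmas iso_unfolded = iso[unfolded sheaf_iso_log_def, THEN spec, THEN mp]

lemma iso_bij: "zariski_open U \<Longrightarrow> bij_betw (\<phi> U) (sections S U) (log_forms \<H> U)"
  by (rule iso_unfolded[THEN conjunct1])

lemma iso_add: "zariski_open U \<Longrightarrow> s \<in> sections S U \<Longrightarrow> t \<in> sections S U \<Longrightarrow>
    \<phi> U (\<lambda>a x. s a x + t a x) = (\<lambda>x. \<phi> U s x + \<phi> U t x)"
  by (rule iso_unfolded[THEN conjunct2, THEN conjunct1, THEN bspec, THEN bspec])

lemma iso_scale: "zariski_open U \<Longrightarrow> s \<in> sections S U \<Longrightarrow> regular_on U f \<Longrightarrow>
    \<phi> U (\<lambda>a x. f x *s s a x) = (\<lambda>x. f (pt x) *s \<phi> U s x)"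
  by (rule iso_unfolded[THEN conjunct2, THEN conjunct2, THEN conjunct1, THEN spec, THEN bspec, THEN mp])

lemma iso_restrict: "zariski_open U \<Longrightarrow> zariski_open V \<Longrightarrow> V \<subseteq> U \<Longrightarrow> s \<in> sections S U \<Longrightarrow>
    \<phi> V (\<lambda>a x. if x \<in> V then s a x else 0) = (\<lambda>x. if x \<in> punctured_cone V then \<phi> U s x else 0)"
  by (rule iso_unfolded[THEN conjunct2, THEN conjunct2, THEN conjunct2, THEN spec, THEN bspec, THEN mp])
    simp_all

lemma iso_sum:
  assumes "zariski_open U" "\<And>j. j \<in> J \<Longrightarrow> s j \<in> sections S U" "\<And>j. j \<in> J \<Longrightarrow> regular_on U (f j)"
  shows "\<phi> U (\<lambda>a x. \<Sum>j\<in>J. f j x *s s j a x) = (\<lambda>x. \<Sum>j\<in>J. f j (pt x) *s \<phi> U (s j) x)"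
proof -
  have zero: "\<phi> U (\<lambda>_ _. 0) = (\<lambda>_. 0)"
    using iso_scale[OF assms(1) sections_zero regular_on_const[of U 0]] by simp
  show ?thesis
    using assms(2,3)
  proof (induction J rule: infinite_finite_induct)
    case (insert j J)
    have j: "s j \<in> sections S U" "regular_on U (f j)" using insert.prems by auto
    have "(\<lambda>a x. \<Sum>j\<in>J. f j x *s s j a x) \<in> sections S U"
      using insert.prems by (intro sections_sum) auto
    from iso_add[OF assms(1) sections_scale[OF j] this] iso_scale[OF assms(1) j] insert
    show ?case by simp
  qed (simp_all add: zero)
qed

text \<open>Composing \<open>\<phi>\<close> with the residue along \<open>h\<close> gives an \<open>O\<close>-linear map from \<open>S\<close> to the
  functions on \<open>h\<close>, that is, a section over \<open>h\<close> of the dual of \<open>S\<close>.\<close>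

lemma logarithmic_imp_unstable:
  assumes S: "vector_bundle S" and nc: "normal_crossing \<H>" and h: "h \<in> \<H>"
    and h': "h' \<in> \<H>" "h' \<noteq> h" and v: "2 \<le> CARD('v)"
  shows "unstable_hyperplane S h"
proof -
  have fin: "finite \<H>" using nc by (simp add: normal_crossing_def)
  let ?Z = "hyperplane h"
  note opn = vector_bundle_open[OF S]
  \<comment> \<open>\<open>e a i\<close> is the i-th vector of the frame of \<open>S\<close> over
    the chart \<open>a\<close>, written in all charts \<open>b\<close>.\<close>
  define e where "e a i = (\<lambda>b x. if x \<in> chart_dom S a \<inter> chart_dom S b then column i (transition S b a x) else 0)"
    for a i
  have e: "e a i \<in> sections S (chart_dom S a)" for a i
  proof (rule sectionsI)
    show "regular_on (chart_dom S b \<inter> chart_dom S a) (\<lambda>x. e a i b x $ j)" for b j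
      by (rule regular_on_cong[OF vector_bundle_regular[OF S]]) (simp add: e_def column_def)
    show "e a i b x = transition S b c x *v e a i c x"
      if x: "x \<in> chart_dom S b" "x \<in> chart_dom S c" "x \<in> chart_dom S a" for b c x
    proof -
      have "column i (transition S b a x) = transition S b c x *v column i (transition S c a x)"
        using vector_bundle_cocycle[OF S x]
        by (simp add: column_def matrix_vector_mult_def matrix_matrix_mult_def vec_eq_iff)
      then show ?thesis using x by (simp add: e_def)
    qed
  qed (auto simp: e_def)
  have "\<exists>\<rho>. regular_on (chart_dom S a \<inter> ?Z) \<rho> \<and>
      (\<forall>l\<in>chart_dom S a \<inter> ?Z. has_residue \<H> h (\<phi> (chart_dom S a) (e a i)) l (\<rho> l))" for a i
  proof -
    have "\<phi> (chart_dom S a) (e a i) \<in> log_forms \<H> (chart_dom S a)"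
      using iso_bij[OF opn] e by (rule bij_betwE[THEN bspec])
    then show ?thesis by (rule log_forms_residue[OF nc _ h]) blast
  qed
  then obtain \<rho> where \<rho>: "\<forall>a i. regular_on (chart_dom S a \<inter> ?Z) (\<rho> a i) \<and>
      (\<forall>l\<in>chart_dom S a \<inter> ?Z. has_residue \<H> h (\<phi> (chart_dom S a) (e a i)) l (\<rho> a i l))"
    by metis
  define s where "s a l = (if l \<in> chart_dom S a \<inter> ?Z then (\<chi> i. \<rho> a i l) else 0)" for a l
  \<comment> \<open>On the overlap the frame of \<open>a\<close> is a combination of the frame of
    \<open>b\<close> with regular coefficients. Linearity of the isomorphism and uniqueness of
    residues carry this over to the \<open>\<rho>\<close>.\<close>
  have trans: "\<rho> a i l = (\<Sum>j\<in>UNIV. transition S b a l $ j $ i * \<rho> b j l)"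
    if l: "l \<in> chart_dom S a" "l \<in> chart_dom S b" "l \<in> ?Z" for a b i l
  proof -
    define V where "V = chart_dom S a \<inter> chart_dom S b"
    have V: "zariski_open V" "V \<subseteq> chart_dom S a" "V \<subseteq> chart_dom S b" "l \<in> V"
      using opn l by (auto simp: V_def)
    define r where "r c j = (\<lambda>d x. if x \<in> V then e c j d x else 0)" for c j
    have rb: "r b j \<in> sections S V" for j
      unfolding r_def by (rule sections_restrict[OF e V(3)])
    have reg: "regular_on V (\<lambda>x. transition S b a x $ j $ i)" for j
      using vector_bundle_regular[OF S, of b a] by (rule regular_on_subset) (simp add: V_def)
    have "r a i d x = (\<Sum>j\<in>UNIV. transition S b a x $ j $ i *s r b j d x)" for d x
    proof (cases "x \<in> V \<and> x \<in> chart_dom S d")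
      case True
      then have x: "x \<in> chart_dom S a" "x \<in> chart_dom S b" "x \<in> chart_dom S d" by (auto simp: V_def)
      have "column i (transition S d a x) =
        (\<Sum>j\<in>UNIV. transition S b a x $ j $ i *s column j (transition S d b x))"
        using vector_bundle_cocycle[OF S x(3,2,1)]
        by (simp add: column_def matrix_matrix_mult_def vec_eq_iff mult.commute)
      then show ?thesis using True x by (simp add: r_def e_def)
    qed (auto simp: r_def e_def)
    then have "r a i = (\<lambda>d x. \<Sum>j\<in>UNIV. transition S b a x $ j $ i *s r b j d x)" by blast
    then have eq: "\<phi> V (r a i) = (\<lambda>x. \<Sum>j\<in>UNIV. transition S b a (pt x) $ j $ i *s \<phi> V (r b j) x)"
      using iso_sum[OF V(1), of UNIV "r b" "\<lambda>j x. transition S b a x $ j $ i"] rb reg by simp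
    have res: "has_residue \<H> h (\<phi> V (r c j)) l (\<rho> c j l)"
      if "l \<in> chart_dom S c" "V \<subseteq> chart_dom S c" for c j
    proof -
      have "\<phi> V (r c j) = (\<lambda>x. if x \<in> punctured_cone V then \<phi> (chart_dom S c) (e c j) x else 0)"
        unfolding r_def by (rule iso_restrict[OF opn V(1) that(2) e])
      then show ?thesis using \<rho> that(1) l(3) by (simp add: has_residue_restrict[OF V(1,4)])
    qed
    have "has_residue \<H> h (\<phi> V (r a i)) l (\<Sum>j\<in>UNIV. transition S b a l $ j $ i * \<rho> b j l)"
      unfolding eq by (rule has_residue_sum[OF res[OF l(2) V(3)] reg V(1,4)])
    with res[OF l(1) V(2)] show ?thesis by (rule has_residue_unique[OF nc h l(3)])
  qed
  have "s \<in> sections (dual S) ?Z"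
  proof (rule sectionsI)
    show "regular_on (chart_dom (dual S) a \<inter> ?Z) (\<lambda>l. s a l $ i)" for a i
    proof (rule regular_on_cong)
      show "regular_on (chart_dom (dual S) a \<inter> ?Z) (\<rho> a i)" using \<rho> by simp
    qed (simp add: s_def)
    show "s a l = transition (dual S) a b l *v s b l"
      if "l \<in> chart_dom (dual S) a" "l \<in> chart_dom (dual S) b" "l \<in> ?Z" for a b l
    proof -
      have "transition (dual S) a b l *v s b l = (\<chi> i. \<Sum>j\<in>UNIV. transition S b a l $ j $ i * \<rho> b j l)"
        using that by (simp add: s_def matrix_vector_mult_def transpose_def vec_eq_iff
            del: transpose_matrix_vector)
      also have "\<dots> = (\<chi> i. \<rho> a i l)" using trans[of l a b] that by simp
      also have "\<dots> = s a l" using that by (simp add: s_def)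
      finally show ?thesis by simp
    qed
  qed (auto simp: s_def)
  moreover have "s \<noteq> (\<lambda>_ _. 0)"
  proof
    assume s0: "s = (\<lambda>_ _. 0)"
    \<comment> \<open>With at least two coordinates the hyperplane has a point, at which the residue
      can be tested.\<close>
    have "\<exists>x. x \<noteq> 0 \<and> (\<forall>f\<in>{pairing (coords h)}. f x = 0)"
      using v by (intro linear_form_common_zero) (auto simp: linear_form_pairing)
    then obtain x where x: "x \<noteq> 0" "pairing (coords h) x = 0" by auto
    define l where "l = pt x"
    have l: "l \<in> ?Z" using x by (simp add: l_def mem_hyperplane_pt)
    obtain a where a: "l \<in> chart_dom S a" using vector_bundle_cover[OF S] .
    \<comment> \<open>The coefficients of dh / h - dh' / h': the second hyperplane balances their
      sum to 0, while the residue along \<open>h\<close> is 1.\<close>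
    define c where "c g = (\<lambda>_ :: 'v proj. if g = h then 1 else if g = h' then - 1 else 0 :: complex)" for g
    have c0: "(\<Sum>g\<in>\<H>. c g m) = 0" for m
    proof -
      have "(\<Sum>g\<in>\<H>. c g m) = (\<Sum>g\<in>\<H>. (if g = h then 1 else 0) - (if g = h' then 1 else 0))"
        using h'(2) by (intro sum.cong) (auto simp: c_def)
      then show ?thesis using fin h h' by (simp add: sum_subtractf)
    qed
    let ?U = "chart_dom S a"
    define \<omega> where "\<omega> = log_form \<H> ?U c"
    have reg: "regular_on ?U (c g)" for g unfolding c_def by (rule regular_on_const)
    have "\<omega> \<in> log_forms \<H> ?U"
      unfolding \<omega>_def by (rule log_form_in_log_forms[OF opn fin reg c0])
    then obtain t where t: "t \<in> sections S ?U" "\<omega> = \<phi> ?U t"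
      using iso_bij[OF opn[of a]] by (metis bij_betw_imp_surj_on imageE)
    have "t b x = (\<Sum>i\<in>UNIV. t a x $ i *s e a i b x)" for b x
    proof (cases "x \<in> ?U \<and> x \<in> chart_dom S b")
      case True
      then have "t b x = transition S b a x *v t a x"
        using sections_transition[OF t(1)] by blast
      then show ?thesis
        using True by (simp add: e_def column_def matrix_vector_mult_def vec_eq_iff mult.commute)
    next
      case False
      then show ?thesis using sections_outside[OF t(1), of x b] by (auto simp: e_def)
    qed
    then have "t = (\<lambda>b x. \<Sum>i\<in>UNIV. t a x $ i *s e a i b x)" by blast
    moreover have treg: "regular_on ?U (\<lambda>x. t a x $ i)" for i
      using sections_regular[OF t(1), of a i] by simp
    ultimately have eq: "\<omega> = (\<lambda>x. \<Sum>i\<in>UNIV. t a (pt x) $ i *s \<phi> ?U (e a i) x)"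
      using iso_sum[where U = ?U and s = "e a" and J = UNIV and f = "\<lambda>i x. t a x $ i", OF opn e treg] t(2)
      by simp
    \<comment> \<open>Expanded in the frame, the form would have residue 0, as all
      \<open>\<rho> a i l\<close> vanish together with \<open>s\<close>; its coefficient at
      \<open>h\<close> gives residue 1.\<close>
    have "has_residue \<H> h \<omega> l (\<Sum>i\<in>UNIV. t a l $ i * \<rho> a i l)"
      unfolding eq by (rule has_residue_sum[OF _ treg opn a]) (use \<rho> a l in blast)
    moreover have "\<rho> a i l = 0" for i
      using fun_cong[OF fun_cong[OF s0, of a], of l] a l by (simp add: s_def vec_eq_iff)
    moreover obtain N \<mu> \<theta> where dec: "log_decomposition \<H> ?U \<omega> l N \<mu> c \<theta>"
      using log_form_decomposition[OF opn fin reg c0 a] unfolding \<omega>_def by blast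
    have "l \<in> N" using dec unfolding log_decomposition_def by blast
    then have "has_residue \<H> h \<omega> l (c h l)"
      using log_decomposition_residue[OF dec fin h l _ l] by blast
    ultimately have "c h l = 0" using has_residue_unique[OF nc h l] by fastforce
    then show False by (simp add: c_def)
  qed
  ultimately show ?thesis unfolding unstable_hyperplane_def by blast
qed

end


subsection \<open>The isomorphism with logarithmic forms\<close>

lemma log_decomposition_cong:
  assumes "log_decomposition \<H> N \<omega> l N' \<mu> u \<theta>" "N \<subseteq> U"
    and "\<And>x. x \<in> punctured_cone (N - (\<Union>h\<in>\<H>. hyperplane h)) \<Longrightarrow> \<omega>' x = \<omega> x"
  shows "log_decomposition \<H> U \<omega>' l N' \<mu> u \<theta>"
proof -
  have "N' \<subseteq> N" using assms(1) unfolding log_decomposition_def by blast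
  then have "punctured_cone (N' - (\<Union>h\<in>\<H>. hyperplane h)) \<subseteq> punctured_cone (N - (\<Union>h\<in>\<H>. hyperplane h))"
    by (intro punctured_cone_mono) blast
  then have eq: "\<omega>' x = \<omega> x" if "x \<in> punctured_cone (N' - (\<Union>h\<in>\<H>. hyperplane h))" for x
    using assms(3) that by blast
  have "N' \<subseteq> U" using \<open>N' \<subseteq> N\<close> assms(2) by blast
  then show ?thesis
    using assms(1) unfolding log_decomposition_def by (simp add: eq)
qed

lemma dual_basis_expansion:
  fixes f :: "'t \<Rightarrow> complex ^ 'n::finite"
  assumes ind: "lin_indep f K" "finite K" "card K = CARD('n)"
    and e: "\<And>h. h \<in> K \<Longrightarrow> pairing (f h) (e h) = 1"
      "\<And>g h. g \<in> K \<Longrightarrow> h \<in> K \<Longrightarrow> g \<noteq> h \<Longrightarrow> pairing (f g) (e h) = 0"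
  shows "a = (\<Sum>h\<in>K. pairing a (e h) *s f h)"
proof -
  obtain c where c: "a = (\<Sum>h\<in>K. c h *s f h)" using lin_indep_span[OF ind] .
  have "pairing a (e h) = c h" if h: "h \<in> K" for h
  proof -
    have "pairing a (e h) = (\<Sum>g\<in>K. c g * pairing (f g) (e h))"
      by (simp add: c pairing_sum_left pairing_scale_left)
    also have "\<dots> = (\<Sum>g\<in>K. if g = h then c h else 0)"
      using e h by (intro sum.cong) auto
    finally show ?thesis using h ind(2) by simp
  qed
  then have "(\<Sum>h\<in>K. pairing a (e h) *s f h) = (\<Sum>h\<in>K. c h *s f h)" by simp
  with c show ?thesis by simp
qed

text \<open>The vectors \<open>w h\<close> are already rescaled: \<open>relation\<close> and
  \<open>unique\<close> together say that the relations among them are exactly the constant ones.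
  \<open>card\<close> lets the hyperplanes through a point be completed to a basis of the linear
  forms.\<close>

locale steiner_log = steiner_resolution B S A
  for B :: "complex ^ 'v::finite \<Rightarrow> complex ^ 'w::finite \<Rightarrow> complex ^ 'i::finite"
    and S :: "('a, 'v, 'r::finite) vbundle" and A +
  fixes \<H> :: "'v proj set" and w :: "'v proj \<Rightarrow> complex ^ 'w" and \<iota> :: "'v proj \<Rightarrow> complex ^ 'i"
  assumes nc: "normal_crossing \<H>" and card: "CARD('v) \<le> card \<H>"
    and tensor: "h \<in> \<H> \<Longrightarrow> B x (w h) = pairing (coords h) x *s \<iota> h"
    and relation: "(\<Sum>h\<in>\<H>. w h) = 0"
    and unique: "(\<Sum>h\<in>\<H>. d h *s w h) = 0 \<Longrightarrow> \<exists>e. \<forall>h\<in>\<H>. d h = e"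
begin

lemma fin: "finite \<H>"
  using nc by (simp add: normal_crossing_def)

lemma nonempty: "\<H> \<noteq> {}"
  using card by auto

text \<open>The transpose of \<open>A\<close> is the quotient map onto \<open>S\<close> from the
  trivial bundle with fibre the dual of W; \<open>\<eta>\<close> is a preimage of the value of
  \<open>s\<close> at \<open>l\<close>, in all charts at once.\<close>

definition lifts :: "('a \<Rightarrow> 'v proj \<Rightarrow> complex ^ 'r) \<Rightarrow> 'v proj \<Rightarrow> complex ^ 'w \<Rightarrow> bool" where
  "lifts s l \<eta> \<longleftrightarrow> (\<forall>a. l \<in> chart_dom S a \<longrightarrow> transpose (A a l) *v \<eta> = s a l)"

lemma liftsD: "lifts s l \<eta> \<Longrightarrow> l \<in> chart_dom S a \<Longrightarrow> transpose (A a l) *v \<eta> = s a l"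
  unfolding lifts_def by blast

lemma transpose_transition:
  assumes "l \<in> chart_dom S a" "l \<in> chart_dom S b"
  shows "transpose (A b l) *v \<eta> = transition S b a l *v (transpose (A a l) *v \<eta>)"
proof -
  have "transpose (A b l) = transition S b a l ** transpose (A a l)"
    using arg_cong[OF A_transition[OF assms(2,1)], of transpose]
    by (simp add: matrix_transpose_mul)
  then show ?thesis by (simp only: matrix_vector_mul_assoc)
qed

lemma liftsI:
  assumes "s \<in> sections S U" "l \<in> U" "l \<in> chart_dom S a" "transpose (A a l) *v \<eta> = s a l"
  shows "lifts s l \<eta>"
  unfolding lifts_def
proof (intro allI impI)
  fix b assume b: "l \<in> chart_dom S b"
  show "transpose (A b l) *v \<eta> = s b l"
    unfolding transpose_transition[OF assms(3) b] assms(4)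
    using sections_transition[OF assms(1) b assms(3,2)] by (rule sym)
qed

definition form :: "complex ^ 'v \<Rightarrow> complex ^ 'w \<Rightarrow> complex ^ 'v" where
  "form x \<eta> = (\<Sum>h\<in>\<H>. (pairing \<eta> (w h) / pairing (coords h) x) *s coords h)"

lemma form_add: "form x (\<eta> + \<zeta>) = form x \<eta> + form x \<zeta>"
  by (simp add: form_def pairing_add_left add_divide_distrib vector_sadd_rdistrib sum.distrib)

lemma form_scale: "form x (c *s \<eta>) = c *s form x \<eta>"
  by (simp add: form_def pairing_scale_left vec.scale_sum_right vector_smult_assoc)

text \<open>The transpose of \<open>form x\<close>, see \<open>pairing_form\<close>. Off the
  hyperplanes, \<open>x\<close> itself goes to \<Sum> w h = 0, so this is a map from tangent vectors
  of the projective space.\<close>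

definition tangent :: "complex ^ 'v \<Rightarrow> complex ^ 'v \<Rightarrow> complex ^ 'w" where
  "tangent x v = (\<Sum>h\<in>\<H>. (pairing (coords h) v / pairing (coords h) x) *s w h)"

lemma tangent_add: "tangent x (u + v) = tangent x u + tangent x v"
  by (simp add: tangent_def pairing_add_right add_divide_distrib vector_sadd_rdistrib sum.distrib)

lemma tangent_scale: "tangent x (c *s v) = c *s tangent x v"
  by (simp add: tangent_def pairing_scale_right vec.scale_sum_right vector_smult_assoc)

lemma pairing_form: "pairing (form x \<eta>) v = pairing \<eta> (tangent x v)"
  by (simp add: form_def tangent_def pairing_sum_left pairing_sum_right pairing_scale_left
      pairing_scale_right mult.commute)

text \<open>The values of the forms at \<open>x\<close> cancel because each \<open>w h\<close> is a
  pure tensor, and what remains is \<open>B v\<close> applied to \<Sum> w h = 0.\<close>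

lemma tangent_in_range:
  assumes x: "x \<noteq> 0" "\<forall>h\<in>\<H>. pairing (coords h) x \<noteq> 0" and a: "pt x \<in> chart_dom S a"
  shows "tangent x v \<in> range ((*v) (A a (pt x)))"
proof -
  have "B x (tangent x v) = (\<Sum>h\<in>\<H>. pairing (coords h) v *s \<iota> h)"
    using x(2) by (auto simp: tangent_def sum_right scale_right tensor vector_smult_assoc intro!: sum.cong)
  also have "\<dots> = B v (\<Sum>h\<in>\<H>. w h)" by (simp add: sum_right tensor)
  finally have "B x (tangent x v) = 0" by (simp add: relation)
  moreover obtain e where "coords (pt x) = e *s x" using coords_pt[OF x(1)] .
  ultimately show ?thesis unfolding A_range[OF a] by (simp add: scale_left)
qed

text \<open>Two lifts of the same value differ by a covector that vanishes on the fibre of the dual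
  bundle, which contains every \<open>tangent x v\<close>.\<close>

lemma form_cong:
  assumes x: "x \<noteq> 0" "\<forall>h\<in>\<H>. pairing (coords h) x \<noteq> 0" and a: "pt x \<in> chart_dom S a"
    and eq: "transpose (A a (pt x)) *v \<eta> = transpose (A a (pt x)) *v \<zeta>"
  shows "form x \<eta> = form x \<zeta>"
proof (rule pairing_eqI)
  fix v
  obtain q where "tangent x v = A a (pt x) *v q" using tangent_in_range[OF x a] by blast
  then show "pairing (form x \<eta>) v = pairing (form x \<zeta>) v"
    by (simp only: pairing_form pairing_transpose eq)
qed

text \<open>The vectors \<open>tangent x v\<close> fill the fibre of the dual bundle, because their only relations
  come from \<open>v\<close> proportional to \<open>x\<close>.\<close>

lemma form_eq_0D:
  assumes x: "x \<noteq> 0" "\<forall>h\<in>\<H>. pairing (coords h) x \<noteq> 0" and a: "pt x \<in> chart_dom S a"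
    and form0: "form x \<eta> = 0"
  shows "transpose (A a (pt x)) *v \<eta> = 0"
proof (rule ccontr)
  define \<sigma> where "\<sigma> = transpose (A a (pt x)) *v \<eta>"
  assume "transpose (A a (pt x)) *v \<eta> \<noteq> 0"
  then obtain i where i: "\<sigma> $ i \<noteq> 0" unfolding \<sigma>_def[symmetric] by (auto simp: vec_eq_iff)
  obtain g where g: "g \<in> \<H>" using nonempty by blast
  obtain L where L: "L ** A a (pt x) = mat 1"
    using A_inj[OF a] matrix_left_invertible_injective by blast
  define q where "q v = L *v tangent x v" for v
  have Aq: "A a (pt x) *v q v = tangent x v" for v
  proof -
    obtain p where p: "tangent x v = A a (pt x) *v p" using tangent_in_range[OF x a] by blast
    have "q v = p" unfolding q_def p by (simp add: matrix_vector_mul_assoc L)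
    then show ?thesis by (simp add: p)
  qed
  have q_add: "q (u + v) = q u + q v" and q_scale: "q (c *s v) = c *s q v" for u v c
    by (simp_all add: q_def tangent_add tangent_scale matrix_vector_right_distrib vector_scalar_commute)
  \<comment> \<open>At most r <= n equations on n + 1 coordinates: all components of
    \<open>q v\<close> but the i-th, and one form \<open>g\<close>, which excludes the multiples of
    \<open>x\<close>. The i-th component then vanishes because \<open>\<sigma>\<close> pairs to 0
    with \<open>q v\<close> and \<open>\<sigma> $ i \<noteq> 0\<close>.\<close>
  define F where "F = insert (pairing (coords g)) ((\<lambda>j v. q v $ j) ` (UNIV - {i}))"
  have "card F \<le> Suc (card ((\<lambda>j v. q v $ j) ` (UNIV - {i})))"
    unfolding F_def by (rule card_insert_le_m1) auto
  also have "\<dots> \<le> Suc (CARD('r) - 1)"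
    using card_image_le[of "UNIV - {i}" "\<lambda>j v. q v $ j"]
    by (simp only: Suc_le_mono card_Diff_singleton UNIV_I finite)
  also have "\<dots> < CARD('v)" using rank by simp
  finally have "card F < CARD('v)" .
  moreover have "finite F" by (simp add: F_def)
  moreover have "linear_form f" if "f \<in> F" for f
    using that linear_form_pairing by (auto simp: F_def linear_form_def q_add q_scale)
  ultimately obtain v where v: "v \<noteq> 0" "\<forall>f\<in>F. f v = 0" using linear_form_common_zero by blast
  have "0 = pairing (form x \<eta>) v" by (simp add: form0)
  also have "\<dots> = pairing \<sigma> (q v)"
    by (simp only: pairing_form \<sigma>_def pairing_transpose[symmetric] Aq)
  also have "\<dots> = (\<Sum>j\<in>UNIV. if j = i then \<sigma> $ i * q v $ i else 0)"
    unfolding pairing_def using v(2) by (intro sum.cong) (auto simp: F_def)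
  finally have "q v $ i = 0" using i by simp
  then have "q v = 0" using v(2) by (auto simp: vec_eq_iff F_def)
  then have "tangent x v = 0" using Aq[of v] by simp
  then obtain e where e: "\<forall>h\<in>\<H>. pairing (coords h) v / pairing (coords h) x = e"
    using unique[of "\<lambda>h. pairing (coords h) v / pairing (coords h) x"] unfolding tangent_def by blast
  \<comment> \<open>The common ratio is 0 at \<open>g\<close>, so \<open>v\<close> would lie on all
    the hyperplanes, of which there are at least n + 1.\<close>
  have "e = 0" using e g v(2) by (auto simp: F_def)
  then have "{h \<in> \<H>. pairing (coords h) v = 0} = \<H>" using e x(2) by auto
  then show False using normal_crossing_through_point[OF nc v(1)] card by simp
qed

text \<open>Near \<open>l\<close> the matrix \<open>A a\<close> has a regular left inverse, whose
  transpose splits the quotient map onto \<open>S\<close>.\<close>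

lemma local_lift:
  assumes s: "s \<in> sections S U" and U: "zariski_open U" "l \<in> U"
  obtains N \<eta> where "zariski_open N" "l \<in> N" "N \<subseteq> U" "\<And>q. regular_on N (\<lambda>m. \<eta> m $ q)"
    "\<And>m. m \<in> N \<Longrightarrow> lifts s m (\<eta> m)"
proof -
  obtain a where a: "l \<in> chart_dom S a" using vector_bundle_cover[OF S] .
  let ?D = "chart_dom S a \<inter> U"
  have "regular_on ?D (\<lambda>m. A a m $ p $ q)" for p q
    using A_regular by (rule regular_on_subset) blast
  moreover have "zariski_open ?D" using vector_bundle_open[OF S] U by blast
  ultimately obtain N L where N: "zariski_open N" "l \<in> N" "N \<subseteq> ?D"
    and L: "\<And>i j. regular_on N (\<lambda>m. L m $ i $ j)" "\<And>m. m \<in> N \<Longrightarrow> L m ** A a m = mat 1"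
    using regular_left_inverse[of ?D "A a" l] A_inj[OF a] a U(2) by blast
  define \<eta> where "\<eta> m = transpose (L m) *v s a m" for m
  have "regular_on N (\<lambda>m. \<eta> m $ q)" for q
    unfolding \<eta>_def
    by (intro regular_on_mult_vec regular_on_subset[OF sections_regular[OF s] N(3)])
      (simp add: transpose_def L(1))
  moreover have "lifts s m (\<eta> m)" if "m \<in> N" for m
  proof (rule liftsI[OF s])
    have "transpose (A a m) *v \<eta> m = transpose (L m ** A a m) *v s a m"
      unfolding \<eta>_def matrix_transpose_mul by (simp only: matrix_vector_mul_assoc)
    then show "transpose (A a m) *v \<eta> m = s a m" by (simp add: L(2)[OF that] transpose_mat)
  qed (use that N(3) in auto)
  ultimately show thesis using that N by blast
qed

text \<open>The choice of the lift is pointwise; \<open>form_cong\<close> makes the value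
  independent of it, so regularity can be checked afterwards with regular lifts.\<close>

definition \<phi> :: "'v proj set \<Rightarrow> ('a \<Rightarrow> 'v proj \<Rightarrow> complex ^ 'r) \<Rightarrow> complex ^ 'v \<Rightarrow> complex ^ 'v" where
  "\<phi> U s x = (if x \<in> punctured_cone (U - (\<Union>h\<in>\<H>. hyperplane h))
    then form x (SOME \<eta>. lifts s (pt x) \<eta>) else 0)"

lemma \<phi>_eq:
  assumes x: "x \<in> punctured_cone (U - (\<Union>h\<in>\<H>. hyperplane h))" and \<eta>: "lifts s (pt x) \<eta>"
  shows "\<phi> U s x = form x \<eta>"
proof -
  have x': "x \<noteq> 0" "\<forall>h\<in>\<H>. pairing (coords h) x \<noteq> 0"
    using x unfolding punctured_cone_Diff_hyperplanes by (auto simp: punctured_cone_iff)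
  obtain a where a: "pt x \<in> chart_dom S a" using vector_bundle_cover[OF S] .
  have "lifts s (pt x) (SOME \<eta>. lifts s (pt x) \<eta>)" using \<eta> by (rule someI)
  then have "transpose (A a (pt x)) *v (SOME \<eta>. lifts s (pt x) \<eta>) = transpose (A a (pt x)) *v \<eta>"
    using liftsD[OF _ a] \<eta> by (simp only:)
  then have "form x (SOME \<eta>. lifts s (pt x) \<eta>) = form x \<eta>" by (rule form_cong[OF x' a])
  then show ?thesis using x by (simp add: \<phi>_def)
qed

lemma \<phi>_outside: "x \<notin> punctured_cone (U - (\<Union>h\<in>\<H>. hyperplane h)) \<Longrightarrow> \<phi> U s x = 0"
  by (simp add: \<phi>_def)

lemma obtain_lift:
  assumes "s \<in> sections S U" "zariski_open U" "x \<in> punctured_cone (U - (\<Union>h\<in>\<H>. hyperplane h))"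
  obtains \<eta> where "lifts s (pt x) \<eta>"
proof -
  have "pt x \<in> U" using assms(3) by (auto simp: punctured_cone_iff)
  then obtain N \<eta> where N: "pt x \<in> N" "\<And>m. m \<in> N \<Longrightarrow> lifts s m (\<eta> m)"
    using local_lift[OF assms(1,2)] by metis
  show thesis by (rule that[OF N(2)[OF N(1)]])
qed

text \<open>For a regular lift \<open>\<eta>\<close> the coefficients \<open>\<eta>(w h)\<close> are
  regular and sum to the value of \<open>\<eta>\<close> on \<Sum> w h = 0, so \<open>\<phi>\<close>
  is locally a \<open>log_form\<close>.\<close>

lemma \<phi>_local:
  assumes s: "s \<in> sections S U" and U: "zariski_open U" "l \<in> U"
  obtains N c where "zariski_open N" "l \<in> N" "N \<subseteq> U" "\<And>h. regular_on N (c h)"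
    "\<And>m. m \<in> N \<Longrightarrow> (\<Sum>h\<in>\<H>. c h m) = 0"
    "\<And>x. x \<in> punctured_cone (N - (\<Union>h\<in>\<H>. hyperplane h)) \<Longrightarrow> \<phi> U s x = log_form \<H> N c x"
proof -
  obtain N \<eta> where N: "zariski_open N" "l \<in> N" "N \<subseteq> U" and \<eta>: "\<And>q. regular_on N (\<lambda>m. \<eta> m $ q)"
    "\<And>m. m \<in> N \<Longrightarrow> lifts s m (\<eta> m)"
    using local_lift[OF assms] by blast
  define c where "c h m = pairing (\<eta> m) (w h)" for h m
  have "regular_on N (c h)" for h
    unfolding c_def[abs_def] pairing_def by (intro regular_on_sum regular_on_mult \<eta>(1) regular_on_const)
  moreover have "(\<Sum>h\<in>\<H>. c h m) = 0" for m
    unfolding c_def pairing_sum_right[symmetric] relation by simp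
  moreover have "\<phi> U s x = log_form \<H> N c x" if x: "x \<in> punctured_cone (N - (\<Union>h\<in>\<H>. hyperplane h))" for x
  proof -
    have "x \<in> punctured_cone (U - (\<Union>h\<in>\<H>. hyperplane h))" "pt x \<in> N"
      using x N(3) by (auto simp: punctured_cone_iff)
    then have "\<phi> U s x = form x (\<eta> (pt x))" using \<eta>(2) by (intro \<phi>_eq) auto
    then show ?thesis using x by (simp add: log_form_def form_def c_def)
  qed
  ultimately show thesis using that N by blast
qed

lemma \<phi>_in_log_forms:
  assumes s: "s \<in> sections S U" and U: "zariski_open U"
  shows "\<phi> U s \<in> log_forms \<H> U"
  unfolding log_forms_iff
proof (intro conjI ballI)
  let ?X = "\<Union>h\<in>\<H>. hyperplane h"
  show "\<exists>N \<mu> u \<theta>. log_decomposition \<H> U (\<phi> U s) l N \<mu> u \<theta>" if l: "l \<in> U" for l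
  proof -
    obtain N c where N: "zariski_open N" "l \<in> N" "N \<subseteq> U" and c: "\<And>h. regular_on N (c h)"
      "\<And>m. m \<in> N \<Longrightarrow> (\<Sum>h\<in>\<H>. c h m) = 0"
      "\<And>x. x \<in> punctured_cone (N - ?X) \<Longrightarrow> \<phi> U s x = log_form \<H> N c x"
      using \<phi>_local[OF s U l] by blast
    obtain N' \<mu> \<theta> where "log_decomposition \<H> N (log_form \<H> N c) l N' \<mu> c \<theta>"
      using log_form_decomposition[OF N(1) fin c(1,2) N(2)] by blast
    from log_decomposition_cong[OF this N(3) c(3)] show ?thesis by blast
  qed
  have loc: "\<exists>N \<omega>. zariski_open N \<and> pt x \<in> N \<and> N \<subseteq> U \<and> \<omega> \<in> one_forms (N - ?X) \<and>
      (\<forall>y\<in>punctured_cone (N - ?X). \<phi> U s y = \<omega> y)" if x: "x \<in> punctured_cone (U - ?X)" for x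
  proof -
    have l: "pt x \<in> U" using x by (auto simp: punctured_cone_iff)
    obtain N c where N: "zariski_open N" "pt x \<in> N" "N \<subseteq> U" and c: "\<And>h. regular_on N (c h)"
      "\<And>m. m \<in> N \<Longrightarrow> (\<Sum>h\<in>\<H>. c h m) = 0"
      "\<And>x. x \<in> punctured_cone (N - ?X) \<Longrightarrow> \<phi> U s x = log_form \<H> N c x"
      using \<phi>_local[OF s U l] by blast
    have "log_form \<H> N c \<in> one_forms (N - ?X)"
      using log_form_in_log_forms[OF N(1) fin c(1,2)] unfolding log_forms_iff by blast
    with N c(3) show ?thesis by blast
  qed
  show "\<phi> U s \<in> one_forms (U - ?X)"
  proof (rule one_formsI)
    fix i
    show "homog_regular (- 1) (U - ?X) (\<lambda>x. \<phi> U s x $ i)"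
    proof (rule homog_regular_local)
      fix x assume "x \<in> punctured_cone (U - ?X)"
      then obtain N \<omega> where N: "zariski_open N" "pt x \<in> N" "N \<subseteq> U" "\<omega> \<in> one_forms (N - ?X)"
        "\<forall>y\<in>punctured_cone (N - ?X). \<phi> U s y = \<omega> y"
        using loc by blast
      have "N \<inter> (U - ?X) = N - ?X" using N(3) by blast
      moreover have "homog_regular (- 1) (N - ?X) (\<lambda>x. \<phi> U s x $ i)"
        using one_formsD(1)[OF N(4)] by (rule homog_regular_cong) (use N(5) in simp)
      ultimately show "\<exists>N. zariski_open N \<and> pt x \<in> N \<and>
          homog_regular (- 1) (N \<inter> (U - ?X)) (\<lambda>x. \<phi> U s x $ i)"
        using N(1,2) by (intro exI[of _ N]) simp
    qed
  next
    fix x assume x: "x \<in> punctured_cone (U - ?X)"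
    then obtain N \<omega> where N: "pt x \<in> N" "\<omega> \<in> one_forms (N - ?X)"
      "\<forall>y\<in>punctured_cone (N - ?X). \<phi> U s y = \<omega> y"
      using loc by blast
    have "x \<in> punctured_cone (N - ?X)" using x N(1) unfolding punctured_cone_iff by blast
    then show "pairing (\<phi> U s x) x = 0" using N(3) one_formsD(2)[OF N(2)] by simp
  qed (rule \<phi>_outside)
qed

lemma \<phi>_add:
  assumes s: "s \<in> sections S U" and t: "t \<in> sections S U" and U: "zariski_open U"
  shows "\<phi> U (\<lambda>a x. s a x + t a x) = (\<lambda>x. \<phi> U s x + \<phi> U t x)"
proof
  fix x
  show "\<phi> U (\<lambda>a x. s a x + t a x) x = \<phi> U s x + \<phi> U t x"
  proof (cases "x \<in> punctured_cone (U - (\<Union>h\<in>\<H>. hyperplane h))")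
    case True
    obtain \<eta> where \<eta>: "lifts s (pt x) \<eta>" using obtain_lift[OF s U True] .
    obtain \<zeta> where \<zeta>: "lifts t (pt x) \<zeta>" using obtain_lift[OF t U True] .
    have "lifts (\<lambda>a x. s a x + t a x) (pt x) (\<eta> + \<zeta>)"
      using \<eta> \<zeta> unfolding lifts_def matrix_vector_right_distrib by simp
    from \<phi>_eq[OF True this] show ?thesis
      by (simp add: \<phi>_eq[OF True \<eta>] \<phi>_eq[OF True \<zeta>] form_add)
  qed (simp add: \<phi>_outside)
qed

lemma \<phi>_scale:
  assumes s: "s \<in> sections S U" and U: "zariski_open U"
  shows "\<phi> U (\<lambda>a x. f x *s s a x) = (\<lambda>x. f (pt x) *s \<phi> U s x)"
proof
  fix x
  show "\<phi> U (\<lambda>a x. f x *s s a x) x = f (pt x) *s \<phi> U s x"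
  proof (cases "x \<in> punctured_cone (U - (\<Union>h\<in>\<H>. hyperplane h))")
    case True
    obtain \<eta> where \<eta>: "lifts s (pt x) \<eta>" using obtain_lift[OF s U True] .
    have "lifts (\<lambda>a x. f x *s s a x) (pt x) (f (pt x) *s \<eta>)"
      using \<eta> unfolding lifts_def vector_scalar_commute by simp
    from \<phi>_eq[OF True this] show ?thesis by (simp add: \<phi>_eq[OF True \<eta>] form_scale)
  qed (simp add: \<phi>_outside)
qed

lemma \<phi>_restrict:
  assumes s: "s \<in> sections S U" and U: "zariski_open U" and V: "V \<subseteq> U"
  shows "\<phi> V (\<lambda>a x. if x \<in> V then s a x else 0) = (\<lambda>x. if x \<in> punctured_cone V then \<phi> U s x else 0)"
proof
  fix x
  let ?X = "\<Union>h\<in>\<H>. hyperplane h"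
  show "\<phi> V (\<lambda>a x. if x \<in> V then s a x else 0) x = (if x \<in> punctured_cone V then \<phi> U s x else 0)"
  proof (cases "x \<in> punctured_cone (V - ?X)")
    case True
    then have xU: "x \<in> punctured_cone (U - ?X)" and xV: "x \<in> punctured_cone V"
      using V by (auto simp: punctured_cone_iff)
    obtain \<eta> where \<eta>: "lifts s (pt x) \<eta>" using obtain_lift[OF s U xU] .
    then have "lifts (\<lambda>a x. if x \<in> V then s a x else 0) (pt x) \<eta>"
      using xV unfolding lifts_def by (simp add: punctured_cone_iff)
    from \<phi>_eq[OF True this] show ?thesis using xV by (simp add: \<phi>_eq[OF xU \<eta>])
  next
    case False
    then have "x \<notin> punctured_cone V \<or> x \<notin> punctured_cone (U - ?X)"
      unfolding punctured_cone_iff by blast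
    then show ?thesis using False by (auto simp: \<phi>_outside)
  qed
qed

text \<open>Off the hyperplanes \<open>form_eq_0D\<close> recovers the section from its form. The
  remaining points are limits along a line in general position. Besides injectivity, this serves to
  glue local preimages.\<close>

lemma section_eqI:
  assumes s: "s \<in> sections S U" and t: "t \<in> sections S U" and U: "zariski_open U"
    and eq: "\<And>x. x \<in> punctured_cone (U - (\<Union>h\<in>\<H>. hyperplane h)) \<Longrightarrow> \<phi> U s x = \<phi> U t x"
  shows "s = t"
proof (intro ext)
  fix a l
  have off: "s a (pt x) = t a (pt x)"
    if x: "x \<in> punctured_cone (U - (\<Union>h\<in>\<H>. hyperplane h))" and a: "pt x \<in> chart_dom S a" for x
  proof -
    have x': "x \<noteq> 0" "\<forall>h\<in>\<H>. pairing (coords h) x \<noteq> 0"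
      using x unfolding punctured_cone_Diff_hyperplanes by (auto simp: punctured_cone_iff)
    obtain \<eta> where \<eta>: "lifts s (pt x) \<eta>" using obtain_lift[OF s U x] .
    obtain \<zeta> where \<zeta>: "lifts t (pt x) \<zeta>" using obtain_lift[OF t U x] .
    have "form x \<eta> = form x \<zeta>" using eq[OF x] by (simp add: \<phi>_eq[OF x \<eta>] \<phi>_eq[OF x \<zeta>])
    then have "form x (\<eta> + (- 1) *s \<zeta>) = 0" unfolding form_add form_scale by (simp add: vec_eq_iff)
    from form_eq_0D[OF x' a this] have "transpose (A a (pt x)) *v \<eta> = transpose (A a (pt x)) *v \<zeta>"
      unfolding matrix_vector_right_distrib vector_scalar_commute by (simp add: vec_eq_iff)
    then show ?thesis using liftsD[OF \<eta> a] liftsD[OF \<zeta> a] by simp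
  qed
  show "s a l = t a l"
  proof (cases "l \<in> chart_dom S a \<inter> U")
    case False
    then show ?thesis using sections_outside[OF s] sections_outside[OF t] by metis
  next
    case True
    let ?D = "chart_dom S a \<inter> U"
    have D: "zariski_open ?D" using vector_bundle_open[OF S] U by blast
    have lD: "coords l \<in> punctured_cone ?D" using True by simp
    have "finite (coords ` \<H>)" "0 \<notin> coords ` \<H>" using fin by (auto dest: sym)
    then obtain z where z: "\<And>a. a \<in> coords ` \<H> \<Longrightarrow> pairing a z \<noteq> 0"
      using finite_forms_nonzero by blast
    have ev: "\<forall>\<^sub>F u in at 0. coords l + u *s z \<in> punctured_cone ?D"
      by (rule eventually_line_in_punctured_cone[OF D lD])
    have "\<forall>\<^sub>F u in at 0. \<forall>h\<in>\<H>. pairing (coords h) (coords l + u *s z) \<noteq> 0"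
      by (rule eventually_off_hyperplanes[OF fin]) (use z in blast)
    with ev have eq': "\<forall>\<^sub>F u in at 0. s a (pt (coords l + u *s z)) = t a (pt (coords l + u *s z))"
    proof eventually_elim
      case (elim u)
      show ?case
      proof (rule off)
        show "coords l + u *s z \<in> punctured_cone (U - (\<Union>h\<in>\<H>. hyperplane h))"
          unfolding punctured_cone_Diff_hyperplanes using elim by simp
        show "pt (coords l + u *s z) \<in> chart_dom S a" using elim(1) by (simp add: punctured_cone_iff)
      qed
    qed
    have "s a l $ i = t a l $ i" for i
    proof -
      have "((\<lambda>u. s a (pt (coords l + u *s z)) $ i) \<longlongrightarrow> s a l $ i) (at 0)"
        using homog_regular_tendsto_line[OF sections_regular[OF s, unfolded regular_on_def] D lD] by simp
      moreover have "\<forall>\<^sub>F u in at 0. s a (pt (coords l + u *s z)) $ i = t a (pt (coords l + u *s z)) $ i"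
        using eq' by eventually_elim simp
      ultimately have "((\<lambda>u. t a (pt (coords l + u *s z)) $ i) \<longlongrightarrow> s a l $ i) (at 0)"
        by (rule Lim_transform_eventually)
      moreover have "((\<lambda>u. t a (pt (coords l + u *s z)) $ i) \<longlongrightarrow> t a l $ i) (at 0)"
        using homog_regular_tendsto_line[OF sections_regular[OF t, unfolded regular_on_def] D lD] by simp
      ultimately show ?thesis using tendsto_unique[of "at (0::complex)"] by auto
    qed
    then show ?thesis by (simp add: vec_eq_iff)
  qed
qed

text \<open>When one hyperplane \<open>g\<close> is dropped, the remaining \<open>w h\<close> are
  independent by \<open>unique\<close> and have dual covectors. The value at \<open>w g\<close>
  comes out right because both the \<open>w h\<close> and the \<open>c h\<close> sum to 0. As
  \<open>f\<close> does not depend on \<open>c\<close>, regular coefficients yield a regular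
  covector.\<close>

lemma covector_with_values:
  obtains f :: "'v proj \<Rightarrow> complex ^ 'w" where
    "\<And>c h. (\<Sum>g\<in>\<H>. c g) = 0 \<Longrightarrow> h \<in> \<H> \<Longrightarrow> pairing (\<Sum>g\<in>\<H>. c g *s f g) (w h) = c h"
proof -
  obtain g where g: "g \<in> \<H>" using nonempty by blast
  let ?G = "\<H> - {g}"
  have ind: "lin_indep w ?G"
    unfolding lin_indep_def
  proof (intro allI impI)
    fix d assume d: "(\<Sum>t\<in>?G. d t *s w t) = 0"
    have "(\<Sum>h\<in>\<H>. (d(g := 0)) h *s w h) = (\<Sum>t\<in>?G. d t *s w t)"
      using g fin by (simp add: sum.remove)
    with d have "(\<Sum>h\<in>\<H>. (d(g := 0)) h *s w h) = 0" by simp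
    from unique[OF this] obtain e where e: "\<forall>h\<in>\<H>. (d(g := 0)) h = e" by blast
    then have "e = 0" using g by auto
    show "\<forall>t\<in>?G. d t = 0"
    proof
      fix t assume "t \<in> ?G"
      then show "d t = 0" using bspec[OF e, of t] \<open>e = 0\<close> by simp
    qed
  qed
  have finG: "finite ?G" using fin by simp
  have "\<exists>v. pairing (w h) v = 1 \<and> (\<forall>k\<in>?G. k \<noteq> h \<longrightarrow> pairing (w k) v = 0)" if "h \<in> ?G" for h
    by (rule dual_vector[OF ind finG that]) blast
  then obtain f where f: "\<forall>h\<in>?G. pairing (w h) (f h) = 1 \<and> (\<forall>k\<in>?G. k \<noteq> h \<longrightarrow> pairing (w k) (f h) = 0)"
    by metis
  define f' where "f' = f(g := 0)"
  have "pairing (\<Sum>k\<in>\<H>. c k *s f' k) (w h) = c h" if c: "(\<Sum>k\<in>\<H>. c k) = 0" and h: "h \<in> \<H>" for c h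
  proof -
    define \<eta> where "\<eta> = (\<Sum>k\<in>\<H>. c k *s f' k)"
    have \<eta>: "\<eta> = (\<Sum>k\<in>?G. c k *s f k)" using g fin by (simp add: \<eta>_def f'_def sum.remove)
    have G: "pairing \<eta> (w h) = c h" if "h \<in> ?G" for h
    proof -
      have "pairing \<eta> (w h) = (\<Sum>k\<in>?G. c k * pairing (w h) (f k))"
        by (simp add: \<eta> pairing_sum_left pairing_scale_left pairing_commute[of "w h"])
      also have "\<dots> = (\<Sum>k\<in>?G. if k = h then c h else 0)"
        using f that by (intro sum.cong) auto
      finally show ?thesis using that finG by simp
    qed
    have "pairing \<eta> (w g) + (\<Sum>k\<in>?G. pairing \<eta> (w k)) = pairing \<eta> (\<Sum>k\<in>\<H>. w k)"
      unfolding pairing_sum_right using g fin by (simp add: sum.remove)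
    then have "pairing \<eta> (w g) + (\<Sum>k\<in>?G. c k) = 0" using G by (simp add: relation)
    moreover have "c g + (\<Sum>k\<in>?G. c k) = 0" using c g fin by (simp add: sum.remove)
    ultimately have "pairing \<eta> (w g) = c g" by (metis add_right_cancel)
    then show ?thesis using G h unfolding \<eta>_def[symmetric] by (cases "h = g") auto
  qed
  then show thesis using that by blast
qed

lemma section_of_lift:
  assumes "\<And>q. regular_on N (\<lambda>m. \<eta> m $ q)"
  obtains s where "s \<in> sections S N" "\<And>m. m \<in> N \<Longrightarrow> lifts s m (\<eta> m)"
proof -
  define s where "s a m = (if m \<in> chart_dom S a \<inter> N then transpose (A a m) *v \<eta> m else 0)" for a m
  have "s \<in> sections S N"
  proof (rule sectionsI)
    fix a i
    have "regular_on (chart_dom S a \<inter> N) (\<lambda>m. (transpose (A a m) *v \<eta> m) $ i)"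
    proof (rule regular_on_mult_vec)
      show "regular_on (chart_dom S a \<inter> N) (\<lambda>m. transpose (A a m) $ p $ q)" for p q
        unfolding transpose_def using A_regular[of a q p] by (simp add: regular_on_subset)
      show "regular_on (chart_dom S a \<inter> N) (\<lambda>m. \<eta> m $ q)" for q
        using assms by (rule regular_on_subset) blast
    qed
    then show "regular_on (chart_dom S a \<inter> N) (\<lambda>m. s a m $ i)"
      by (rule regular_on_cong) (simp add: s_def)
  next
    show "s a m = transition S a b m *v s b m"
      if "m \<in> chart_dom S a" "m \<in> chart_dom S b" "m \<in> N" for a b m
      using transpose_transition[OF that(2,1)] that by (simp add: s_def del: transpose_matrix_vector)
  qed (auto simp: s_def)
  moreover have "lifts s m (\<eta> m)" if "m \<in> N" for m
    using that by (simp add: lifts_def s_def)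
  ultimately show thesis using that by blast
qed

text \<open>Complete the hyperplanes through \<open>l\<close> to a basis of the linear forms, with dual basis \<open>e\<close>. The
  section corresponding to \<open>\<omega>\<close> has the coefficients \<open>h(x) \<omega>(e h)\<close>, which are regular at \<open>l\<close>.\<close>

lemma \<phi>_locally_surjective:
  assumes \<omega>: "\<omega> \<in> log_forms \<H> U" and l: "l \<in> U"
  shows "\<exists>N s. zariski_open N \<and> l \<in> N \<and> N \<subseteq> U \<and> s \<in> sections S N \<and>
    (\<forall>x\<in>punctured_cone (N - (\<Union>h\<in>\<H>. hyperplane h)). \<phi> N s x = \<omega> x)"
proof -
  obtain N \<mu> u \<theta> where dec: "log_decomposition \<H> U \<omega> l N \<mu> u \<theta>"
    using \<omega> l unfolding log_forms_iff by blast
  have N: "zariski_open N" "l \<in> N" "N \<subseteq> U" and \<mu>: "\<And>m. m \<in> N \<Longrightarrow> pairing \<mu> (coords m) \<noteq> 0"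
    and u: "\<And>h. h \<in> \<H> \<Longrightarrow> regular_on N (u h)" and \<theta>: "\<theta> \<in> one_forms N"
    and \<omega>_eq: "\<And>x. x \<in> punctured_cone (N - (\<Union>h\<in>\<H>. hyperplane h)) \<Longrightarrow>
      \<omega> x = \<theta> x + (\<Sum>h\<in>{h\<in>\<H>. l \<in> hyperplane h}. u h (pt x) *s dlog (local_equation \<mu> h) x)"
    using dec unfolding log_decomposition_def by blast+
  define J where "J = {h \<in> \<H>. l \<in> hyperplane h}"
  have J: "J \<subseteq> \<H>" "finite J" using fin by (auto simp: J_def)
  have "card J < CARD('v)"
    using normal_crossing_through_point[OF nc, of "coords l"] by (simp add: J_def hyperplane_def)
  \<comment> \<open>Fewer than \<open>CARD('v)\<close> hyperplanes pass through \<open>l\<close>,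
    and \<open>\<H>\<close> has at least that many elements.\<close>
  then obtain K where K: "J \<subseteq> K" "K \<subseteq> \<H>" "card K = CARD('v)"
    using exists_subset_between[of J "CARD('v)" \<H>] J card fin by auto
  have finK: "finite K" using K fin finite_subset by blast
  have ind: "lin_indep coords K" by (rule normal_crossing_lin_indep[OF nc K(2)]) (simp add: K)
  have "\<exists>v. pairing (coords h) v = 1 \<and> (\<forall>g\<in>K. g \<noteq> h \<longrightarrow> pairing (coords g) v = 0)" if "h \<in> K" for h
    by (rule dual_vector[OF ind finK that]) blast
  then obtain e where e: "\<forall>h\<in>K. pairing (coords h) (e h) = 1 \<and> (\<forall>g\<in>K. g \<noteq> h \<longrightarrow> pairing (coords g) (e h) = 0)"
    by metis
  have expand: "a = (\<Sum>h\<in>K. pairing a (e h) *s coords h)" for a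
    by (rule dual_basis_expansion[OF ind finK K(3)]) (use e in auto)
  have expand': "pairing a y = (\<Sum>h\<in>K. pairing a (e h) * pairing (coords h) y)" for a y
    by (subst expand[of a]) (simp add: pairing_sum_left pairing_scale_left)
  have \<mu>x: "pairing \<mu> x \<noteq> 0" if "x \<in> punctured_cone N" for x
    using that \<mu>[of "pt x"] pairing_coords_pt_eq_0_iff[of x \<mu>] by (simp add: punctured_cone_iff)
  \<comment> \<open>The value of \<omega> on \<open>e h\<close>, times the equation of
    \<open>h\<close>, written out with the decomposition: the pole along \<open>h\<close> cancels
    and leaves \<open>u h\<close>, so the expression is regular on all of \<open>N\<close>,
    hyperplanes included.\<close>
  define C where "C h x = pairing (coords h) x * pairing (\<theta> x) (e h) + (if h \<in> J then u h (pt x) else 0)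
    - pairing (coords h) x * ((\<Sum>g\<in>J. u g (pt x)) * (pairing \<mu> (e h) / pairing \<mu> x))" for h x
  have C_reg: "homog_regular 0 N (C h)" for h
  proof -
    have 1: "homog_regular (1 + -1) N (\<lambda>x. pairing (coords h) x * pairing (\<theta> x) (e h))"
      unfolding pairing_def[of "\<theta> _"] mult.commute[of "\<theta> _ $ _"]
      by (intro homog_regular_mult homog_regular_pairing homog_regular_sum homog_regular_cmult one_formsD(1)[OF \<theta>])
    have 2: "homog_regular 0 N (\<lambda>x. if h \<in> J then u h (pt x) else 0)"
      using u[of h] J(1) homog_regular_const[of N 0] unfolding regular_on_def by (cases "h \<in> J") auto
    have 3: "homog_regular (1 + (0 + (0 - 1))) N (\<lambda>x. pairing (coords h) x *
        ((\<Sum>g\<in>J. u g (pt x)) * (pairing \<mu> (e h) / pairing \<mu> x)))"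
      by (intro homog_regular_mult homog_regular_pairing homog_regular_sum homog_regular_divide
          homog_regular_const \<mu>x) (use u J(1) in \<open>auto simp: regular_on_def\<close>)
    show ?thesis
      unfolding C_def[abs_def] using 1 2 3 by (intro homog_regular_diff homog_regular_add) auto
  qed
  define c where "c h m = (if h \<in> K then C h (coords m) else 0)" for h m
  have c_pt: "c h (pt x) = C h x" if "x \<in> punctured_cone N" "h \<in> K" for h x
  proof -
    have "x \<noteq> 0" using that by (simp add: punctured_cone_iff)
    then obtain t where t: "t \<noteq> 0" "coords (pt x) = t *s x" by (rule coords_pt)
    show ?thesis using homog_regular_homogeneous[OF C_reg that(1) t(1), of h] that(2) t(2) by (simp add: c_def)
  qed
  have c_reg: "regular_on N (c h)" for h
  proof (cases "h \<in> K")
    case True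
    show ?thesis
      unfolding regular_on_def using C_reg[of h] by (rule homog_regular_cong) (use c_pt True in auto)
  qed (simp add: c_def[abs_def] regular_on_const)
  \<comment> \<open>Since \<open>x\<close> is the sum of the \<open>e h\<close> weighted by the
    values of the forms at \<open>x\<close>, the sum is the contraction with the Euler field:
    \<open>\<theta>\<close> contributes 0, and the \<open>u g\<close> cancel against the term with
    \<open>\<mu>\<close>.\<close>
  have C_sum: "(\<Sum>h\<in>K. C h x) = 0" if x: "x \<in> punctured_cone N" for x
  proof -
    have "(\<Sum>h\<in>K. C h x) = pairing (\<theta> x) x + (\<Sum>h\<in>K. if h \<in> J then u h (pt x) else 0)
      - (\<Sum>g\<in>J. u g (pt x)) * (pairing \<mu> x / pairing \<mu> x)"
      unfolding expand'[of "\<theta> x" x] expand'[of \<mu> x, THEN arg_cong, of "\<lambda>r. r / pairing \<mu> x"]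
      by (simp add: C_def sum.distrib sum_subtractf sum_distrib_left sum_divide_distrib mult_ac)
    also have "(\<Sum>h\<in>K. if h \<in> J then u h (pt x) else 0) = (\<Sum>g\<in>J. u g (pt x))"
      using K(1) finK by (simp add: sum.If_cases Int_absorb1)
    finally show ?thesis using one_formsD(2)[OF \<theta> x] \<mu>x[OF x] by simp
  qed
  have c_sum: "(\<Sum>h\<in>\<H>. c h m) = 0" if "m \<in> N" for m
  proof -
    have "(\<Sum>h\<in>\<H>. c h m) = (\<Sum>h\<in>K. C h (coords m))"
      using K(2) fin by (intro sum.mono_neutral_cong_right) (auto simp: c_def)
    then show ?thesis using C_sum[of "coords m"] that by simp
  qed
  obtain f :: "'v proj \<Rightarrow> complex ^ 'w" where
    f: "\<And>c h. (\<Sum>g\<in>\<H>. c g) = 0 \<Longrightarrow> h \<in> \<H> \<Longrightarrow> pairing (\<Sum>g\<in>\<H>. c g *s f g) (w h) = c h"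
    using covector_with_values by blast
  define \<eta> where "\<eta> m = (\<Sum>g\<in>\<H>. c g m *s f g)" for m
  have "regular_on N (\<lambda>m. \<eta> m $ q)" for q
    by (simp add: \<eta>_def regular_on_sum regular_on_mult c_reg regular_on_const)
  then obtain s where s: "s \<in> sections S N" "\<And>m. m \<in> N \<Longrightarrow> lifts s m (\<eta> m)"
    by (rule section_of_lift) blast
  have "\<phi> N s x = \<omega> x" if x: "x \<in> punctured_cone (N - (\<Union>h\<in>\<H>. hyperplane h))" for x
  proof -
    have xN: "x \<in> punctured_cone N" and off: "\<And>h. h \<in> \<H> \<Longrightarrow> pairing (coords h) x \<noteq> 0"
      using x unfolding punctured_cone_Diff_hyperplanes by auto
    then have x0: "x \<noteq> 0" "pt x \<in> N" by (auto simp: punctured_cone_iff)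
    have "\<omega> x = \<theta> x + (\<Sum>g\<in>J. u g (pt x) *s ((1 / pairing (coords g) x) *s coords g - (1 / pairing \<mu> x) *s \<mu>))"
      unfolding \<omega>_eq[OF x] J_def[symmetric]
      by (intro arg_cong2[of _ _ _ _ "(+)"] sum.cong refl arg_cong2[of _ _ _ _ "(*s)"] dlog_local_equation x0 \<mu>x xN)
        (use off J in auto)
    then have \<omega>e: "pairing (\<omega> x) y = pairing (\<theta> x) y +
        (\<Sum>g\<in>J. u g (pt x) * (pairing (coords g) y / pairing (coords g) x - pairing \<mu> y / pairing \<mu> x))" for y
      by (simp add: pairing_add_left pairing_sum_left pairing_scale_left pairing_diff_left right_diff_distrib)
    have coeff: "pairing (\<omega> x) (e h) = c h (pt x) / pairing (coords h) x" if h: "h \<in> K" for h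
    proof -
      have "(\<Sum>g\<in>J. u g (pt x) * (pairing (coords g) (e h) / pairing (coords g) x)) =
        (\<Sum>g\<in>J. if g = h then u h (pt x) / pairing (coords h) x else 0)"
        using e h K(1) by (intro sum.cong) auto
      also have "\<dots> = (if h \<in> J then u h (pt x) else 0) / pairing (coords h) x"
        using J(2) by simp
      finally have "pairing (\<omega> x) (e h) = pairing (\<theta> x) (e h) + (if h \<in> J then u h (pt x) else 0) / pairing (coords h) x
        - (\<Sum>g\<in>J. u g (pt x)) * (pairing \<mu> (e h) / pairing \<mu> x)"
        unfolding \<omega>e right_diff_distrib sum_subtractf
        by (simp add: sum_distrib_right sum_divide_distrib)
      also have "\<dots> = C h x / pairing (coords h) x"
        using off[of h] h K(2) by (simp add: C_def diff_divide_distrib add_divide_distrib subset_iff)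
      finally show ?thesis using c_pt[OF xN h] by simp
    qed
    have "\<phi> N s x = form x (\<eta> (pt x))" using s(2)[OF x0(2)] by (rule \<phi>_eq[OF x])
    also have "\<dots> = (\<Sum>h\<in>\<H>. (c h (pt x) / pairing (coords h) x) *s coords h)"
      unfolding form_def \<eta>_def using f c_sum[OF x0(2)] by (intro sum.cong) auto
    also have "\<dots> = (\<Sum>h\<in>K. (c h (pt x) / pairing (coords h) x) *s coords h)"
      using K(2) fin by (intro sum.mono_neutral_right) (auto simp: c_def)
    also have "\<dots> = (\<Sum>h\<in>K. pairing (\<omega> x) (e h) *s coords h)" using coeff by simp
    also have "\<dots> = \<omega> x" by (rule expand[symmetric])
    finally show ?thesis .
  qed
  with N s(1) show ?thesis by blast
qed

text \<open>Local preimages have the same form on overlaps, so they agree there by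
  \<open>section_eqI\<close> and glue.\<close>

lemma \<phi>_surjective:
  assumes \<omega>: "\<omega> \<in> log_forms \<H> U" and U: "zariski_open U"
  obtains s where "s \<in> sections S U" "\<phi> U s = \<omega>"
proof -
  let ?X = "\<Union>h\<in>\<H>. hyperplane h"
  have "\<forall>l\<in>U. \<exists>N s. zariski_open N \<and> l \<in> N \<and> N \<subseteq> U \<and> s \<in> sections S N \<and>
    (\<forall>x\<in>punctured_cone (N - ?X). \<phi> N s x = \<omega> x)"
    using \<phi>_locally_surjective[OF \<omega>] by blast
  then obtain N \<sigma> where "\<forall>l\<in>U. zariski_open (N l) \<and> l \<in> N l \<and> N l \<subseteq> U \<and> \<sigma> l \<in> sections S (N l) \<and>
    (\<forall>x\<in>punctured_cone (N l - ?X). \<phi> (N l) (\<sigma> l) x = \<omega> x)"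
    by (metis (no_types, lifting) bchoice)
  then have N: "\<And>l. l \<in> U \<Longrightarrow> zariski_open (N l)" "\<And>l. l \<in> U \<Longrightarrow> l \<in> N l" "\<And>l. l \<in> U \<Longrightarrow> N l \<subseteq> U"
    and \<sigma>: "\<And>l. l \<in> U \<Longrightarrow> \<sigma> l \<in> sections S (N l)"
      "\<And>l x. l \<in> U \<Longrightarrow> x \<in> punctured_cone (N l - ?X) \<Longrightarrow> \<phi> (N l) (\<sigma> l) x = \<omega> x"
    by blast+
  have agree: "\<sigma> l a p = \<sigma> m a p" if lm: "l \<in> U" "m \<in> U" and p: "p \<in> N l" "p \<in> N m" for l m a p
  proof -
    let ?V = "N l \<inter> N m"
    have V: "zariski_open ?V" using N(1) lm by blast
    let ?s = "\<lambda>k a x. if x \<in> ?V then \<sigma> k a x else 0"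
    have sec: "?s l \<in> sections S ?V" "?s m \<in> sections S ?V"
      by (rule sections_restrict[OF \<sigma>(1)]; use lm in blast)+
    have "?s l = ?s m"
    proof (rule section_eqI[OF sec V])
      fix x assume x: "x \<in> punctured_cone (?V - ?X)"
      then have xs: "x \<in> punctured_cone ?V" "x \<in> punctured_cone (N l - ?X)" "x \<in> punctured_cone (N m - ?X)"
        unfolding punctured_cone_iff by blast+
      have "\<phi> ?V (?s l) x = \<omega> x"
        unfolding \<phi>_restrict[OF \<sigma>(1)[OF lm(1)] N(1)[OF lm(1)] Int_lower1]
        using xs \<sigma>(2)[OF lm(1)] by (simp del: punctured_cone_Int)
      moreover have "\<phi> ?V (?s m) x = \<omega> x"
        unfolding \<phi>_restrict[OF \<sigma>(1)[OF lm(2)] N(1)[OF lm(2)] Int_lower2]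
        using xs \<sigma>(2)[OF lm(2)] by (simp del: punctured_cone_Int)
      ultimately show "\<phi> ?V (?s l) x = \<phi> ?V (?s m) x" by simp
    qed
    from fun_cong[OF fun_cong[OF this, of a], of p] p show ?thesis by simp
  qed
  \<comment> \<open>The value at \<open>l\<close> is taken from the section chosen for
    \<open>l\<close> itself; by \<open>agree\<close> every other section defined at \<open>l\<close>
    gives the same value.\<close>
  define s where "s a l = (if l \<in> U then \<sigma> l a l else 0)" for a l
  have s_eq: "s a m = \<sigma> l a m" if "l \<in> U" "m \<in> N l" for a l m
  proof -
    have "m \<in> U" using that N(3) by blast
    then show ?thesis using agree[of m l m a] that N(2) by (simp add: s_def)
  qed
  have s: "s \<in> sections S U"
  proof (rule sectionsI)
    fix a i
    show "regular_on (chart_dom S a \<inter> U) (\<lambda>x. s a x $ i)"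
    proof (rule regular_on_local)
      fix l assume "l \<in> chart_dom S a \<inter> U"
      then have l: "l \<in> U" by blast
      have "regular_on (chart_dom S a \<inter> N l) (\<lambda>x. s a x $ i)"
        using sections_regular[OF \<sigma>(1)[OF l], of a i] by (rule regular_on_cong) (use s_eq[OF l] in auto)
      then have "regular_on (N l \<inter> (chart_dom S a \<inter> U)) (\<lambda>x. s a x $ i)"
        by (rule regular_on_subset) blast
      then show "\<exists>N. zariski_open N \<and> l \<in> N \<and> regular_on (N \<inter> (chart_dom S a \<inter> U)) (\<lambda>x. s a x $ i)"
        using N l by blast
    qed
  next
    show "s a l = transition S a b l *v s b l"
      if "l \<in> chart_dom S a" "l \<in> chart_dom S b" "l \<in> U" for a b l
      using sections_transition[OF \<sigma>(1)[OF that(3)] that(1,2) N(2)[OF that(3)]] that(3) by (simp add: s_def)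
  next
    show "s a l = 0" if "l \<notin> chart_dom S a \<inter> U" for a l
      using that sections_outside[OF \<sigma>(1), of l l a] by (auto simp: s_def)
  qed
  moreover have "\<phi> U s = \<omega>"
  proof
    fix x
    show "\<phi> U s x = \<omega> x"
    proof (cases "x \<in> punctured_cone (U - ?X)")
      case True
      then have l: "pt x \<in> U" by (simp add: punctured_cone_iff)
      have xN: "x \<in> punctured_cone (N (pt x) - ?X)"
        using True N(2)[OF l] unfolding punctured_cone_iff by blast
      obtain \<eta> where \<eta>: "lifts (\<sigma> (pt x)) (pt x) \<eta>" using obtain_lift[OF \<sigma>(1)[OF l] N(1)[OF l] xN] .
      then have "lifts s (pt x) \<eta>" using l by (simp add: lifts_def s_def)
      from \<phi>_eq[OF True this] have "\<phi> U s x = \<phi> (N (pt x)) (\<sigma> (pt x)) x"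
        by (simp add: \<phi>_eq[OF xN \<eta>])
      then show ?thesis using \<sigma>(2)[OF l xN] by simp
    next
      case False
      have "\<omega> \<in> one_forms (U - ?X)" using \<omega> unfolding log_forms_iff by blast
      from one_formsD(3)[OF this False] show ?thesis by (simp add: \<phi>_outside[OF False])
    qed
  qed
  ultimately show thesis using that by blast
qed

theorem sheaf_iso_log_\<phi>: "sheaf_iso_log S \<H> \<phi>"
  unfolding sheaf_iso_log_def
proof (intro allI impI conjI ballI)
  fix U :: "'v proj set" assume U: "zariski_open U"
  show "bij_betw (\<phi> U) (sections S U) (log_forms \<H> U)"
  proof (rule bij_betw_imageI)
    show "inj_on (\<phi> U) (sections S U)"
      by (intro inj_onI section_eqI[OF _ _ U]) auto
    show "\<phi> U ` sections S U = log_forms \<H> U"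
    proof (intro equalityI subsetI)
      fix \<omega> assume "\<omega> \<in> log_forms \<H> U"
      then obtain s where "s \<in> sections S U" "\<phi> U s = \<omega>" using \<phi>_surjective[OF _ U] by blast
      then show "\<omega> \<in> \<phi> U ` sections S U" by blast
    qed (use \<phi>_in_log_forms[OF _ U] in blast)
  qed
next
  fix U s t assume "zariski_open U" "s \<in> sections S U" "t \<in> sections S U"
  then show "\<phi> U (\<lambda>a x. s a x + t a x) = (\<lambda>x. \<phi> U s x + \<phi> U t x)" by (intro \<phi>_add)
next
  fix U f s assume "zariski_open U" "s \<in> sections S U"
  then show "\<phi> U (\<lambda>a x. f x *s s a x) = (\<lambda>x. f (pt x) *s \<phi> U s x)" by (intro \<phi>_scale)
next
  fix U U' s assume "zariski_open U" "s \<in> sections S U" "zariski_open U' \<and> U' \<subseteq> U"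
  then show "\<phi> U' (\<lambda>a x. if x \<in> U' then s a x else 0) = (\<lambda>x. if x \<in> punctured_cone U' then \<phi> U s x else 0)"
    by (intro \<phi>_restrict) auto
qed

end


subsection \<open>The criterion\<close>

lemma lin_indep_coords_pair:
  assumes "s \<noteq> (t :: 'v::finite proj)"
  shows "lin_indep coords {s, t}"
proof (rule lin_indep_insert)
  show "lin_indep coords {t}" by (simp add: lin_indep_def)
  fix c
  show "coords s \<noteq> (\<Sum>r\<in>{t}. c r *s coords r)"
  proof
    assume "coords s = (\<Sum>r\<in>{t}. c r *s coords r)"
    then have "coords s = c t *s coords t" by simp
    then have "pt (coords t) = pt (coords s)" by (subst pt_eq_iff) auto
    with assms show False by simp
  qed
qed (use assms in auto)

lemma lin_indep_scale:
  assumes "lin_indep f T" "\<And>t. t \<in> T \<Longrightarrow> e t \<noteq> 0"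
  shows "lin_indep (\<lambda>t. e t *s f t) T"
  unfolding lin_indep_def
proof (intro allI impI ballI)
  fix c t assume c: "(\<Sum>t\<in>T. c t *s (e t *s f t)) = 0" and t: "t \<in> T"
  then have "(\<Sum>t\<in>T. (c t * e t) *s f t) = 0" by (simp add: vector_smult_assoc)
  from lin_indepD[OF assms(1) this t] assms(2)[OF t] show "c t = 0" by simp
qed

lemma normal_crossing_if_lin_indep:
  fixes \<H> :: "'v::finite proj set"
  assumes "finite \<H>" "\<And>M. M \<subseteq> \<H> \<Longrightarrow> card M \<le> CARD('v) \<Longrightarrow> lin_indep coords M"
  shows "normal_crossing \<H>"
  unfolding normal_crossing_def
proof (intro conjI allI impI)
  fix M assume M: "M \<subseteq> \<H>" "card M \<le> CARD('v)"
  show "vec.independent (coords ` M)"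
    by (rule lin_indep_imp_independent(2)[OF assms(2)[OF M]]) (use M assms(1) finite_subset in blast)
qed fact

text \<open>Take the coordinate hyperplanes and the zero set of the sum of the coordinates: the only
  relation among these forms involves all of them, so every proper subfamily is independent. With
  \<open>2 \<le> CARD('v)\<close> pairs are proper subfamilies, so the hyperplanes are
  distinct.\<close>

lemma ex_normal_crossing:
  assumes v: "2 \<le> CARD('v::finite)"
  obtains \<H> :: "'v::finite proj set" where "normal_crossing \<H>" "card \<H> = CARD('v) + 1"
proof -
  define f :: "'v option \<Rightarrow> complex ^ 'v" where
    "f = (\<lambda>t. case t of None \<Rightarrow> (\<chi> i. 1) | Some i \<Rightarrow> axis i 1)"
  have ind: "lin_indep f R" if R: "R \<noteq> UNIV" for R
    unfolding lin_indep_def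
  proof (intro allI impI)
    fix c assume c: "(\<Sum>t\<in>R. c t *s f t) = 0"
    define d where "d t = (if t \<in> R then c t else 0)" for t
    have "(\<Sum>t\<in>UNIV. d t *s f t) = (\<Sum>t\<in>R. c t *s f t)"
      by (intro sum.mono_neutral_cong_right) (auto simp: d_def)
    then have sum0: "(\<Sum>t\<in>UNIV. d t *s f t) = 0" using c by simp
    have comp: "d None + d (Some i) = 0" for i
    proof -
      have "(\<Sum>t\<in>UNIV. d t *s f t) $ i = d None + (\<Sum>j\<in>UNIV. d (Some j) * axis j 1 $ i)"
        by (simp add: UNIV_option_conv sum.reindex f_def)
      also have "(\<Sum>j\<in>UNIV. d (Some j) * axis j 1 $ i) = (\<Sum>j\<in>UNIV. if j = i then d (Some i) else 0)"
        by (intro sum.cong) (auto simp: axis_def)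
      finally show ?thesis using sum0 by simp
    qed
    obtain t where "t \<notin> R" using R by blast
    then have "d t = 0" by (simp add: d_def)
    have None0: "d None = 0"
    proof (cases t)
      case (Some i)
      then show ?thesis using \<open>d t = 0\<close> comp[of i] by simp
    qed (use \<open>d t = 0\<close> in simp)
    have d0: "d s = 0" for s
    proof (cases s)
      case (Some i)
      then show ?thesis using None0 comp[of i] by simp
    qed (use None0 in simp)
    show "\<forall>t\<in>R. c t = 0"
    proof
      fix s assume "s \<in> R"
      then show "c s = 0" using d0[of s] by (simp add: d_def)
    qed
  qed
  have card_opt: "card (UNIV :: 'v option set) = CARD('v) + 1"
    by (simp add: UNIV_option_conv card_image)
  have f0: "f t \<noteq> 0" for t
  proof (rule lin_indep_nonzero[of f "{t}" t])
    have "card {t} \<noteq> card (UNIV :: 'v option set)" using card_opt v by simp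
    then show "lin_indep f {t}" by (intro ind) metis
  qed auto
  have inj: "inj (\<lambda>t. pt (f t))"
  proof (rule injI, rule ccontr)
    fix s t assume eq: "pt (f s) = pt (f t)" and ne: "s \<noteq> t"
    then obtain c where c: "f t = c *s f s" using pt_eq_iff[OF f0 f0] by blast
    have "card {s, t} \<noteq> card (UNIV :: 'v option set)" using card_opt v ne by simp
    then have "lin_indep f {s, t}" by (intro ind) metis
    moreover have "(\<Sum>r\<in>{s, t}. (if r = s then c else - 1) *s f r) = 0" using ne c by simp
    ultimately have "(if t = s then c else - 1) = 0" by (rule lin_indepD) simp
    then show False using ne by simp
  qed
  define \<H> where "\<H> = range (\<lambda>t. pt (f t))"
  have "normal_crossing \<H>"
  proof (rule normal_crossing_if_lin_indep)
    fix M assume M: "M \<subseteq> \<H>" "card M \<le> CARD('v)"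
    define R where "R = {t. pt (f t) \<in> M}"
    have MR: "M = (\<lambda>t. pt (f t)) ` R" using M(1) by (auto simp: R_def \<H>_def)
    have "card M = card R" unfolding MR using inj by (intro card_image) (rule inj_on_subset, auto)
    then have "R \<noteq> UNIV" using M(2) card_opt by auto
    have "\<forall>t. \<exists>e. e \<noteq> 0 \<and> coords (pt (f t)) = e *s f t" using coords_pt[OF f0] by metis
    then obtain e where e: "\<And>t. e t \<noteq> 0" "\<And>t. coords (pt (f t)) = e t *s f t" by metis
    have "lin_indep (\<lambda>t. e t *s f t) R" by (rule lin_indep_scale[OF ind[OF \<open>R \<noteq> UNIV\<close>] e(1)])
    then have R_ind: "lin_indep (\<lambda>t. coords (pt (f t))) R" by (simp add: e(2))
    show "lin_indep coords M"
      unfolding lin_indep_def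
    proof (intro allI impI ballI)
      fix c m assume c: "(\<Sum>t\<in>M. c t *s coords t) = 0" and m: "m \<in> M"
      obtain t where t: "t \<in> R" "m = pt (f t)" using m MR by blast
      have "(\<Sum>t\<in>R. c (pt (f t)) *s coords (pt (f t))) = (\<Sum>t\<in>M. c t *s coords t)"
        unfolding MR using inj by (subst sum.reindex) (auto intro: inj_on_subset)
      with c have "(\<Sum>t\<in>R. c (pt (f t)) *s coords (pt (f t))) = 0" by simp
      from lin_indepD[OF R_ind this t(1)] t(2) show "c m = 0" by simp
    qed
  qed (simp add: \<H>_def)
  moreover have "card \<H> = CARD('v) + 1"
    unfolding \<H>_def using inj by (simp add: card_image card_opt)
  ultimately show thesis using that by blast
qed

context steiner_map
begin

text \<open>For a line I, the covector \<open>adj x \<iota>\<close> depends injectively on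
  \<open>x\<close> by \<open>adj_eq_0D\<close>. Vectors dual to its values on the coordinate axes
  define \<open>W\<close>, which attaches a pure tensor to every linear form.\<close>

lemma rank_one_tensors:
  assumes i: "CARD('i) = 1"
  obtains W :: "complex ^ 'v \<Rightarrow> complex ^ 'w" and \<iota> where
    "\<And>a x. B x (W a) = pairing a x *s \<iota>" "\<iota> \<noteq> 0"
proof -
  define \<iota> :: "complex ^ 'i" where "\<iota> = (\<chi> i. 1)"
  have \<iota>: "\<iota> \<noteq> 0" by (simp add: \<iota>_def vec_eq_iff)
  obtain j where j: "(UNIV :: 'i set) = {j}" using i card_1_singletonE by blast
  have all_j: "k = j" for k :: 'i using j by blast
  have coord: "y = pairing \<iota> y *s \<iota>" for y
  proof -
    have "y $ k = (pairing \<iota> y *s \<iota>) $ k" for k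
      using all_j[of k] by (simp add: pairing_def \<iota>_def j)
    then show ?thesis unfolding vec_eq_iff by blast
  qed
  have "lin_indep (\<lambda>u. adj (axis u 1) \<iota>) UNIV"
    unfolding lin_indep_def
  proof (intro allI impI ballI)
    fix c u assume c: "(\<Sum>u\<in>UNIV. c u *s adj (axis u 1) \<iota>) = 0"
    have "adj (\<Sum>u\<in>U. c u *s axis u 1) \<iota> = (\<Sum>u\<in>U. c u *s adj (axis u 1) \<iota>)" for U
    proof (induction U rule: infinite_finite_induct)
      case empty
      show ?case using adj_scale_left[of 0 0 \<iota>] by simp
    next
      case infinite
      then show ?case by simp
    qed (simp add: adj_add_left adj_scale_left)
    then have "adj (\<Sum>u\<in>UNIV. c u *s axis u 1) \<iota> = 0" using c by simp
    then have "(\<Sum>u\<in>UNIV. c u *s axis u (1 :: complex)) = 0" using adj_eq_0D \<iota> by blast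
    then have "(\<chi> u. c u) = 0" using basis_expansion[of "\<chi> u. c u"] by simp
    then show "c u = 0" by (simp add: vec_eq_iff)
  qed
  then have "\<exists>d. pairing (adj (axis u 1) \<iota>) d = 1 \<and>
      (\<forall>u'. u' \<noteq> u \<longrightarrow> pairing (adj (axis u' 1) \<iota>) d = 0)" for u
    by (rule dual_vector[of _ UNIV u]) auto
  then obtain d where d: "\<And>u. pairing (adj (axis u 1) \<iota>) (d u) = 1"
    "\<And>u u'. u' \<noteq> u \<Longrightarrow> pairing (adj (axis u' 1) \<iota>) (d u) = 0"
    by metis
  have Bd: "B x (d u) = x $ u *s \<iota>" for x u
  proof -
    have ax: "B (axis u' 1) (d u) = (if u' = u then 1 else 0) *s \<iota>" for u'
      using coord[of "B (axis u' 1) (d u)"] d(1)[of u] d(2)[of u' u] by (auto simp: pairing_adj)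
    have "B x (d u) = B (\<Sum>u'\<in>UNIV. x $ u' *s axis u' 1) (d u)" by (simp only: basis_expansion)
    also have "\<dots> = (\<Sum>u'\<in>UNIV. x $ u' *s B (axis u' 1) (d u))" by (simp add: sum_left scale_left)
    also have "\<dots> = (\<Sum>u'\<in>UNIV. if u' = u then x $ u *s \<iota> else 0)"
      unfolding ax by (intro sum.cong) auto
    finally show ?thesis by simp
  qed
  define W where "W a = (\<Sum>u\<in>UNIV. a $ u *s d u)" for a
  have "B x (W a) = pairing a x *s \<iota>" for a x
    by (simp add: W_def sum_right scale_right Bd pairing_def vec.scale_sum_left vector_smult_assoc)
  with \<iota> that show thesis by blast
qed

end

context steiner_resolution
begin

text \<open>The coefficients of the unique relation are all nonzero, so they can be absorbed into
  \<open>w\<close> and \<open>\<iota>\<close>; this is the normalisation that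
  \<open>steiner_log\<close> requires.\<close>

lemma logarithmic_if_tensors:
  assumes nc: "normal_crossing \<H>" and card: "card \<H> = CARD('w) + 1" and v: "2 \<le> CARD('v)"
    and tensors: "steiner_tensors B \<H> coords w \<iota>"
  shows "\<exists>\<phi>. sheaf_iso_log S \<H> \<phi>"
proof -
  interpret steiner_tensors B \<H> coords w \<iota> by fact
  obtain c where c: "\<And>h. h \<in> \<H> \<Longrightarrow> c h \<noteq> 0" "(\<Sum>h\<in>\<H>. c h *s w h) = 0"
    "\<And>d. (\<Sum>h\<in>\<H>. d h *s w h) = 0 \<Longrightarrow> \<exists>e. \<forall>h\<in>\<H>. d h = e * c h"
    using unique_relation[OF normal_crossing_lin_indep[OF nc] card] by blast
  have "steiner_log B S A \<H> (\<lambda>h. c h *s w h) (\<lambda>h. c h *s \<iota> h)"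
  proof unfold_locales
    show "CARD('v) \<le> card \<H>"
    proof -
      have "0 < CARD('i)" by simp
      then show ?thesis using card dims by linarith
    qed
    show "B x (c h *s w h) = pairing (coords h) x *s (c h *s \<iota> h)" if "h \<in> \<H>" for h x
      using tensor[OF that] by (simp add: scale_right vector_smult_assoc mult.commute)
    show "\<exists>e. \<forall>h\<in>\<H>. d h = e" if "(\<Sum>h\<in>\<H>. d h *s (c h *s w h)) = 0" for d
    proof -
      have "(\<Sum>h\<in>\<H>. (d h * c h) *s w h) = 0" using that by (simp add: vector_smult_assoc)
      then obtain e where "\<forall>h\<in>\<H>. d h * c h = e * c h" using c(3)[of "\<lambda>h. d h * c h"] by blast
      then have "\<forall>h\<in>\<H>. d h = e" using c(1) by simp
      then show ?thesis by blast
    qed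
  qed (use nc c(2) in auto)
  then show ?thesis using steiner_log.sheaf_iso_log_\<phi> by blast
qed

theorem logarithmic_iff_unstable:
  "logarithmic_bundle (CARD('w) + 1) S \<longleftrightarrow>
    (\<exists>\<H>. finite \<H> \<and> CARD('w) + 1 \<le> card \<H> \<and> (\<forall>h\<in>\<H>. unstable_hyperplane S h))"
proof -
  have v: "2 \<le> CARD('v)"
  proof -
    have "0 < CARD('r)" by simp
    then show ?thesis using rank by linarith
  qed
  have w: "1 \<le> CARD('w)" by (simp add: Suc_le_eq)
  show ?thesis
  proof
    assume "logarithmic_bundle (CARD('w) + 1) S"
    then obtain \<H> \<phi> where nc: "normal_crossing \<H>" and card: "card \<H> = CARD('w) + 1"
      and iso: "sheaf_iso_log S \<H> \<phi>"
      unfolding logarithmic_bundle_def by blast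
    have fin: "finite \<H>" using nc by (simp add: normal_crossing_def)
    have "unstable_hyperplane S h" if h: "h \<in> \<H>" for h
    proof -
      \<comment> \<open>A second hyperplane exists because \<open>CARD('w) + 1 \<ge> 2\<close>; it
        balances the residue in \<open>logarithmic_imp_unstable\<close>.\<close>
      have "card (\<H> - {h}) \<noteq> 0" using card h fin w by simp
      then obtain h' where "h' \<in> \<H>" "h' \<noteq> h" by (metis Diff_iff card.empty ex_in_conv insertI1)
      then show ?thesis using logarithmic_imp_unstable[OF iso S nc h _ _ v] by blast
    qed
    then show "\<exists>\<H>. finite \<H> \<and> CARD('w) + 1 \<le> card \<H> \<and> (\<forall>h\<in>\<H>. unstable_hyperplane S h)"
      using fin card by (intro exI[of _ \<H>]) auto
  next
    assume "\<exists>\<H>. finite \<H> \<and> CARD('w) + 1 \<le> card \<H> \<and> (\<forall>h\<in>\<H>. unstable_hyperplane S h)"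
    then obtain \<H>0 where \<H>0: "CARD('w) + 1 \<le> card \<H>0" "\<forall>h\<in>\<H>0. unstable_hyperplane S h" by blast
    show "logarithmic_bundle (CARD('w) + 1) S"
    proof (cases "CARD('i) = 1")
      case True
      \<comment> \<open>The given hyperplanes may be in special position here, so a fresh set is
        used; \<open>CARD('w) = CARD('v)\<close> makes its size the required one.\<close>
      obtain \<H> :: "'v proj set" where nc: "normal_crossing \<H>" and card: "card \<H> = CARD('v) + 1"
        using ex_normal_crossing[OF v] .
      have card': "card \<H> = CARD('w) + 1" using card dims True by simp
      obtain W :: "complex ^ 'v \<Rightarrow> complex ^ 'w" and \<iota> where
        W: "\<And>a x. B x (W a) = pairing a x *s \<iota>" and \<iota>: "\<iota> \<noteq> 0"
        using rank_one_tensors[OF True] by blast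
      have "steiner_tensors B \<H> coords (\<lambda>h. W (coords h)) (\<lambda>_. \<iota>)"
      proof unfold_locales
        show "finite \<H>" using nc by (simp add: normal_crossing_def)
        show "W (coords h) \<noteq> 0" for h
        proof
          assume "W (coords h) = 0"
          then have "pairing (coords h) x = 0" for x using W[of x "coords h"] \<iota> by simp
          then have "coords h = 0" by (rule pairing_eq_0I)
          then show False by simp
        qed
      qed (simp_all add: W lin_indep_coords_pair)
      then show ?thesis
        unfolding logarithmic_bundle_def using logarithmic_if_tensors[OF nc card' v] nc card' by blast
    next
      case False
      then have i: "2 \<le> CARD('i)" using zero_less_card_finite[where 'a = 'i] by linarith
      \<comment> \<open>Exactly \<open>CARD('w) + 1\<close> hyperplanes are kept, as uniqueness of
        the relation depends on this number.\<close>
      obtain \<H> where \<H>: "\<H> \<subseteq> \<H>0" "card \<H> = CARD('w) + 1"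
        using obtain_subset_with_card_n[OF \<H>0(1)] by metis
      have fin: "finite \<H>" using \<H>(2) by (intro card_ge_0_finite) simp
      have "\<exists>w \<iota>. w \<noteq> 0 \<and> (\<forall>x. B x w = pairing (coords h) x *s \<iota>)" if h: "h \<in> \<H>" for h
      proof -
        have "unstable_hyperplane S h" using \<H>0(2) \<H>(1) h by blast
        then obtain w \<iota> where "w \<noteq> 0" "\<And>x. B x w = pairing (coords h) x *s \<iota>"
          using unstable_hyperplane_tensor by blast
        then show ?thesis by (intro exI conjI allI)
      qed
      then have "\<forall>h\<in>\<H>. \<exists>w \<iota>. w \<noteq> 0 \<and> (\<forall>x. B x w = pairing (coords h) x *s \<iota>)" by blast
      then obtain w where "\<forall>h\<in>\<H>. \<exists>\<iota>. w h \<noteq> 0 \<and> (\<forall>x. B x (w h) = pairing (coords h) x *s \<iota>)"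
        by (rule bchoice[THEN exE])
      then obtain \<iota> where w: "\<forall>h\<in>\<H>. w h \<noteq> 0 \<and> (\<forall>x. B x (w h) = pairing (coords h) x *s \<iota> h)"
        by (rule bchoice[THEN exE])
      have T: "steiner_tensors B \<H> coords w \<iota>"
        by unfold_locales (use fin w lin_indep_coords_pair in auto)
      have nc: "normal_crossing \<H>"
        by (rule normal_crossing_if_lin_indep[OF fin]) (rule steiner_tensors.h_indep[OF T _ _ i])
      show ?thesis
        unfolding logarithmic_bundle_def using logarithmic_if_tensors[OF nc \<H>(2) v T] nc \<H>(2) by blast
    qed
  qed
qed

end

theorem corollary5p4:
  fixes S :: "('a, 'v::finite, 'r::finite) vbundle"
    and n k :: nat
  assumes "CARD('v) = n + 1"
    and "CARD('w::finite) = n + k"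
    and "CARD('i::finite) = k"
    and "steiner_bundle TYPE('w) TYPE('i) S"
  shows "logarithmic_bundle (n + k + 1) S \<longleftrightarrow>
    (\<exists>\<H>. finite \<H> \<and> n + k + 1 \<le> card \<H> \<and> (\<forall>h\<in>\<H>. unstable_hyperplane S h))"
proof -
  have "CARD('w) + 1 = CARD('v) + CARD('i)" using assms(1-3) by simp
  then obtain B :: "complex ^ 'v \<Rightarrow> complex ^ 'w \<Rightarrow> complex ^ 'i" and A
    where "steiner_resolution B S A"
    using steiner_bundle_resolution[OF assms(4)] by blast
  then interpret steiner_resolution B S A .
  show ?thesis using logarithmic_iff_unstable by (simp only: assms(2))
qed

end
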